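(* Let $m\ge1$. (i) Every left-convergent sequence $(G_n)_{n\in\mathbb N}$ of finite $m$-partite cographs has as QF-limit (hence, via the associated random-free graphon, as left-limit) a Borel graph of the form $\mathsf I(\mathbf T,\mu)$ for some colored Borel tree-semilattice $\mathbf T$ with atomless probability measure $\mu$. (ii) Conversely, for every colored Borel tree-semilattice $\mathbf T$ with atomless probability measure $\mu$, the Borel graph $\mathsf I(\mathbf T,\mu)$ is the QF-limit of a sequence of finite $m$-partite cographs.
   Context: A graph $G$ is an $m$-partite cograph if there is a rooted tree whose leaves are the vertices of $G$, colored by labels in $\{1,\dots,m\}$, with each internal node $v$ assigned a symmetric $f_v:\{1,\dots,m\}^2\to\{0,1\}$, such that vertices $x,y$ with colors $i,j$ are adjacent iff their least common ancestor $v$ satisfies $f_v(i,j)=1$. A tree-semilattice is $(T,\wedge)$ with $\wedge$ idempotent, commutative, associative, and such that $x\wedge z=x$ and $y\wedge z=y$ imply $x\wedge y\in\{x,y\}$; it is Borel if $T$ is a standard Borel space and $\wedge$ is Borel. Here "colored" means equipped with Borel unary relations $L_1,\dots,L_m$ and $P_f$ for $f\in\{0,1\}^{\{1,\dots,m\}\times\{1,\dots,m\}}$. The interpretation $\mathsf I(\mathbf T,\mu)$ of such a structure with a Borel probability measure $\mu$ is the Borel graph whose vertex set is the support of $\mu$, with measure $\nu$ the restriction of $\mu$, in which $x,y$ are adjacent iff there are $i,j\in\{1,\dots,m\}$ and $f$ with $f(i,j)=1$, $L_i(x)$, $L_j(y)$ and $P_f(x\wedge y)$. A Borel graph is a standard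 Borel vertex set with Borel symmetric edge set and a probability measure $\nu$; it is the QF-limit of finite graphs $G_n$ (with uniform measures) if $\langle\phi,G_n\rangle\to\langle\phi,(G,\nu)\rangle$ for all quantifier-free $\phi$, where $\langle\phi,(G,\nu)\rangle=\nu^{\otimes p}$ of the set of satisfying $p$-tuples. A sequence of finite graphs is left-convergent if $\hom(F,G_n)/|G_n|^{|F|}$ converges for every finite graph $F$. A measure is atomless if singletons have measure $0$.
   Formalization: In (i) the QF-limit is claimed when |G_n| → ∞ (false for constant K_1), the left-limit always; the color relations L_1,…,L_m are taken pairwise disjoint; adjacency in I(T,μ) is between distinct points, and in (ii) it is assumed symmetric. *)

theory Defs
  imports "HOL-Probability.Probability"
begin

section \<open>Finite graphs and m-partite cographs\<close>

text \<open>Finite graphs have their vertices in \<^typ>\<open>nat\<close>, which is no restriction up to isomorphism.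
  Only the values of \<open>adj\<close> on \<open>verts\<close> matter.\<close>

record 'a graph =
  verts :: "'a set"
  adj :: "'a \<Rightarrow> 'a \<Rightarrow> bool"

definition finite_graph :: "'a graph \<Rightarrow> bool" where
  "finite_graph G \<longleftrightarrow> finite (verts G)
     \<and> (\<forall>x\<in>verts G. \<forall>y\<in>verts G. adj G x y \<longrightarrow> adj G y x)
     \<and> (\<forall>x\<in>verts G. \<not> adj G x x)"

text \<open>Finite rooted trees: node set \<open>N\<close>, root \<open>r\<close>, arcs \<open>A\<close> from parents to children. Acyclicity
  follows, as every node is reachable from the root and has at most one parent. The ancestor
  relation is \<open>A\<^sup>*\<close>, so a node counts as its own ancestor.\<close>

definition rooted_tree :: "'a set \<Rightarrow> 'a \<Rightarrow> ('a \<times> 'a) set \<Rightarrow> bool" where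
  "rooted_tree N r A \<longleftrightarrow> finite N \<and> r \<in> N \<and> A \<subseteq> N \<times> N
     \<and> (\<forall>v. (v, r) \<notin> A)
     \<and> (\<forall>u u' v. (u, v) \<in> A \<and> (u', v) \<in> A \<longrightarrow> u = u')
     \<and> (\<forall>v\<in>N. (r, v) \<in> A\<^sup>*)"

definition tree_leaves :: "'a set \<Rightarrow> ('a \<times> 'a) set \<Rightarrow> 'a set" where
  "tree_leaves N A = {v \<in> N. \<forall>w. (v, w) \<notin> A}"

definition is_lca :: "('a \<times> 'a) set \<Rightarrow> 'a \<Rightarrow> 'a \<Rightarrow> 'a \<Rightarrow> bool" where
  "is_lca A x y v \<longleftrightarrow> (v, x) \<in> A\<^sup>* \<and> (v, y) \<in> A\<^sup>*
     \<and> (\<forall>u. (u, x) \<in> A\<^sup>* \<and> (u, y) \<in> A\<^sup>* \<longrightarrow> (u, v) \<in> A\<^sup>*)"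

definition binary_maps :: "nat \<Rightarrow> (nat \<times> nat \<Rightarrow> nat) set" where
  "binary_maps m = ({1..m} \<times> {1..m}) \<rightarrow>\<^sub>E {0, 1}"

definition m_partite_cograph :: "nat \<Rightarrow> nat graph \<Rightarrow> bool" where
  "m_partite_cograph m G \<longleftrightarrow> finite_graph G \<and>
     (\<exists>N r A c f. rooted_tree N r A \<and> tree_leaves N A = verts G
        \<and> (\<forall>x\<in>verts G. c x \<in> {1..m})
        \<and> (\<forall>v\<in>N - verts G. f v \<in> binary_maps m
              \<and> (\<forall>i\<in>{1..m}. \<forall>j\<in>{1..m}. f v (i, j) = f v (j, i)))
        \<and> (\<forall>x\<in>verts G. \<forall>y\<in>verts G. \<forall>v. x \<noteq> y \<and> is_lca A x y v \<longrightarrow>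
              (adj G x y \<longleftrightarrow> f v (c x, c y) = 1)))"

section \<open>Left convergence\<close>

definition hom_count :: "nat graph \<Rightarrow> nat graph \<Rightarrow> nat" where
  "hom_count F G = card {h \<in> verts F \<rightarrow>\<^sub>E verts G.
     \<forall>x\<in>verts F. \<forall>y\<in>verts F. adj F x y \<longrightarrow> adj G (h x) (h y)}"

definition hom_density :: "nat graph \<Rightarrow> nat graph \<Rightarrow> real" where
  "hom_density F G = real (hom_count F G) / real (card (verts G)) ^ card (verts F)"

definition left_convergent :: "(nat \<Rightarrow> nat graph) \<Rightarrow> bool" where
  "left_convergent G \<longleftrightarrow> (\<forall>F. finite_graph F \<longrightarrow> convergent (\<lambda>n. hom_density F (G n)))"

text \<open>Graphons over an arbitrary probability space. The condition \<open>i < j\<close> makes every undirected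
  edge contribute a single factor.\<close>

definition graphon_density :: "nat graph \<Rightarrow> 'a measure \<Rightarrow> ('a \<Rightarrow> 'a \<Rightarrow> real) \<Rightarrow> real" where
  "graphon_density F \<nu> W = (\<integral>x. (\<Prod>(i, j)\<in>{(i, j). i \<in> verts F \<and> j \<in> verts F \<and> i < j \<and> adj F i j}.
       W (x i) (x j)) \<partial>(\<Pi>\<^sub>M i\<in>verts F. \<nu>))"

definition left_limit :: "(nat \<Rightarrow> nat graph) \<Rightarrow> 'a measure \<Rightarrow> ('a \<Rightarrow> 'a \<Rightarrow> real) \<Rightarrow> bool" where
  "left_limit G \<nu> W \<longleftrightarrow> (\<forall>F. finite_graph F \<longrightarrow>
     (\<lambda>n. hom_density F (G n)) \<longlonglongrightarrow> graphon_density F \<nu> W)"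

text \<open>The \<open>{0, 1}\<close>-valued (i.e. random-free) graphon associated with an edge relation.\<close>

definition random_free_graphon :: "('a \<Rightarrow> 'a \<Rightarrow> bool) \<Rightarrow> 'a \<Rightarrow> 'a \<Rightarrow> real" where
  "random_free_graphon E x y = of_bool (E x y)"

section \<open>Quantifier-free formulas and QF-limits\<close>

text \<open>First-order quantifier-free formulas, with equality, in the language of graphs; variables
  are natural numbers, and the remaining connectives are definable.\<close>

datatype qf_formula =
    Eq nat nat
  | Adj nat nat
  | Neg qf_formula
  | Conj qf_formula qf_formula

primrec qf_vars :: "qf_formula \<Rightarrow> nat set" where
  "qf_vars (Eq i j) = {i, j}"
| "qf_vars (Adj i j) = {i, j}"
| "qf_vars (Neg \<phi>) = qf_vars \<phi>"
| "qf_vars (Conj \<phi> \<psi>) = qf_vars \<phi> \<union> qf_vars \<psi>"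

primrec qf_sat :: "('a \<Rightarrow> 'a \<Rightarrow> bool) \<Rightarrow> (nat \<Rightarrow> 'a) \<Rightarrow> qf_formula \<Rightarrow> bool" where
  "qf_sat E x (Eq i j) \<longleftrightarrow> x i = x j"
| "qf_sat E x (Adj i j) \<longleftrightarrow> E (x i) (x j)"
| "qf_sat E x (Neg \<phi>) \<longleftrightarrow> \<not> qf_sat E x \<phi>"
| "qf_sat E x (Conj \<phi> \<psi>) \<longleftrightarrow> qf_sat E x \<phi> \<and> qf_sat E x \<psi>"

text \<open>The pairing of \<open>\<phi>\<close> with \<open>(E, \<nu>)\<close>, for a formula \<open>\<phi>\<close> regarded as having the \<open>p\<close> free
  variables \<open>0, \<dots>, p - 1\<close>.\<close>

definition qf_pairing :: "nat \<Rightarrow> qf_formula \<Rightarrow> 'a measure \<Rightarrow> ('a \<Rightarrow> 'a \<Rightarrow> bool) \<Rightarrow> real" where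
  "qf_pairing p \<phi> \<nu> E = measure (\<Pi>\<^sub>M i\<in>{..<p}. \<nu>) {x \<in> space (\<Pi>\<^sub>M i\<in>{..<p}. \<nu>). qf_sat E x \<phi>}"

definition qf_limit :: "(nat \<Rightarrow> nat graph) \<Rightarrow> 'a measure \<Rightarrow> ('a \<Rightarrow> 'a \<Rightarrow> bool) \<Rightarrow> bool" where
  "qf_limit G \<nu> E \<longleftrightarrow> (\<forall>p \<phi>. qf_vars \<phi> \<subseteq> {..<p} \<longrightarrow>
     (\<lambda>n. qf_pairing p \<phi> (uniform_count_measure (verts (G n))) (adj (G n)))
       \<longlonglongrightarrow> qf_pairing p \<phi> \<nu> E)"

section \<open>Standard Borel spaces and Borel graphs\<close>

definition compatible_polish_topology :: "'a topology \<Rightarrow> 'a measure \<Rightarrow> bool" where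
  "compatible_polish_topology X M \<longleftrightarrow> completely_metrizable_space X \<and> second_countable X
     \<and> topspace X = space M \<and> sets M = sigma_sets (topspace X) {U. openin X U}"

definition standard_borel :: "'a measure \<Rightarrow> bool" where
  "standard_borel M \<longleftrightarrow> (\<exists>X. compatible_polish_topology X M)"

definition atomless :: "'a measure \<Rightarrow> bool" where
  "atomless \<mu> \<longleftrightarrow> (\<forall>x\<in>space \<mu>. emeasure \<mu> {x} = 0)"

definition measure_support :: "'a topology \<Rightarrow> 'a measure \<Rightarrow> 'a set" where
  "measure_support X \<mu> = {x \<in> topspace X. \<forall>U. openin X U \<and> x \<in> U \<longrightarrow> emeasure \<mu> U > 0}"

text \<open>A Borel graph is given by its probability measure \<open>\<nu>\<close>, whose underlying measurable space is
  the vertex space, and its edge relation \<open>E\<close>.\<close>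

definition borel_graph :: "'a measure \<Rightarrow> ('a \<Rightarrow> 'a \<Rightarrow> bool) \<Rightarrow> bool" where
  "borel_graph \<nu> E \<longleftrightarrow> standard_borel \<nu> \<and> prob_space \<nu>
     \<and> {(x, y). x \<in> space \<nu> \<and> y \<in> space \<nu> \<and> E x y} \<in> sets (\<nu> \<Otimes>\<^sub>M \<nu>)
     \<and> (\<forall>x\<in>space \<nu>. \<forall>y\<in>space \<nu>. E x y \<longrightarrow> E y x)"

section \<open>Colored Borel tree-semilattices and the interpretation\<close>

text \<open>Only the measurable space underlying \<open>borel_space\<close> is used; the probability measure is kept
  separate.\<close>

record 'a colored_tree =
  borel_space :: "'a measure"
  meet :: "'a \<Rightarrow> 'a \<Rightarrow> 'a"
  leaf_label :: "nat \<Rightarrow> 'a set"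
  node_label :: "(nat \<times> nat \<Rightarrow> nat) \<Rightarrow> 'a set"

definition tree_semilattice :: "'a set \<Rightarrow> ('a \<Rightarrow> 'a \<Rightarrow> 'a) \<Rightarrow> bool" where
  "tree_semilattice S w \<longleftrightarrow>
     (\<forall>x\<in>S. \<forall>y\<in>S. w x y \<in> S)
     \<and> (\<forall>x\<in>S. w x x = x)
     \<and> (\<forall>x\<in>S. \<forall>y\<in>S. w x y = w y x)
     \<and> (\<forall>x\<in>S. \<forall>y\<in>S. \<forall>z\<in>S. w (w x y) z = w x (w y z))
     \<and> (\<forall>x\<in>S. \<forall>y\<in>S. \<forall>z\<in>S. w x z = x \<and> w y z = y \<longrightarrow> w x y \<in> {x, y})"

text \<open>As the label of a leaf is its color, an element carries at most one of the labels
  \<open>1, \<dots>, m\<close>. With overlapping labels the interpretation could have more than \<open>m\<close> effective colors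
  and need not be a limit of \<open>m\<close>-partite cographs.\<close>

definition colored_borel_tree_semilattice :: "nat \<Rightarrow> 'a colored_tree \<Rightarrow> bool" where
  "colored_borel_tree_semilattice m T \<longleftrightarrow> standard_borel (borel_space T)
     \<and> tree_semilattice (space (borel_space T)) (meet T)
     \<and> (\<lambda>(x, y). meet T x y) \<in> borel_space T \<Otimes>\<^sub>M borel_space T \<rightarrow>\<^sub>M borel_space T
     \<and> (\<forall>i\<in>{1..m}. leaf_label T i \<in> sets (borel_space T))
     \<and> (\<forall>f\<in>binary_maps m. node_label T f \<in> sets (borel_space T))
     \<and> disjoint_family_on (leaf_label T) {1..m}"

text \<open>The two components of the interpretation. The support of \<open>\<mu>\<close> refers to a Polish topology \<open>X\<close>
  generating the Borel structure. As graphs are loopless, adjacency concerns distinct elements.\<close>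

definition interp_measure :: "'a topology \<Rightarrow> 'a measure \<Rightarrow> 'a measure" where
  "interp_measure X \<mu> = restrict_space \<mu> (measure_support X \<mu>)"

definition interp_adj :: "nat \<Rightarrow> 'a colored_tree \<Rightarrow> 'a \<Rightarrow> 'a \<Rightarrow> bool" where
  "interp_adj m T x y \<longleftrightarrow> x \<noteq> y \<and>
     (\<exists>i\<in>{1..m}. \<exists>j\<in>{1..m}. \<exists>f\<in>binary_maps m. f (i, j) = 1
        \<and> x \<in> leaf_label T i \<and> y \<in> leaf_label T j \<and> meet T x y \<in> node_label T f)"

text \<open>\<open>\<mu>\<close> is an atomless Borel probability measure on \<open>T\<close>, and \<open>X\<close> is a Polish topology inducing the
  Borel structure of \<open>T\<close>.\<close>

definition atomless_prob_on :: "'a colored_tree \<Rightarrow> 'a topology \<Rightarrow> 'a measure \<Rightarrow> bool" where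
  "atomless_prob_on T X \<mu> \<longleftrightarrow> compatible_polish_topology X (borel_space T)
     \<and> sets \<mu> = sets (borel_space T) \<and> prob_space \<mu> \<and> atomless \<mu>"

end

theory Submission
  imports Defs
begin

text \<open>Both directions go through homomorphism densities: since \<open>\<mu>\<close> is atomless, almost no tuple has
  repeated entries, and off these tuples a quantifier-free formula is a fixed linear combination of
  edge monomials.

  For (ii), sample \<open>N\<close> points. The meets of finitely many points of a tree semilattice form a finite
  tree, so the sampled graph is an \<open>m\<close>-partite cograph; by the second moment method some samples have
  densities converging to those of the Borel graph.

  For (i), make the trees binary with the lighter subtree on the left. Following the heavy children
  from the root, a leaf leaves the heavy path at some node, then leaves the heavy path of the light
  subtree it has entered, and so on; recording the positions (in the left-to-right order of the
  leaves) and the labels of these nodes gives a code. Two leaves meet at the first difference of their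
  codes, and the label of their meet is read off the code with the smaller position. As blocks of
  level \<open>k\<close> contain at most a fraction \<open>2\<^sup>-\<^sup>k\<close> of the leaves, and as only few pairs have different but
  close positions, the adjacency of most pairs is determined, uniformly in the graph, by finitely many
  digits of the codes. Along a subsequence the laws of the digits converge, and the limit law lives on
  the sequences of positions and labels, on which truncation at the first difference is a Borel
  tree-semilattice operation. The latter is carried to the reals by an injection.\<close>

text \<open>The trees themselves have no evident limit: their depth is unbounded, and two random
  leaves may part at any depth. Counting only the turns into light subtrees replaces depth by a
  level, and halving makes the codes up to level \<open>s\<close>, read with precision
  \<open>2^-s\<close>, decide all but a fraction of order \<open>s / 2^s\<close> of the pairs (up to
  \<open>1/n\<close> for \<open>n\<close> leaves), for all trees at once. This uniformity is what
  allows the limit over the graphs to be exchanged with the limit over the precision. Positions are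
  read through binary cuts, whose limits may be off by one unit; comparisons therefore demand a gap
  of two units, and the pairs lost in this way are again counted uniformly. The same count shows
  that two independent limit leaves almost surely have different codes, which is the origin of
  atomlessness. Passing to a subsequence costs nothing, because left convergence already fixes every
  homomorphism density.\<close>

section \<open>Support of the measure and the interpretation as a standard Borel space\<close>

text \<open>The complement of the support is a union of possibly uncountably many null open sets; a
  countable base leaves only countably many null basic sets to be united.\<close>

lemma support_complement_null:
  assumes "second_countable X" "topspace X = space \<mu>" "\<And>U. openin X U \<Longrightarrow> U \<in> sets \<mu>"
  shows "topspace X - measure_support X \<mu> \<in> null_sets \<mu>"
proof -
  obtain B where B: "countable B" "\<And>V. V \<in> B \<Longrightarrow> openin X V"
    "\<And>U x. openin X U \<Longrightarrow> x \<in> U \<Longrightarrow> \<exists>V\<in>B. x \<in> V \<and> V \<subseteq> U"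
    using assms(1) unfolding second_countable_def by metis
  have "topspace X - measure_support X \<mu> = \<Union>{V\<in>B. emeasure \<mu> V = 0}"
  proof (intro equalityI subsetI)
    fix x assume "x \<in> topspace X - measure_support X \<mu>"
    then obtain U where U: "openin X U" "x \<in> U" "emeasure \<mu> U = 0"
      by (auto simp: measure_support_def not_gr_zero)
    obtain V where V: "V \<in> B" "x \<in> V" "V \<subseteq> U" using B(3)[OF U(1,2)] by blast
    have "emeasure \<mu> V \<le> emeasure \<mu> U" using V U assms(3) by (intro emeasure_mono) auto
    then show "x \<in> \<Union>{V\<in>B. emeasure \<mu> V = 0}" using U V by auto
  next
    fix x assume "x \<in> \<Union>{V\<in>B. emeasure \<mu> V = 0}"
    then obtain V where V: "V \<in> B" "x \<in> V" "emeasure \<mu> V = 0" by auto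
    then show "x \<in> topspace X - measure_support X \<mu>"
      using B(2)[OF V(1)] openin_subset[OF B(2)[OF V(1)]] by (auto simp: measure_support_def)
  qed
  also have "\<dots> = (\<Union>V\<in>{V\<in>B. emeasure \<mu> V = 0}. V)" by simp
  also have "\<dots> \<in> null_sets \<mu>"
    using B(1,2) assms(3) by (intro null_sets_UN') auto
  finally show ?thesis .
qed

lemma closedin_measure_support: "closedin X (measure_support X \<mu>)"
proof -
  have "topspace X - measure_support X \<mu> = \<Union>{U. openin X U \<and> emeasure \<mu> U = 0}"
    using openin_subset by (fastforce simp: measure_support_def not_gr_zero)
  moreover have "openin X \<dots>" by (intro openin_Union) auto
  ultimately show ?thesis by (simp add: closedin_def measure_support_def)
qed

context
  fixes T :: "'a colored_tree" and X :: "'a topology" and \<mu> :: "'a measure"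
  assumes A: "atomless_prob_on T X \<mu>"
begin

lemma atomless_prob_on_top: "completely_metrizable_space X" "second_countable X"
    "topspace X = space \<mu>" "sets \<mu> = sigma_sets (topspace X) {U. openin X U}"
    "space \<mu> = space (borel_space T)" "sets \<mu> = sets (borel_space T)"
  using A by (auto simp: atomless_prob_on_def compatible_polish_topology_def dest: sets_eq_imp_space_eq)

lemma atomless_prob_on_open: "openin X U \<Longrightarrow> U \<in> sets \<mu>"
  using atomless_prob_on_top(4) by auto

lemma support_in_sets: "measure_support X \<mu> \<in> sets \<mu>"
proof -
  have "topspace X - (topspace X - measure_support X \<mu>) \<in> sets \<mu>"
    using atomless_prob_on_open closedin_measure_support[of X \<mu>]
    by (metis closedin_def openin_topspace sets.Diff)
  moreover have "measure_support X \<mu> \<subseteq> topspace X" by (auto simp: measure_support_def)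
  ultimately show ?thesis by (simp add: double_diff)
qed

lemma AE_support: "AE x in \<mu>. x \<in> measure_support X \<mu>"
proof (rule AE_I')
  show "topspace X - measure_support X \<mu> \<in> null_sets \<mu>"
    using support_complement_null atomless_prob_on_top atomless_prob_on_open by blast
qed (use atomless_prob_on_top in auto)

lemma space_interp_measure: "space (interp_measure X \<mu>) = measure_support X \<mu>"
  using support_in_sets sets.sets_into_space by (auto simp: interp_measure_def space_restrict_space)

lemma prob_space_interp: "prob_space (interp_measure X \<mu>)"
proof -
  interpret prob_space \<mu> using A by (simp add: atomless_prob_on_def)
  show ?thesis unfolding interp_measure_def
    using AE_support support_in_sets emeasure_eq_1_AE by (intro prob_space_restrict_space) auto
qed

lemma sets_interp: "sets (interp_measure X \<mu>) = sets (restrict_space \<mu> (measure_support X \<mu>))"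
  by (simp add: interp_measure_def)

lemma id_measurable_interp: "(\<lambda>x. x) \<in> interp_measure X \<mu> \<rightarrow>\<^sub>M \<mu>"
  unfolding interp_measure_def by (rule measurable_restrict_space1) simp

text \<open>As the complement of the support is null, restricting to the support and including it
  back loses nothing. Densities over the interpretation can thus be computed with
  \<open>\<mu>\<close> itself.\<close>

lemma distr_interp: "distr (interp_measure X \<mu>) \<mu> (\<lambda>x. x) = \<mu>"
proof (rule measure_eqI)
  fix B assume "B \<in> sets (distr (interp_measure X \<mu>) \<mu> (\<lambda>x. x))"
  then have B: "B \<in> sets \<mu>" by simp
  have "emeasure (distr (interp_measure X \<mu>) \<mu> (\<lambda>x. x)) B =
      emeasure (interp_measure X \<mu>) (B \<inter> measure_support X \<mu>)"
    using B id_measurable_interp by (simp add: emeasure_distr space_interp_measure)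
  also have "\<dots> = emeasure \<mu> (B \<inter> measure_support X \<mu>)"
    unfolding interp_measure_def using B support_in_sets
    by (subst emeasure_restrict_space) (auto dest: sets.sets_into_space)
  also have "\<dots> = emeasure \<mu> B"
    using AE_support B support_in_sets by (intro emeasure_eq_AE) auto
  finally show "emeasure (distr (interp_measure X \<mu>) \<mu> (\<lambda>x. x)) B = emeasure \<mu> B" .
qed simp

text \<open>A closed subspace of a Polish space is Polish, and the traces of the open sets generate
  the trace \<sigma>-algebra.\<close>

lemma standard_borel_interp: "standard_borel (interp_measure X \<mu>)"
  unfolding standard_borel_def
proof (intro exI)
  let ?S = "measure_support X \<mu>" let ?Y = "subtopology X ?S"
  have top: "topspace ?Y = ?S" by (auto simp: measure_support_def)
  have S: "?S \<subseteq> topspace X" by (auto simp: measure_support_def)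
  have "sets (restrict_space \<mu> ?S) = (\<inter>) ?S ` sets \<mu>" by (simp add: sets_restrict_space)
  also have "\<dots> = sigma_sets ?S ((\<inter>) ?S ` {U. openin X U})"
    using sigma_sets_Int[of ?S "topspace X" "{U. openin X U}"] support_in_sets S
    by (simp add: atomless_prob_on_top(4))
  also have "(\<inter>) ?S ` {U. openin X U} = {U. openin ?Y U}"
    by (auto simp: openin_subtopology)
  finally show "compatible_polish_topology ?Y (interp_measure X \<mu>)"
    unfolding compatible_polish_topology_def sets_interp space_interp_measure top
    using completely_metrizable_space_closedin[OF atomless_prob_on_top(1) closedin_measure_support]
      second_countable_subtopology[OF atomless_prob_on_top(2)] by simp
qed

end

section \<open>Measurability of equality and adjacency\<close>

text \<open>Distinct points have disjoint basic neighbourhoods, so the complement of the diagonal is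
  a countable union of open rectangles. This makes equality of variables an event for the product
  \<sigma>-algebra.\<close>

lemma diagonal_measurable:
  assumes "compatible_polish_topology X M"
  shows "{z \<in> space (M \<Otimes>\<^sub>M M). fst z = snd z} \<in> sets (M \<Otimes>\<^sub>M M)"
proof -
  have X: "completely_metrizable_space X" "second_countable X" "topspace X = space M"
    and ss: "sets M = sigma_sets (topspace X) {U. openin X U}"
    using assms by (auto simp: compatible_polish_topology_def)
  have opn: "openin X U \<Longrightarrow> U \<in> sets M" for U using ss by auto
  have H: "Hausdorff_space X"
    using X(1) completely_metrizable_imp_metrizable_space metrizable_imp_Hausdorff_space by blast
  obtain B where B: "countable B" "\<And>V. V \<in> B \<Longrightarrow> openin X V"
    "\<And>U x. openin X U \<Longrightarrow> x \<in> U \<Longrightarrow> \<exists>V\<in>B. x \<in> V \<and> V \<subseteq> U"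
    using X(2) unfolding second_countable_def by metis
  have *: "{z \<in> space (M \<Otimes>\<^sub>M M). fst z \<noteq> snd z} =
     (\<Union>(U, V)\<in>{(U, V). U \<in> B \<and> V \<in> B \<and> U \<inter> V = {}}. U \<times> V)" (is "?L = ?R")
  proof (intro equalityI subsetI)
    fix z assume "z \<in> ?L"
    then obtain x y where z: "z = (x, y)" "x \<in> topspace X" "y \<in> topspace X" "x \<noteq> y"
      by (auto simp: space_pair_measure X)
    then obtain U V where "openin X U" "openin X V" "x \<in> U" "y \<in> V" "disjnt U V"
      using H unfolding Hausdorff_space_def by meson
    moreover then obtain U' V' where "U' \<in> B" "x \<in> U'" "U' \<subseteq> U" "V' \<in> B" "y \<in> V'" "V' \<subseteq> V"
      using B(3) by meson
    ultimately have "(U', V') \<in> {(U, V). U \<in> B \<and> V \<in> B \<and> U \<inter> V = {}}" "z \<in> U' \<times> V'"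
      using z by (auto simp: disjnt_def)
    then show "z \<in> ?R" by blast
  next
    fix z assume "z \<in> ?R"
    then show "z \<in> ?L" using B(2) openin_subset by (fastforce simp: space_pair_measure X(3)[symmetric])
  qed
  have "countable {(U, V). U \<in> B \<and> V \<in> B \<and> U \<inter> V = {}}"
    by (rule countable_subset[of _ "B \<times> B"]) (use B in auto)
  then have "?R \<in> sets (M \<Otimes>\<^sub>M M)"
    using B(2) opn by (intro sets.countable_UN'') auto
  then have "space (M \<Otimes>\<^sub>M M) - ?R \<in> sets (M \<Otimes>\<^sub>M M)" by auto
  moreover have "space (M \<Otimes>\<^sub>M M) - ?R = {z \<in> space (M \<Otimes>\<^sub>M M). fst z = snd z}"
    unfolding *[symmetric] by auto
  ultimately show ?thesis by simp
qed

lemma finite_binary_maps: "finite (binary_maps m)"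
  unfolding binary_maps_def by (intro finite_PiE) auto

lemma interp_adj_measurable:
  assumes "colored_borel_tree_semilattice m T" "compatible_polish_topology X (borel_space T)"
  shows "(\<lambda>(x, y). interp_adj m T x y) \<in> borel_space T \<Otimes>\<^sub>M borel_space T \<rightarrow>\<^sub>M count_space UNIV"
proof -
  let ?M = "borel_space T"
  have [measurable]: "(\<lambda>(x, y). meet T x y) \<in> ?M \<Otimes>\<^sub>M ?M \<rightarrow>\<^sub>M ?M"
    and lm[measurable]: "\<And>i. i \<in> {1..m} \<Longrightarrow> leaf_label T i \<in> sets ?M"
    and nm[measurable]: "\<And>f. f \<in> binary_maps m \<Longrightarrow> node_label T f \<in> sets ?M"
    using assms(1) by (auto simp: colored_borel_tree_semilattice_def)
  have 1: "Measurable.pred (?M \<Otimes>\<^sub>M ?M) (\<lambda>z. fst z = snd z)"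
    using diagonal_measurable[OF assms(2)] by (simp add: pred_def)
  have 2: "Measurable.pred (?M \<Otimes>\<^sub>M ?M) (\<lambda>z. f (i, j) = 1 \<and> fst z \<in> leaf_label T i \<and>
      snd z \<in> leaf_label T j \<and> meet T (fst z) (snd z) \<in> node_label T f)"
    if "i \<in> {1..m}" "j \<in> {1..m}" "f \<in> binary_maps m" for i j f
    using lm[OF that(1)] lm[OF that(2)] nm[OF that(3)] by measurable
  have "Measurable.pred (?M \<Otimes>\<^sub>M ?M) (\<lambda>z. fst z \<noteq> snd z \<and>
     (\<exists>i\<in>{1..m}. \<exists>j\<in>{1..m}. \<exists>f\<in>binary_maps m. f (i, j) = 1
        \<and> fst z \<in> leaf_label T i \<and> snd z \<in> leaf_label T j \<and> meet T (fst z) (snd z) \<in> node_label T f))"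
    using 1 2 finite_binary_maps by (intro pred_intros_logic pred_intros_finite) auto
  then show ?thesis by (simp add: interp_adj_def case_prod_unfold)
qed

section \<open>Edge densities over product measures\<close>

text \<open>With index type, measure and relation left arbitrary, this covers homomorphism densities
  of finite graphs, densities of random-free graphons and densities of random samples at once. Only
  the orientations listed in \<open>D\<close> are tested.\<close>

definition edge_dens :: "'k set \<Rightarrow> ('k \<times> 'k) set \<Rightarrow> 'a measure \<Rightarrow> ('a \<Rightarrow> 'a \<Rightarrow> bool) \<Rightarrow> real" where
  "edge_dens I D \<nu> E = measure (\<Pi>\<^sub>M i\<in>I. \<nu>) {x \<in> space (\<Pi>\<^sub>M i\<in>I. \<nu>). \<forall>(i, j)\<in>D. E (x i) (x j)}"

lemma pred_edges:
  assumes "(\<lambda>(x, y). E x y) \<in> M \<Otimes>\<^sub>M M \<rightarrow>\<^sub>M count_space UNIV" "finite D" "D \<subseteq> I \<times> I"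
  shows "Measurable.pred (\<Pi>\<^sub>M i\<in>I. M) (\<lambda>x. \<forall>(i, j)\<in>D. E (x i) (x j))"
proof -
  have "Measurable.pred (\<Pi>\<^sub>M i\<in>I. M) (\<lambda>x. E (x (fst d)) (x (snd d)))" if "d \<in> D" for d
  proof -
    have "(\<lambda>x. (x (fst d), x (snd d))) \<in> (\<Pi>\<^sub>M i\<in>I. M) \<rightarrow>\<^sub>M M \<Otimes>\<^sub>M M"
      using that assms(3) by (intro measurable_Pair measurable_component_singleton) auto
    from measurable_compose[OF this assms(1)] show ?thesis by simp
  qed
  then show ?thesis using assms(2) by (auto simp: case_prod_unfold intro!: pred_intros_finite)
qed

text \<open>The product of image measures is the image of the product measure. The lemma serves
  three maps: the inclusion of the support, the projection of a blow-up, and the coding map of the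
  limit.\<close>

lemma edge_dens_distr:
  assumes "finite I" "D \<subseteq> I \<times> I" "prob_space M" and f: "f \<in> M \<rightarrow>\<^sub>M N"
    and E: "(\<lambda>(x, y). E x y) \<in> N \<Otimes>\<^sub>M N \<rightarrow>\<^sub>M count_space UNIV"
  shows "edge_dens I D (distr M N f) E = edge_dens I D M (\<lambda>x y. E (f x) (f y))"
proof -
  have D: "finite D" using assms(1,2) finite_subset by blast
  let ?d = "distr M N f"
  have pd: "prob_space ?d" using assms by (simp add: prob_space.prob_space_distr)
  have f': "f \<in> M \<rightarrow>\<^sub>M ?d" using f by simp
  have "(\<Pi>\<^sub>M i\<in>I. distr M ?d f) = distr (\<Pi>\<^sub>M i\<in>I. M) (\<Pi>\<^sub>M i\<in>I. ?d) (compose I f)"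
    using assms f' pd by (subst distr_PiM_finite_prob_space') auto
  moreover have "distr M ?d f = ?d" by (intro distr_cong) auto
  ultimately have eq: "(\<Pi>\<^sub>M i\<in>I. ?d) = distr (\<Pi>\<^sub>M i\<in>I. M) (\<Pi>\<^sub>M i\<in>I. ?d) (compose I f)" by simp
  have cm: "compose I f \<in> (\<Pi>\<^sub>M i\<in>I. M) \<rightarrow>\<^sub>M (\<Pi>\<^sub>M i\<in>I. ?d)"
    unfolding compose_def using f' by (intro measurable_restrict) (auto intro: measurable_compose)
  have "sets (?d \<Otimes>\<^sub>M ?d) = sets (N \<Otimes>\<^sub>M N)" by (intro sets_pair_measure_cong) auto
  then have "(\<lambda>(x, y). E x y) \<in> ?d \<Otimes>\<^sub>M ?d \<rightarrow>\<^sub>M count_space UNIV"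
    using E by (simp cong: measurable_cong_sets)
  from pred_edges[OF this D assms(2)]
  have S: "{x \<in> space (\<Pi>\<^sub>M i\<in>I. ?d). \<forall>(i, j)\<in>D. E (x i) (x j)} \<in> sets (\<Pi>\<^sub>M i\<in>I. ?d)"
    by (simp add: pred_def)
  have "edge_dens I D ?d E = measure (distr (\<Pi>\<^sub>M i\<in>I. M) (\<Pi>\<^sub>M i\<in>I. ?d) (compose I f))
      {x \<in> space (\<Pi>\<^sub>M i\<in>I. ?d). \<forall>(i, j)\<in>D. E (x i) (x j)}"
    unfolding edge_dens_def eq[symmetric] ..
  also have "\<dots> = measure (\<Pi>\<^sub>M i\<in>I. M)
      (compose I f -` {x \<in> space (\<Pi>\<^sub>M i\<in>I. ?d). \<forall>(i, j)\<in>D. E (x i) (x j)} \<inter> space (\<Pi>\<^sub>M i\<in>I. M))"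
    by (rule measure_distr[OF cm S])
  also have "compose I f -` {x \<in> space (\<Pi>\<^sub>M i\<in>I. ?d). \<forall>(i, j)\<in>D. E (x i) (x j)} \<inter> space (\<Pi>\<^sub>M i\<in>I. M)
      = {x \<in> space (\<Pi>\<^sub>M i\<in>I. M). \<forall>(i, j)\<in>D. E (f (x i)) (f (x j))}"
    using measurable_space[OF cm] assms(2) by (fastforce simp: compose_def)
  finally show ?thesis by (simp add: edge_dens_def)
qed

text \<open>Statements about tuples are reduced to pairs here; a product indexed by
  \<open>bool\<close> is the bridge between families and pairs.\<close>

lemma distr_PiM_pair:
  assumes "prob_space M" "i \<in> I" "j \<in> I" "i \<noteq> j"
  shows "distr (\<Pi>\<^sub>M i\<in>I. M) (M \<Otimes>\<^sub>M M) (\<lambda>x. (x i, x j)) = M \<Otimes>\<^sub>M M"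
proof -
  interpret prob_space M by fact
  let ?f = "case_bool i j"
  let ?r = "\<lambda>\<omega>. \<lambda>n\<in>UNIV. \<omega> (?f n)"
  have re: "distr (\<Pi>\<^sub>M i\<in>I. M) (\<Pi>\<^sub>M b\<in>UNIV. M) ?r = (\<Pi>\<^sub>M b\<in>UNIV. M)"
    using assms by (intro distr_PiM_reindex[of I "\<lambda>_. M" ?f UNIV]) (auto simp: inj_on_def split: bool.split)
  have rm: "?r \<in> (\<Pi>\<^sub>M i\<in>I. M) \<rightarrow>\<^sub>M (\<Pi>\<^sub>M b\<in>UNIV. M)"
  proof (rule measurable_restrict)
    fix n :: bool show "(\<lambda>\<omega>. \<omega> (?f n)) \<in> (\<Pi>\<^sub>M i\<in>I. M) \<rightarrow>\<^sub>M M"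
      using assms by (cases n) (auto intro: measurable_component_singleton)
  qed
  have "(\<lambda>b. case b of True \<Rightarrow> M | False \<Rightarrow> M) = (\<lambda>_. M)" by (auto split: bool.split)
  then have "M \<Otimes>\<^sub>M M = distr (\<Pi>\<^sub>M b\<in>UNIV. M) (M \<Otimes>\<^sub>M M) (\<lambda>x. (x True, x False))"
    using pair_measure_eq_distr_PiM[of M M] sigma_finite_measure_axioms by simp
  also have "\<dots> = distr (distr (\<Pi>\<^sub>M i\<in>I. M) (\<Pi>\<^sub>M b\<in>UNIV. M) ?r) (M \<Otimes>\<^sub>M M) (\<lambda>x. (x True, x False))"
    by (simp only: re)
  also have "\<dots> = distr (\<Pi>\<^sub>M i\<in>I. M) (M \<Otimes>\<^sub>M M) ((\<lambda>x. (x True, x False)) \<circ> ?r)"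
    by (intro distr_distr[OF _ rm]) measurable
  finally show ?thesis by (simp add: comp_def)
qed

lemma AE_PiM_pair:
  assumes "prob_space M" "i \<in> I" "j \<in> I" "i \<noteq> j" "AE z in M \<Otimes>\<^sub>M M. P (fst z) (snd z)"
  shows "AE x in (\<Pi>\<^sub>M i\<in>I. M). P (x i) (x j)"
proof -
  have "AE z in distr (\<Pi>\<^sub>M i\<in>I. M) (M \<Otimes>\<^sub>M M) (\<lambda>x. (x i, x j)). P (fst z) (snd z)"
    using assms(5) by (subst distr_PiM_pair[OF assms(1-4)])
  from AE_distrD[OF _ this] show ?thesis
    using assms(2,3) by (auto intro!: measurable_Pair measurable_component_singleton)
qed

text \<open>Fubini: every section of the diagonal is a singleton, hence null.\<close>

lemma atomless_AE_neq:
  assumes "prob_space \<nu>" "atomless \<nu>" "{z \<in> space (\<nu> \<Otimes>\<^sub>M \<nu>). fst z = snd z} \<in> sets (\<nu> \<Otimes>\<^sub>M \<nu>)"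
  shows "AE z in \<nu> \<Otimes>\<^sub>M \<nu>. fst z \<noteq> snd z"
proof -
  interpret prob_space \<nu> by fact
  let ?D = "{z \<in> space (\<nu> \<Otimes>\<^sub>M \<nu>). fst z = snd z}"
  have "emeasure (\<nu> \<Otimes>\<^sub>M \<nu>) ?D = (\<integral>\<^sup>+x. emeasure \<nu> (Pair x -` ?D) \<partial>\<nu>)"
    using assms(3) by (rule emeasure_pair_measure_alt)
  also have "\<dots> = (\<integral>\<^sup>+x. 0 \<partial>\<nu>)"
  proof (rule nn_integral_cong)
    fix x assume "x \<in> space \<nu>"
    then have "Pair x -` ?D = {x}" by (auto simp: space_pair_measure)
    then show "emeasure \<nu> (Pair x -` ?D) = 0" using assms(2) \<open>x \<in> space \<nu>\<close> by (simp add: atomless_def)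
  qed
  finally have "emeasure (\<nu> \<Otimes>\<^sub>M \<nu>) ?D = 0" by simp
  then show ?thesis using assms(3) by (intro AE_I[of _ _ ?D]) auto
qed

lemma atomless_AE_inj:
  assumes "prob_space \<nu>" "atomless \<nu>" "{z \<in> space (\<nu> \<Otimes>\<^sub>M \<nu>). fst z = snd z} \<in> sets (\<nu> \<Otimes>\<^sub>M \<nu>)" "finite I"
  shows "AE x in (\<Pi>\<^sub>M i\<in>I. \<nu>). inj_on x I"
proof -
  have "AE x in (\<Pi>\<^sub>M i\<in>I. \<nu>). \<forall>i\<in>I. \<forall>j\<in>I. i \<noteq> j \<longrightarrow> x i \<noteq> x j"
    using assms(4) AE_PiM_pair[OF assms(1) _ _ _ atomless_AE_neq[OF assms(1,2,3)]]
    by (intro AE_finite_allI) (auto simp: AE_all_countable)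
  then show ?thesis by eventually_elim (auto simp: inj_on_def)
qed

section \<open>Labelled binary trees\<close>

text \<open>Binary form of the trees defining cographs: a vertex with several children is
  represented by a chain of nodes repeating its label, which preserves the labels of all
  meets.\<close>

datatype (labs: 'l, leaves: 'v) ltree = Leaf 'v | Node 'l "('l, 'v) ltree" "('l, 'v) ltree"

primrec distinct_leaves :: "('l, 'v) ltree \<Rightarrow> bool" where
  "distinct_leaves (Leaf v) \<longleftrightarrow> True"
| "distinct_leaves (Node l s t) \<longleftrightarrow> distinct_leaves s \<and> distinct_leaves t \<and> leaves s \<inter> leaves t = {}"

text \<open>For two different leaves the recursion stops at the node separating them, before it can
  reach a \<open>Leaf\<close>.\<close>

primrec lca_lab :: "('l, 'v) ltree \<Rightarrow> 'v \<Rightarrow> 'v \<Rightarrow> 'l" where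
  "lca_lab (Leaf v) x y = undefined"
| "lca_lab (Node l s t) x y = (if x \<in> leaves s \<and> y \<in> leaves s then lca_lab s x y
     else if x \<in> leaves t \<and> y \<in> leaves t then lca_lab t x y else l)"

lemma finite_leaves [simp]: "finite (leaves t)"
  by (induction t) auto

lemma leaves_nonempty [simp]: "leaves t \<noteq> {}"
  by (induction t) auto

lemma card_leaves_pos: "0 < card (leaves t)"
  by (simp add: card_gt_0_iff)

subsection \<open>Rooted trees and labelled binary trees\<close>

text \<open>As parents are unique, all ancestors of \<open>x\<close> lie on a single upward
  path.\<close>

lemma rtrancl_common_descendant:
  assumes "\<And>u u' v. (u, v) \<in> A \<Longrightarrow> (u', v) \<in> A \<Longrightarrow> u = u'" "(u, x) \<in> A\<^sup>*" "(w, x) \<in> A\<^sup>*"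
  shows "(u, w) \<in> A\<^sup>* \<or> (w, u) \<in> A\<^sup>*"
  using assms(2,3)
proof (induction)
  case base then show ?case by auto
next
  case (step y z)
  show ?case
  proof (cases "w = z")
    case True then show ?thesis using step by (meson rtrancl.rtrancl_into_rtrancl)
  next
    case False
    then obtain y' where "(w, y') \<in> A\<^sup>*" "(y', z) \<in> A" using step.prems by (meson rtranclE)
    then show ?thesis using step.IH assms(1) step.hyps(2) by blast
  qed
qed

context
  fixes N :: "'a set" and r A
  assumes rt: "rooted_tree N r A"
begin

lemma rooted_tree_parent_unique: "(u, v) \<in> A \<Longrightarrow> (u', v) \<in> A \<Longrightarrow> u = u'"
  using rt unfolding rooted_tree_def by blast

text \<open>A cycle through a node other than the root also runs through its parent. Following
  parents moves it up to the root, which has no incoming arc.\<close>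

lemma rooted_tree_acyclic: "(v, v) \<notin> A\<^sup>+"
proof
  assume c: "(v, v) \<in> A\<^sup>+"
  then obtain w where "(v, w) \<in> A" by (meson tranclD)
  then have "v \<in> N" using rt by (auto simp: rooted_tree_def)
  then have "(r, v) \<in> A\<^sup>*" using rt by (auto simp: rooted_tree_def)
  then have "(v, v) \<notin> A\<^sup>+"
  proof (induction)
    case base
    show ?case
    proof
      assume "(r, r) \<in> A\<^sup>+"
      then obtain z where "(z, r) \<in> A" by (meson tranclD2)
      then show False using rt by (auto simp: rooted_tree_def)
    qed
  next
    case (step u v)
    show ?case
    proof
      assume "(v, v) \<in> A\<^sup>+"
      then obtain w where "(v, w) \<in> A\<^sup>*" "(w, v) \<in> A" by (meson tranclD2)
      then have "(v, u) \<in> A\<^sup>*" using rooted_tree_parent_unique step by blast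
      then show False using step by (meson rtrancl_into_trancl2)
    qed
  qed
  then show False using c by simp
qed

lemma rooted_tree_child_ancestor:
  assumes "(v, w) \<in> A" "(u, w) \<in> A\<^sup>*" "u \<noteq> w"
  shows "(u, v) \<in> A\<^sup>*"
  using assms rooted_tree_parent_unique by (metis rtranclE)

lemma rooted_tree_siblings_disjoint:
  assumes "(v, w) \<in> A" "(v, w') \<in> A" "w \<noteq> w'" "(w, x) \<in> A\<^sup>*"
  shows "(w', x) \<notin> A\<^sup>*"
proof
  assume "(w', x) \<in> A\<^sup>*"
  then consider "(w, w') \<in> A\<^sup>*" | "(w', w) \<in> A\<^sup>*"
    using rtrancl_common_descendant[of A w x w'] rooted_tree_parent_unique assms(4) by blast
  then show False
    by cases (metis assms rooted_tree_child_ancestor rooted_tree_acyclic rtrancl_into_trancl2)+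
qed

text \<open>A common ancestor of \<open>x\<close> and \<open>y\<close> cannot lie at or below
  \<open>w\<close>, since siblings have no common descendant; being comparable with
  \<open>w\<close>, it lies above it and therefore above or at \<open>v\<close>.\<close>

lemma rooted_tree_lca_siblings:
  assumes "(v, w) \<in> A" "(v, w') \<in> A" "w \<noteq> w'" "(w, x) \<in> A\<^sup>*" "(w', y) \<in> A\<^sup>*"
  shows "is_lca A x y v"
  unfolding is_lca_def
proof (intro conjI allI impI)
  show "(v, x) \<in> A\<^sup>*" "(v, y) \<in> A\<^sup>*" using assms by (auto intro: converse_rtrancl_into_rtrancl)
  fix u assume u: "(u, x) \<in> A\<^sup>* \<and> (u, y) \<in> A\<^sup>*"
  have "(w, u) \<notin> A\<^sup>*"
  proof
    assume "(w, u) \<in> A\<^sup>*"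
    then have "(w, y) \<in> A\<^sup>*" using u by (meson rtrancl_trans)
    then show False using rooted_tree_siblings_disjoint assms by blast
  qed
  then have "(u, w) \<in> A\<^sup>*" "u \<noteq> w"
    using rtrancl_common_descendant[of A w x u] rooted_tree_parent_unique assms(4) u by blast+
  then show "(u, v) \<in> A\<^sup>*" using rooted_tree_child_ancestor assms(1) by blast
qed

text \<open>Well-founded induction from the leaves upwards. At an inner node the trees of the
  children are joined one after the other by binary nodes that all carry the label of
  \<open>v\<close>, because leaves below different children meet at \<open>v\<close>.\<close>

lemma rooted_tree_ltree_at:
  assumes "v \<in> N"
  shows "\<exists>t. distinct_leaves t \<and> leaves t = {x \<in> tree_leaves N A. (v, x) \<in> A\<^sup>*}
     \<and> labs t \<subseteq> f ` (N - tree_leaves N A)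
     \<and> (\<forall>x\<in>leaves t. \<forall>y\<in>leaves t. x \<noteq> y \<longrightarrow> (\<exists>w. is_lca A x y w \<and> lca_lab t x y = f w))"
proof -
  have "finite A" using rt by (auto simp: rooted_tree_def intro: finite_subset)
  moreover have "acyclic A" using rooted_tree_acyclic by (simp add: acyclic_def)
  ultimately have wf: "wf (A\<inverse>)" by (rule finite_acyclic_wf_converse)
  let ?L = "\<lambda>v. {x \<in> tree_leaves N A. (v, x) \<in> A\<^sup>*}"
  define P where "P S t \<longleftrightarrow> distinct_leaves t \<and> leaves t = S \<and> labs t \<subseteq> f ` (N - tree_leaves N A)
     \<and> (\<forall>x\<in>leaves t. \<forall>y\<in>leaves t. x \<noteq> y \<longrightarrow> (\<exists>w. is_lca A x y w \<and> lca_lab t x y = f w))" for S t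
  have PI: "P S t" if "distinct_leaves t" "leaves t = S" "labs t \<subseteq> f ` (N - tree_leaves N A)"
    "\<And>x y. x \<in> leaves t \<Longrightarrow> y \<in> leaves t \<Longrightarrow> x \<noteq> y \<Longrightarrow> \<exists>w. is_lca A x y w \<and> lca_lab t x y = f w" for S t
    using that by (simp add: P_def)
  have PD: "distinct_leaves t" "leaves t = S" "labs t \<subseteq> f ` (N - tree_leaves N A)"
    "x \<in> leaves t \<Longrightarrow> y \<in> leaves t \<Longrightarrow> x \<noteq> y \<Longrightarrow> \<exists>w. is_lca A x y w \<and> lca_lab t x y = f w" if "P S t" for S t x y
    using that unfolding P_def by blast+
  have "\<exists>t. P (?L v) t" using wf assms
  proof (induction v rule: wf_induct_rule)
    case (less v)
    show ?case
    proof (cases "v \<in> tree_leaves N A")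
      case True
      then have "(v, x) \<in> A\<^sup>* \<Longrightarrow> x = v" for x
        by (metis (no_types, lifting) converse_rtranclE mem_Collect_eq tree_leaves_def)
      then have "?L v = {v}" using True by auto
      then have "P (?L v) (Leaf v)" by (intro PI) auto
      then show ?thesis by blast
    next
      case False
      define C where "C = {w. (v, w) \<in> A}"
      have C: "finite C" "C \<subseteq> N" "C \<noteq> {}"
        using False less.prems rt finite_subset[of C N]
        by (auto simp: C_def tree_leaves_def rooted_tree_def)
      have IH: "\<exists>t. P (?L w) t" if "w \<in> C" for w
        using that less.IH[of w] C(2) by (simp add: C_def subset_iff)
      have *: "\<exists>t. P (\<Union>w\<in>D. ?L w) t" if "finite D" "D \<noteq> {}" "D \<subseteq> C" for D
        using that
      proof (induction rule: finite_ne_induct)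
        case (singleton w)
        then have "w \<in> C" by simp
        from IH[OF this] show ?case by simp
      next
        case (insert w D)
        have D: "D \<subseteq> C" "w \<in> C" "w \<notin> D" using insert.prems insert.hyps by simp_all
        obtain t where t: "P (\<Union>w\<in>D. ?L w) t" using insert.IH[OF D(1)] by (elim exE) (rule that)
        obtain s where s: "P (?L w) s" using IH[OF D(2)] by (elim exE) (rule that)
        note t' = PD[OF t] and s' = PD[OF s]
        have w: "(v, w) \<in> A" using D by (simp add: C_def)
        have disj: "is_lca A x y v \<and> is_lca A y x v \<and> x \<notin> leaves t \<and> y \<notin> leaves s"
          if xs: "x \<in> leaves s" and yt: "y \<in> leaves t" for x y
        proof -
          have wx: "(w, x) \<in> A\<^sup>*" using xs unfolding s'(2) by simp
          obtain w' where w': "w' \<in> D" "(w', y) \<in> A\<^sup>*" using yt unfolding t'(2) by blast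
          then have ne: "(v, w') \<in> A" "w \<noteq> w'" using D by (auto simp: C_def)
          have "x \<notin> leaves t"
          proof
            assume "x \<in> leaves t"
            then obtain w2 where w2: "w2 \<in> D" "(w2, x) \<in> A\<^sup>*" unfolding t'(2) by blast
            then have "(v, w2) \<in> A" "w \<noteq> w2" using D by (auto simp: C_def)
            then show False using rooted_tree_siblings_disjoint[OF w _ _ wx] w2 by blast
          qed
          moreover have "y \<notin> leaves s"
            using rooted_tree_siblings_disjoint[OF ne(1) w ne(2)[symmetric] w'(2)] unfolding s'(2) by simp
          ultimately show ?thesis
            using rooted_tree_lca_siblings[OF w ne wx w'(2)]
              rooted_tree_lca_siblings[OF ne(1) w ne(2)[symmetric] w'(2) wx] by blast
        qed
        have st: "leaves s \<inter> leaves t = {}" using disj by blast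
        have "P (\<Union>w\<in>insert w D. ?L w) (Node (f v) s t)"
        proof (rule PI)
          show "distinct_leaves (Node (f v) s t)" using s'(1) t'(1) st by simp
          show "leaves (Node (f v) s t) = (\<Union>w\<in>insert w D. ?L w)" by (simp add: s'(2) t'(2))
          show "labs (Node (f v) s t) \<subseteq> f ` (N - tree_leaves N A)"
            using s'(3) t'(3) False less.prems by simp
          fix x y assume xy: "x \<in> leaves (Node (f v) s t)" "y \<in> leaves (Node (f v) s t)" "x \<noteq> y"
          then consider "x \<in> leaves s" "y \<in> leaves s" | "x \<in> leaves t" "y \<in> leaves t"
            | "x \<in> leaves s" "y \<in> leaves t" | "x \<in> leaves t" "y \<in> leaves s" by (simp only: ltree.set) blast
          then show "\<exists>w. is_lca A x y w \<and> lca_lab (Node (f v) s t) x y = f w"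
          proof cases
            case 1
            then show ?thesis using s'(4)[OF 1 xy(3)] by simp
          next
            case 2
            moreover have "x \<notin> leaves s" using 2 st by blast
            ultimately show ?thesis using t'(4)[OF 2 xy(3)] by simp
          next
            case 3
            then have "x \<notin> leaves t" "y \<notin> leaves s" "is_lca A x y v" using disj by blast+
            then show ?thesis by (intro exI[of _ v]) simp
          next
            case 4
            then have "y \<notin> leaves t" "x \<notin> leaves s" "is_lca A x y v" using disj by blast+
            then show ?thesis by (intro exI[of _ v]) simp
          qed
        qed
        then show ?case by blast
      qed
      have "?L v = (\<Union>w\<in>C. ?L w)"
      proof (intro equalityI subsetI)
        fix x assume x: "x \<in> ?L v"
        then have "v \<noteq> x" using False by auto
        then obtain w where "(v, w) \<in> A" "(w, x) \<in> A\<^sup>*" using x by (metis (no_types, lifting) converse_rtranclE mem_Collect_eq)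
        then show "x \<in> (\<Union>w\<in>C. ?L w)" using x by (auto simp: C_def)
      qed (auto simp: C_def intro: converse_rtrancl_into_rtrancl)
      then show ?thesis using *[OF C(1,3)] by simp
    qed
  qed
  then show ?thesis unfolding P_def .
qed

end

text \<open>The labels that cographs allow. That there are finitely many of them will bound the
  label digits of the codes.\<close>

definition sym_maps :: "nat \<Rightarrow> (nat \<times> nat \<Rightarrow> nat) set" where
  "sym_maps m = {f \<in> binary_maps m. \<forall>i\<in>{1..m}. \<forall>j\<in>{1..m}. f (i, j) = f (j, i)}"

lemma m_partite_cograph_imp_ltree:
  assumes "m_partite_cograph m G"
  obtains t c where "distinct_leaves t" "leaves t = verts G" "labs t \<subseteq> sym_maps m"
    "\<And>x. x \<in> verts G \<Longrightarrow> c x \<in> {1..m}"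
    "\<And>x y. x \<in> verts G \<Longrightarrow> y \<in> verts G \<Longrightarrow> x \<noteq> y \<Longrightarrow> adj G x y \<longleftrightarrow> lca_lab t x y (c x, c y) = 1"
proof -
  obtain N r A c f where rt: "rooted_tree N r A" and L: "tree_leaves N A = verts G"
    and c: "\<forall>x\<in>verts G. c x \<in> {1..m}"
    and f: "\<forall>v\<in>N - verts G. f v \<in> binary_maps m
              \<and> (\<forall>i\<in>{1..m}. \<forall>j\<in>{1..m}. f v (i, j) = f v (j, i))"
    and a: "\<forall>x\<in>verts G. \<forall>y\<in>verts G. \<forall>v. x \<noteq> y \<and> is_lca A x y v \<longrightarrow>
              (adj G x y \<longleftrightarrow> f v (c x, c y) = 1)"
    using assms unfolding m_partite_cograph_def by blast
  have "r \<in> N" using rt by (simp add: rooted_tree_def)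
  from rooted_tree_ltree_at[OF rt this, of f] obtain t where
    t: "distinct_leaves t" "leaves t = {x \<in> verts G. (r, x) \<in> A\<^sup>*}" "labs t \<subseteq> f ` (N - verts G)"
       "\<forall>x\<in>leaves t. \<forall>y\<in>leaves t. x \<noteq> y \<longrightarrow> (\<exists>w. is_lca A x y w \<and> lca_lab t x y = f w)"
    unfolding L by blast
  have "{x \<in> verts G. (r, x) \<in> A\<^sup>*} = verts G"
    using rt L by (auto simp: rooted_tree_def tree_leaves_def)
  with t have t2: "leaves t = verts G" by simp
  show thesis
  proof (rule that[of t c])
    show "labs t \<subseteq> sym_maps m" using t(3) f by (auto simp: sym_maps_def)
    fix x y assume "x \<in> verts G" "y \<in> verts G" "x \<noteq> y"
    then obtain w where w: "is_lca A x y w" "lca_lab t x y = f w" using t t2 by blast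
    then show "adj G x y \<longleftrightarrow> lca_lab t x y (c x, c y) = 1"
      using a \<open>x \<in> verts G\<close> \<open>y \<in> verts G\<close> \<open>x \<noteq> y\<close> by auto
  qed (use t c t2 in auto)
qed

text \<open>The leaves keep their names, so inner nodes need natural numbers different from all
  leaves and from the nodes of the neighbouring subtree. The set \<open>Z\<close> of forbidden names
  strengthens the induction so that both subtrees can be built on disjoint node sets.\<close>

lemma ltree_imp_rooted_tree:
  fixes t :: "('l, nat) ltree"
  assumes "distinct_leaves t" "finite Z"
  shows "\<exists>N r A f. rooted_tree N r A \<and> tree_leaves N A = leaves t \<and> (N - leaves t) \<inter> Z = {}
     \<and> f ` (N - leaves t) \<subseteq> labs t
     \<and> (\<forall>x\<in>leaves t. \<forall>y\<in>leaves t. \<forall>v. x \<noteq> y \<and> is_lca A x y v \<longrightarrow> v \<in> N - leaves t \<and> f v = lca_lab t x y)"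
  using assms
proof (induction t arbitrary: Z)
  case (Leaf v)
  have "rooted_tree {v} v {}" by (auto simp: rooted_tree_def)
  moreover have "tree_leaves {v} {} = {v}" by (auto simp: tree_leaves_def)
  ultimately show ?case by (intro exI[of _ "{v}"] exI[of _ v] exI[of _ "{}"]) auto
next
  case (Node l s t)
  \<comment> \<open>Inner nodes of the left tree must also avoid the leaves of the right one;
    \<open>?Z2\<close> below keeps the right tree off everything chosen for the left one.\<close>
  let ?Z1 = "Z \<union> leaves s \<union> leaves t"
  have "finite ?Z1" "distinct_leaves s" using Node.prems by auto
  from Node.IH(1)[OF this(2,1)] obtain N1 r1 A1 f1 where
    H1: "rooted_tree N1 r1 A1" "tree_leaves N1 A1 = leaves s" "(N1 - leaves s) \<inter> ?Z1 = {}"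
       "f1 ` (N1 - leaves s) \<subseteq> labs s"
       "\<forall>x\<in>leaves s. \<forall>y\<in>leaves s. \<forall>v. x \<noteq> y \<and> is_lca A1 x y v \<longrightarrow> v \<in> N1 - leaves s \<and> f1 v = lca_lab s x y"
    by (elim exE conjE) (rule that)
  let ?Z2 = "?Z1 \<union> N1"
  have fin1: "finite N1" using H1 by (simp add: rooted_tree_def)
  then have "finite ?Z2" "distinct_leaves t" using Node.prems by auto
  from Node.IH(2)[OF this(2,1)] obtain N2 r2 A2 f2 where
    H2: "rooted_tree N2 r2 A2" "tree_leaves N2 A2 = leaves t" "(N2 - leaves t) \<inter> ?Z2 = {}"
       "f2 ` (N2 - leaves t) \<subseteq> labs t"
       "\<forall>x\<in>leaves t. \<forall>y\<in>leaves t. \<forall>v. x \<noteq> y \<and> is_lca A2 x y v \<longrightarrow> v \<in> N2 - leaves t \<and> f2 v = lca_lab t x y"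
    by (elim exE conjE) (rule that)
  have fin2: "finite N2" using H2 by (simp add: rooted_tree_def)
  obtain r where r: "r \<notin> ?Z2 \<union> N2" using ex_new_if_finite[of "?Z2 \<union> N2"] fin1 fin2 Node.prems by auto
  have sub: "leaves s \<subseteq> N1" "leaves t \<subseteq> N2" using H1(2) H2(2) by (auto simp: tree_leaves_def)
  have disj: "N1 \<inter> N2 = {}" using H1(3) H2(3) Node.prems(1) sub
    by (simp only: distinct_leaves.simps set_eq_iff) blast
  define A where "A = A1 \<union> A2 \<union> {(r, r1), (r, r2)}"
  define N where "N = insert r (N1 \<union> N2)"
  define f where "f v = (if v \<in> N1 then f1 v else if v \<in> N2 then f2 v else l)" for v
  have A1: "A1 \<subseteq> N1 \<times> N1" "r1 \<in> N1" "\<And>v. (v, r1) \<notin> A1" "\<And>v. v \<in> N1 \<Longrightarrow> (r1, v) \<in> A1\<^sup>*"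
    using H1(1) by (auto simp: rooted_tree_def)
  have A2: "A2 \<subseteq> N2 \<times> N2" "r2 \<in> N2" "\<And>v. (v, r2) \<notin> A2" "\<And>v. v \<in> N2 \<Longrightarrow> (r2, v) \<in> A2\<^sup>*"
    using H2(1) by (auto simp: rooted_tree_def)
  have rr: "r \<notin> N1" "r \<notin> N2" using r by auto
  have nor: "(v, r) \<notin> A" for v using A1 A2 rr by (auto simp: A_def)
  have nor': "(u, r) \<in> A\<^sup>* \<Longrightarrow> u = r" for u using nor by (metis rtranclE)
  have mono: "A1\<^sup>* \<subseteq> A\<^sup>*" "A2\<^sup>* \<subseteq> A\<^sup>*" by (auto intro!: rtrancl_mono simp: A_def)
  \<comment> \<open>No arc leads from \<open>N2\<close> into \<open>N1\<close>, so climbing from a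
    node of \<open>N1\<close> stays within \<open>A1\<close> until \<open>r\<close> is
    reached.\<close>
  have up1: "u = r \<or> (u, x) \<in> A1\<^sup>* \<and> u \<in> N1" if "(u, x) \<in> A\<^sup>*" "x \<in> N1" for u x
    using that
  proof (induction)
    case (step y z)
    from step.hyps(2) have "(y, z) \<in> A1 \<or> y = r" using step.prems A2 disj by (auto simp: A_def)
    then show ?case
    proof
      assume yz: "(y, z) \<in> A1"
      then have "y \<in> N1" using A1 by auto
      then show ?thesis using step.IH yz by (auto intro: rtrancl_into_rtrancl)
    qed (use step.hyps nor' in auto)
  qed auto
  have up2: "u = r \<or> (u, x) \<in> A2\<^sup>* \<and> u \<in> N2" if "(u, x) \<in> A\<^sup>*" "x \<in> N2" for u x
    using that
  proof (induction)
    case (step y z)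
    from step.hyps(2) have "(y, z) \<in> A2 \<or> y = r" using step.prems A1 disj by (auto simp: A_def)
    then show ?case
    proof
      assume yz: "(y, z) \<in> A2"
      then have "y \<in> N2" using A2 by auto
      then show ?thesis using step.IH yz by (auto intro: rtrancl_into_rtrancl)
    qed (use step.hyps nor' in auto)
  qed auto
  have reach1: "(r, v) \<in> A\<^sup>*" if "v \<in> N1" for v
    using A1(4)[OF that] mono(1) by (intro converse_rtrancl_into_rtrancl[of r r1]) (auto simp: A_def)
  have reach2: "(r, v) \<in> A\<^sup>*" if "v \<in> N2" for v
    using A2(4)[OF that] mono(2) by (intro converse_rtrancl_into_rtrancl[of r r2]) (auto simp: A_def)
  have RT: "rooted_tree N r A"
    unfolding rooted_tree_def
  proof (intro conjI allI ballI impI)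
    show "finite N" "r \<in> N" using fin1 fin2 by (auto simp: N_def)
    show "A \<subseteq> N \<times> N" using A1 A2 by (auto simp: A_def N_def)
    show "(v, r) \<notin> A" for v by (rule nor)
    show "(r, v) \<in> A\<^sup>*" if "v \<in> N" for v using that reach1 reach2 by (auto simp: N_def)
    fix u u' v assume "(u, v) \<in> A \<and> (u', v) \<in> A"
    moreover have "\<And>u u' v. (u, v) \<in> A1 \<Longrightarrow> (u', v) \<in> A1 \<Longrightarrow> u = u'"
      "\<And>u u' v. (u, v) \<in> A2 \<Longrightarrow> (u', v) \<in> A2 \<Longrightarrow> u = u'"
      using H1(1) H2(1) unfolding rooted_tree_def by blast+
    ultimately show "u = u'" using A1 A2 disj by (auto simp: A_def)
  qed
  have TL: "tree_leaves N A = leaves (Node l s t)"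
  proof -
    have "tree_leaves N A = tree_leaves N1 A1 \<union> tree_leaves N2 A2"
      using A1 A2 disj rr unfolding tree_leaves_def N_def A_def by blast
    then show ?thesis using H1(2) H2(2) by simp
  qed
  have av: "(N - leaves (Node l s t)) \<inter> Z = {}"
    using H1(3) H2(3) r by (auto simp: N_def)
  have fl: "f ` (N - leaves (Node l s t)) \<subseteq> labs (Node l s t)"
    using H1(4) H2(4) disj by (auto simp: N_def f_def)
  have "v \<in> N - leaves (Node l s t) \<and> f v = lca_lab (Node l s t) x y"
    if x: "x \<in> leaves (Node l s t)" and y: "y \<in> leaves (Node l s t)" and "x \<noteq> y" and v: "is_lca A x y v" for x y v
  proof -
    have va: "(v, x) \<in> A\<^sup>*" "(v, y) \<in> A\<^sup>*"
      and vb: "\<And>u. (u, x) \<in> A\<^sup>* \<Longrightarrow> (u, y) \<in> A\<^sup>* \<Longrightarrow> (u, v) \<in> A\<^sup>*"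
      using v by (auto simp: is_lca_def)
    consider "x \<in> leaves s" "y \<in> leaves s" | "x \<in> leaves t" "y \<in> leaves t"
      | "x \<in> leaves s" "y \<in> leaves t" | "x \<in> leaves t" "y \<in> leaves s" using x y by auto
    then show ?thesis
    proof cases
      case 1
      note xy = 1
      have N1: "x \<in> N1" "y \<in> N1" using xy sub by auto
      \<comment> \<open>\<open>r1\<close> is a common ancestor, hence at or above \<open>v\<close>.
        As nothing but \<open>r\<close> is above \<open>r\<close>, the meet is not the new
        root.\<close>
      have "(r1, v) \<in> A\<^sup>*" using A1(4) N1 mono(1) by (intro vb) auto
      then have "v \<noteq> r" using nor' A1(2) rr by auto
      then have v1: "(v, x) \<in> A1\<^sup>*" "(v, y) \<in> A1\<^sup>*" "v \<in> N1" using up1 va N1 by auto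
      have "is_lca A1 x y v"
        unfolding is_lca_def
      proof (intro conjI allI impI v1(1,2))
        fix u assume u: "(u, x) \<in> A1\<^sup>* \<and> (u, y) \<in> A1\<^sup>*"
        then have "u \<in> N1" using A1(1) N1 by (metis converse_rtranclE mem_Sigma_iff subsetD)
        moreover have "(u, v) \<in> A\<^sup>*" using u mono(1) by (intro vb) auto
        ultimately show "(u, v) \<in> A1\<^sup>*" using up1[of u v] v1(3) rr by auto
      qed
      then have "v \<in> N1 - leaves s \<and> f1 v = lca_lab s x y" using \<open>x \<noteq> y\<close> xy H1(5) \<open>is_lca A1 x y v\<close> by blast
      then show ?thesis using xy v1(3) sub disj by (auto simp: N_def f_def)
    next
      case 2
      note xy = 2
      have N2: "x \<in> N2" "y \<in> N2" using xy sub by auto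
      have "(r2, v) \<in> A\<^sup>*" using A2(4) N2 mono(2) by (intro vb) auto
      then have "v \<noteq> r" using nor' A2(2) rr by auto
      then have v2: "(v, x) \<in> A2\<^sup>*" "(v, y) \<in> A2\<^sup>*" "v \<in> N2" using up2 va N2 by auto
      have "is_lca A2 x y v"
        unfolding is_lca_def
      proof (intro conjI allI impI v2(1,2))
        fix u assume u: "(u, x) \<in> A2\<^sup>* \<and> (u, y) \<in> A2\<^sup>*"
        then have "u \<in> N2" using A2(1) N2 by (metis converse_rtranclE mem_Sigma_iff subsetD)
        moreover have "(u, v) \<in> A\<^sup>*" using u mono(2) by (intro vb) auto
        ultimately show "(u, v) \<in> A2\<^sup>*" using up2[of u v] v2(3) rr by auto
      qed
      then have "v \<in> N2 - leaves t \<and> f2 v = lca_lab t x y" using \<open>x \<noteq> y\<close> xy H2(5) \<open>is_lca A2 x y v\<close> by blast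
      then show ?thesis using xy v2(3) sub disj Node.prems(1) by (auto simp: N_def f_def)
    next
      case 3
      then have "v = r" using up1[OF va(1)] up2[OF va(2)] sub disj by blast
      then show ?thesis using 3 rr sub Node.prems(1) by (auto simp: N_def f_def)
    next
      case 4
      then have "v = r" using up2[OF va(1)] up1[OF va(2)] sub disj by blast
      then show ?thesis using 4 rr sub Node.prems(1) by (auto simp: N_def f_def)
    qed
  qed
  then show ?case
    by (intro exI[of _ N] exI[of _ r] exI[of _ A] exI[of _ f] conjI RT TL av fl ballI allI impI) blast+
qed

lemma ltree_imp_m_partite_cograph:
  assumes "finite_graph G" "distinct_leaves t" "leaves t = verts G" "labs t \<subseteq> sym_maps m"
    "\<And>x. x \<in> verts G \<Longrightarrow> c x \<in> {1..m}"
    "\<And>x y. x \<in> verts G \<Longrightarrow> y \<in> verts G \<Longrightarrow> x \<noteq> y \<Longrightarrow> adj G x y \<longleftrightarrow> lca_lab t x y (c x, c y) = 1"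
  shows "m_partite_cograph m G"
proof -
  obtain N r A f where *: "rooted_tree N r A" "tree_leaves N A = leaves t"
     "f ` (N - leaves t) \<subseteq> labs t"
     "\<forall>x\<in>leaves t. \<forall>y\<in>leaves t. \<forall>v. x \<noteq> y \<and> is_lca A x y v \<longrightarrow> v \<in> N - leaves t \<and> f v = lca_lab t x y"
    using ltree_imp_rooted_tree[OF assms(2) finite.emptyI] by (elim exE conjE) (rule that)
  have f: "f v \<in> sym_maps m" if "v \<in> N - verts G" for v
    using that *(3) assms(3,4) by blast
  have "\<forall>v\<in>N - verts G. f v \<in> binary_maps m \<and> (\<forall>i\<in>{1..m}. \<forall>j\<in>{1..m}. f v (i, j) = f v (j, i))"
    using f unfolding sym_maps_def by blast
  moreover have "adj G x y \<longleftrightarrow> f v (c x, c y) = 1"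
    if "x \<in> verts G" "y \<in> verts G" "x \<noteq> y \<and> is_lca A x y v" for x y v
  proof -
    have "f v = lca_lab t x y" using *(4) that assms(3) by blast
    then show ?thesis using assms(6)[OF that(1,2)] that(3) by simp
  qed
  ultimately show ?thesis
    unfolding m_partite_cograph_def using *(1,2) assms(1,3,5)
    by (intro conjI exI[of _ N] exI[of _ r] exI[of _ A] exI[of _ c] exI[of _ f]) blast+
qed

section \<open>Light subtrees on the left\<close>

primrec left_light :: "('l, 'v) ltree \<Rightarrow> bool" where
  "left_light (Leaf v) \<longleftrightarrow> True"
| "left_light (Node l s t) \<longleftrightarrow> left_light s \<and> left_light t \<and> card (leaves s) \<le> card (leaves t)"

text \<open>Exchanging the two children of a node changes neither the leaves nor the labels nor the
  meets of leaves.\<close>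

lemma exists_left_light:
  "distinct_leaves t \<Longrightarrow> \<exists>t'. distinct_leaves t' \<and> left_light t' \<and> leaves t' = leaves t \<and> labs t' = labs t
     \<and> (\<forall>x\<in>leaves t. \<forall>y\<in>leaves t. x \<noteq> y \<longrightarrow> lca_lab t' x y = lca_lab t x y)"
proof (induction t)
  case (Leaf v)
  show ?case by (intro exI[of _ "Leaf v"]) simp
next
  case (Node l s t)
  obtain s' where s: "distinct_leaves s'" "left_light s'" "leaves s' = leaves s" "labs s' = labs s"
     "\<forall>x\<in>leaves s. \<forall>y\<in>leaves s. x \<noteq> y \<longrightarrow> lca_lab s' x y = lca_lab s x y"
    using Node by (auto simp del: ball_simps)
  obtain t' where t: "distinct_leaves t'" "left_light t'" "leaves t' = leaves t" "labs t' = labs t"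
     "\<forall>x\<in>leaves t. \<forall>y\<in>leaves t. x \<noteq> y \<longrightarrow> lca_lab t' x y = lca_lab t x y"
    using Node by (auto simp del: ball_simps)
  have d: "leaves s \<inter> leaves t = {}" using Node.prems by simp
  let ?n = "if card (leaves s) \<le> card (leaves t) then Node l s' t' else Node l t' s'"
  have n1: "lca_lab ?n x y = lca_lab (Node l s t) x y"
    if xy: "x \<in> leaves (Node l s t)" "y \<in> leaves (Node l s t)" "x \<noteq> y" for x y
  proof -
    consider "x \<in> leaves s" "y \<in> leaves s" "x \<notin> leaves t" "y \<notin> leaves t"
      | "x \<in> leaves t" "y \<in> leaves t" "x \<notin> leaves s" "y \<notin> leaves s"
      | "x \<in> leaves s" "y \<in> leaves t" "x \<notin> leaves t" "y \<notin> leaves s"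
      | "x \<in> leaves t" "y \<in> leaves s" "x \<notin> leaves s" "y \<notin> leaves t"
      using xy(1,2) d unfolding ltree.set by blast
    then show ?thesis by cases (use s t xy(3) in simp_all)
  qed
  have n2: "leaves ?n = leaves (Node l s t)" "labs ?n = labs (Node l s t)" "left_light ?n" "distinct_leaves ?n"
    using s(1-4) t(1-4) d by auto
  show ?case
  proof (rule exI[of _ ?n], intro conjI)
    show "\<forall>x\<in>leaves (Node l s t). \<forall>y\<in>leaves (Node l s t). x \<noteq> y \<longrightarrow> lca_lab ?n x y = lca_lab (Node l s t) x y"
      using n1 by blast
  qed (rule n2)+
qed


section \<open>Blowing up leaves into twins\<close>

text \<open>A caterpillar on \<open>n + 1\<close> copies of \<open>v\<close> whose meets all carry
  \<open>l\<close>. With the zero map as \<open>l\<close> the copies become pairwise nonadjacent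
  twins.\<close>

primrec comb :: "'l \<Rightarrow> 'v \<Rightarrow> nat \<Rightarrow> ('l, 'v \<times> nat) ltree" where
  "comb l v 0 = Leaf (v, 0)"
| "comb l v (Suc n) = Node l (Leaf (v, Suc n)) (comb l v n)"

lemma leaves_comb: "leaves (comb l v n) = {v} \<times> {..n}"
proof (induction n)
  case (Suc n)
  have "{v} \<times> {..Suc n} = insert (v, Suc n) ({v} \<times> {..n})" by (auto simp: atMost_Suc)
  then show ?case using Suc by simp
qed simp

lemma distinct_leaves_comb: "distinct_leaves (comb l v n)"
  by (induction n) (auto simp: leaves_comb)

lemma lca_lab_comb: "i \<le> n \<Longrightarrow> j \<le> n \<Longrightarrow> i \<noteq> j \<Longrightarrow> lca_lab (comb l v n) (v, i) (v, j) = l"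
  by (induction n) (auto simp: leaves_comb)

lemma labs_comb: "labs (comb l v n) \<subseteq> {l}"
  by (induction n) auto

primrec blow_up :: "'l \<Rightarrow> nat \<Rightarrow> ('l, 'v) ltree \<Rightarrow> ('l, 'v \<times> nat) ltree" where
  "blow_up l n (Leaf v) = comb l v n"
| "blow_up l n (Node k s t) = Node k (blow_up l n s) (blow_up l n t)"

lemma leaves_blow_up: "leaves (blow_up l n t) = leaves t \<times> {..n}"
  by (induction t) (auto simp: leaves_comb)

lemma distinct_leaves_blow_up: "distinct_leaves t \<Longrightarrow> distinct_leaves (blow_up l n t)"
  by (induction t) (auto simp: distinct_leaves_comb leaves_blow_up)

lemma labs_blow_up: "labs (blow_up l n t) \<subseteq> insert l (labs t)"
  using labs_comb[of l] by (induction t) fastforce+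

lemma lca_lab_blow_up:
  "distinct_leaves t \<Longrightarrow> x \<in> leaves t \<Longrightarrow> y \<in> leaves t \<Longrightarrow> i \<le> n \<Longrightarrow> j \<le> n \<Longrightarrow> (x, i) \<noteq> (y, j) \<Longrightarrow>
   lca_lab (blow_up l n t) (x, i) (y, j) = (if x = y then l else lca_lab t x y)"
proof (induction t)
  case (Leaf v) then show ?case by (auto simp: lca_lab_comb)
next
  case (Node k s t)
  have d: "leaves s \<inter> leaves t = {}" using Node.prems by simp
  consider "x \<in> leaves s" "y \<in> leaves s" "x \<notin> leaves t" "y \<notin> leaves t"
      | "x \<in> leaves t" "y \<in> leaves t" "x \<notin> leaves s" "y \<notin> leaves s"
      | "x \<in> leaves s" "y \<in> leaves t" "x \<notin> leaves t" "y \<notin> leaves s"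
      | "x \<in> leaves t" "y \<in> leaves s" "x \<notin> leaves s" "y \<notin> leaves t"
    using Node.prems(2,3) d unfolding ltree.set by blast
  then show ?case
    by cases (use Node in \<open>auto simp: leaves_blow_up\<close>)
qed

section \<open>Codes of leaves along heavy paths\<close>

text \<open>In the left-to-right layout of the leaves starting at \<open>a\<close>, \<open>code_pos t a x k\<close> is the left end of the
  level \<open>k\<close> block of \<open>x\<close>: entering a left (light) subtree opens the next level, entering a right one
  stays on the current level. From the level where \<open>x\<close> is alone on, it is the position of \<open>x\<close>.\<close>

primrec leaf_pos :: "('l, 'v) ltree \<Rightarrow> nat \<Rightarrow> 'v \<Rightarrow> nat" where
  "leaf_pos (Leaf v) a x = a"
| "leaf_pos (Node l s t) a x = (if x \<in> leaves s then leaf_pos s a x else leaf_pos t (a + card (leaves s)) x)"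

primrec code_pos :: "('l, 'v) ltree \<Rightarrow> nat \<Rightarrow> 'v \<Rightarrow> nat \<Rightarrow> nat" where
  "code_pos (Leaf v) a x k = a"
| "code_pos (Node l s t) a x k =
    (if x \<in> leaves s then (case k of 0 \<Rightarrow> a | Suc j \<Rightarrow> code_pos s a x j)
     else code_pos t (a + card (leaves s)) x k)"

text \<open>Level \<open>k\<close> records the node at which the path to \<open>x\<close> turns left
  for the \<open>k + 1\<close>st time; \<open>d\<close> fills the levels after the last left
  turn.\<close>

primrec code_lab :: "'l \<Rightarrow> ('l, 'v) ltree \<Rightarrow> 'v \<Rightarrow> nat \<Rightarrow> 'l" where
  "code_lab d (Leaf v) x k = d"
| "code_lab d (Node l s t) x k =
    (if x \<in> leaves s then (case k of 0 \<Rightarrow> l | Suc j \<Rightarrow> code_lab d s x j) else code_lab d t x k)"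

lemma card_leaves_Node:
  "distinct_leaves (Node l s t) \<Longrightarrow> card (leaves (Node l s t)) = card (leaves s) + card (leaves t)"
  by (simp add: card_Un_disjoint)

lemma code_lab_in: "x \<in> leaves t \<Longrightarrow> code_lab d t x k \<in> insert d (labs t)"
  by (induction t arbitrary: k) (auto split: nat.split)

lemma leaf_pos_bounds:
  "distinct_leaves t \<Longrightarrow> x \<in> leaves t \<Longrightarrow> a \<le> leaf_pos t a x \<and> leaf_pos t a x < a + card (leaves t)"
proof (induction t arbitrary: a)
  case (Node l s t)
  show ?case
  proof (cases "x \<in> leaves s")
    case True
    then show ?thesis using Node.IH(1)[of a] Node.prems card_leaves_Node[OF Node.prems(1)] by auto
  next
    case False
    then show ?thesis
      using Node.IH(2)[of "a + card (leaves s)"] Node.prems card_leaves_Node[OF Node.prems(1)] by auto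
  qed
qed auto

lemma leaf_pos_inj: "distinct_leaves t \<Longrightarrow> inj_on (leaf_pos t a) (leaves t)"
proof (induction t arbitrary: a)
  case (Node l s t)
  show ?case
  proof (rule inj_onI)
    fix x y assume xy: "x \<in> leaves (Node l s t)" "y \<in> leaves (Node l s t)"
      and eq: "leaf_pos (Node l s t) a x = leaf_pos (Node l s t) a y"
    have *: "z \<in> leaves s \<Longrightarrow> leaf_pos (Node l s t) a z < a + card (leaves s)"
       "z \<in> leaves t \<Longrightarrow> a + card (leaves s) \<le> leaf_pos (Node l s t) a z" for z
      using leaf_pos_bounds[of s z a] leaf_pos_bounds[of t z "a + card (leaves s)"] Node.prems by auto
    from *[of x] *[of y] eq xy consider "x \<in> leaves s" "y \<in> leaves s" | "x \<in> leaves t" "y \<in> leaves t"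
      by force
    then show "x = y"
    proof cases
      case 1 then show ?thesis using eq Node by (auto dest: inj_onD)
    next
      case 2
      moreover have "x \<notin> leaves s" "y \<notin> leaves s" using 2 Node.prems by auto
      ultimately show ?thesis using eq Node by (auto dest: inj_onD)
    qed
  qed
qed auto

lemma code_pos_bounds:
  "distinct_leaves t \<Longrightarrow> x \<in> leaves t \<Longrightarrow> a \<le> code_pos t a x k \<and> code_pos t a x k \<le> leaf_pos t a x"
proof (induction t arbitrary: a k)
  case (Node l s t)
  show ?case
  proof (cases "x \<in> leaves s")
    case True
    then show ?thesis using Node.IH(1)[of a] Node.prems leaf_pos_bounds[of s x a] by (auto split: nat.split)
  next
    case False
    then show ?thesis using Node.IH(2)[of "a + card (leaves s)" k] Node.prems by auto
  qed
qed auto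

text \<open>Take \<open>k\<close> to be the number of left turns made before the two paths part. The
  leaf going left records the parting node at level \<open>k\<close>, and all positions of the left
  subtree precede those of the right one. The inequality uses \<open>leaf_pos\<close> rather than
  the smaller \<open>code_pos\<close> of that leaf because leaf positions are injective, so that
  pairs with a small gap can be counted.\<close>

lemma code_separates:
  assumes "distinct_leaves t" "x \<in> leaves t" "y \<in> leaves t" "x \<noteq> y"
  shows "\<exists>k. (\<forall>j<k. code_pos t a x j = code_pos t a y j \<and> code_lab d t x j = code_lab d t y j)
    \<and> (leaf_pos t a x < code_pos t a y k \<and> lca_lab t x y = code_lab d t x k
      \<or> leaf_pos t a y < code_pos t a x k \<and> lca_lab t x y = code_lab d t y k)"
  using assms
proof (induction t arbitrary: a)
  case (Leaf v) then show ?case by auto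
next
  case (Node l s t)
  have d: "leaves s \<inter> leaves t = {}" "distinct_leaves s" "distinct_leaves t" using Node.prems by auto
  have sep: "leaf_pos s a z < code_pos t (a + card (leaves s)) w 0"
    if "z \<in> leaves s" "w \<in> leaves t" for z w
    using leaf_pos_bounds[OF d(2) that(1), of a] code_pos_bounds[OF d(3) that(2), of "a + card (leaves s)" 0]
    by linarith
  consider "x \<in> leaves s" "y \<in> leaves s" "x \<notin> leaves t" "y \<notin> leaves t"
      | "x \<in> leaves t" "y \<in> leaves t" "x \<notin> leaves s" "y \<notin> leaves s"
      | "x \<in> leaves s" "y \<in> leaves t" "x \<notin> leaves t" "y \<notin> leaves s"
      | "x \<in> leaves t" "y \<in> leaves s" "x \<notin> leaves s" "y \<notin> leaves t"
    using Node.prems(2,3) d unfolding ltree.set by blast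
  then show ?case
  proof cases
    case 1
    obtain k where k: "\<forall>j<k. code_pos s a x j = code_pos s a y j \<and> code_lab d s x j = code_lab d s y j"
      "leaf_pos s a x < code_pos s a y k \<and> lca_lab s x y = code_lab d s x k
      \<or> leaf_pos s a y < code_pos s a x k \<and> lca_lab s x y = code_lab d s y k"
      using Node.IH(1)[OF d(2) 1(1,2) Node.prems(4), of a] by (elim exE conjE) (rule that)
    show ?thesis by (rule exI[of _ "Suc k"]) (use k 1 in \<open>auto simp: less_Suc_eq_0_disj split: nat.split\<close>)
  next
    case 2
    show ?thesis using Node.IH(2)[OF d(3) 2(1,2) Node.prems(4), of "a + card (leaves s)"] 2 by simp
  next
    case 3
    show ?thesis by (rule exI[of _ 0]) (use 3 sep in auto)
  next
    case 4
    show ?thesis by (rule exI[of _ 0]) (use 4 sep in auto)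
  qed
qed

text \<open>Sharing the block of \<open>x\<close> at levels up to \<open>k\<close> means having made
  the same \<open>k + 1\<close> left turns, each into a subtree with at most half of the leaves. If
  the path to \<open>x\<close> has fewer left turns, the class is a singleton, which accounts for
  the \<open>max\<close>.\<close>

lemma code_class_card:
  assumes "distinct_leaves t" "left_light t" "x \<in> leaves t"
  shows "2 ^ Suc k * card {y \<in> leaves t. \<forall>j\<le>k. code_pos t a y j = code_pos t a x j} \<le> max (2 ^ Suc k) (card (leaves t))"
  using assms
proof (induction t arbitrary: a k)
  case (Leaf v)
  have "{y \<in> leaves (Leaf v). \<forall>j\<le>k. code_pos (Leaf v) a y j = code_pos (Leaf v) a x j} = {v}" by auto
  then show ?case unfolding \<open>_ = {v}\<close> by simp
next
  case (Node l s t)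
  have d: "leaves s \<inter> leaves t = {}" "distinct_leaves s" "distinct_leaves t" using Node.prems by auto
  have l: "left_light s" "left_light t" "card (leaves s) \<le> card (leaves t)" using Node.prems by auto
  have c: "card (leaves (Node l s t)) = card (leaves s) + card (leaves t)"
    by (rule card_leaves_Node[OF Node.prems(1)])
  let ?S = "{y \<in> leaves (Node l s t). \<forall>j\<le>k. code_pos (Node l s t) a y j = code_pos (Node l s t) a x j}"
  have pos_t: "a < code_pos t (a + card (leaves s)) y j" if "y \<in> leaves t" for y j
    using code_pos_bounds[OF d(3) that, of "a + card (leaves s)" j] card_leaves_pos[of s] by linarith
  show ?case
  proof (cases "x \<in> leaves s")
    case True
    have sub: "?S \<subseteq> leaves s"
    proof
      fix y assume y: "y \<in> ?S"
      then have "code_pos (Node l s t) a y 0 = a" using True by auto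
      then show "y \<in> leaves s" using y pos_t[of y 0] by (auto split: if_splits)
    qed
    show ?thesis
    proof (cases k)
      case 0
      have "card ?S \<le> card (leaves s)" using sub by (intro card_mono) auto
      then show ?thesis using l c 0 by simp
    next
      case (Suc i)
      let ?S' = "{y \<in> leaves s. \<forall>j\<le>i. code_pos s a y j = code_pos s a x j}"
      have "?S \<subseteq> ?S'"
      proof
        fix y assume y: "y \<in> ?S"
        then have ys: "y \<in> leaves s" using sub by auto
        have "code_pos s a y j = code_pos s a x j" if "j \<le> i" for j
        proof -
          have "code_pos (Node l s t) a y (Suc j) = code_pos (Node l s t) a x (Suc j)"
            using y that Suc by blast
          then show ?thesis using True ys by simp
        qed
        then show "y \<in> ?S'" using ys by simp
      qed
      then have "card ?S \<le> card ?S'" by (intro card_mono) auto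
      moreover have "2 ^ Suc i * card ?S' \<le> max (2 ^ Suc i) (card (leaves s))"
        using Node.IH(1)[OF d(2) l(1) True] .
      ultimately have "2 ^ Suc i * card ?S \<le> max (2 ^ Suc i) (card (leaves s))"
        by (meson le_trans mult_le_mono2)
      then have "2 ^ Suc k * card ?S \<le> 2 * max (2 ^ Suc i) (card (leaves s))" using Suc by simp
      also have "\<dots> \<le> max (2 ^ Suc k) (card (leaves (Node l s t)))" unfolding c Suc using l by auto
      finally show ?thesis .
    qed
  next
    case False
    then have xt: "x \<in> leaves t" using Node.prems by auto
    let ?S' = "{y \<in> leaves t. \<forall>j\<le>k. code_pos t (a + card (leaves s)) y j = code_pos t (a + card (leaves s)) x j}"
    have "?S \<subseteq> ?S'"
    proof
      fix y assume y: "y \<in> ?S"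
      have "y \<notin> leaves s"
      proof
        assume "y \<in> leaves s"
        then have "code_pos (Node l s t) a y 0 = a" by simp
        moreover have "code_pos (Node l s t) a y 0 = code_pos (Node l s t) a x 0" using y by blast
        ultimately show False using False pos_t[OF xt, of 0] by simp
      qed
      then show "y \<in> ?S'" using y False by auto
    qed
    then have "card ?S \<le> card ?S'" by (intro card_mono) auto
    moreover have "2 ^ Suc k * card ?S' \<le> max (2 ^ Suc k) (card (leaves t))"
      using Node.IH(2)[OF d(3) l(2) xt] .
    ultimately have "2 ^ Suc k * card ?S \<le> max (2 ^ Suc k) (card (leaves t))"
      by (meson le_trans mult_le_mono2)
    also have "\<dots> \<le> max (2 ^ Suc k) (card (leaves (Node l s t)))" unfolding c by auto
    finally show ?thesis .
  qed
qed

subsection \<open>Finite subsets of tree semilattices\<close>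

text \<open>Induction on the number of points. The meet \<open>v\<close> of all points becomes the
  root; the points are split into those whose meet with a chosen point \<open>x i\<close> lies
  strictly above \<open>v\<close> and the others. Any two points from different sides meet exactly
  at \<open>v\<close>.\<close>

lemma tree_semilattice_ltree:
  assumes T: "tree_semilattice S w" and "finite I" "I \<noteq> {}" "inj_on x I" "x ` I \<subseteq> S"
  shows "\<exists>t. distinct_leaves t \<and> leaves t = I \<and> labs t \<subseteq> g ` S
    \<and> (\<forall>i\<in>I. \<forall>j\<in>I. i \<noteq> j \<longrightarrow> lca_lab t i j = g (w (x i) (x j)))"
proof -
  have idem: "w a a = a" if "a \<in> S" for a using T that by (auto simp: tree_semilattice_def)
  have cl: "w a b \<in> S" and comm: "w a b = w b a"
    if "a \<in> S" "b \<in> S" for a b using T that by (auto simp: tree_semilattice_def)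
  have assoc: "w (w a b) c = w a (w b c)" if "a \<in> S" "b \<in> S" "c \<in> S" for a b c
    using T that by (auto simp: tree_semilattice_def)
  have chain: "w a c = a \<Longrightarrow> w b c = b \<Longrightarrow> w a b = a \<or> w a b = b" if "a \<in> S" "b \<in> S" "c \<in> S" for a b c
    using T that unfolding tree_semilattice_def by blast
  have below: "w (w a b) a = w a b" if "a \<in> S" "b \<in> S" for a b
    by (metis assoc cl comm idem that)
  have trans: "w a c = a" if "w a b = a" "w b c = b" "a \<in> S" "b \<in> S" "c \<in> S" for a b c
    by (metis assoc that)
  have glb: "w c (w a b) = c" if "w c a = c" "w c b = c" "a \<in> S" "b \<in> S" "c \<in> S" for a b c
    by (metis assoc that)
  show ?thesis
    using assms(2-)
  proof (induction "card I" arbitrary: I rule: less_induct)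
    case less
    have xS: "x i \<in> S" if "i \<in> I" for i using less.prems that by auto
    show ?case
    proof (cases "card I = 1")
      case True
      then obtain i where "I = {i}" by (auto simp: card_1_singleton_iff)
      then show ?thesis by (intro exI[of _ "Leaf i"]) auto
    next
      case False
      \<comment> \<open>All meets with a fixed \<open>x i\<close> lie below \<open>x i\<close>,
        hence form a chain; finitely many of them have a least one. The least meet with
        \<open>x i0\<close> is below every point, which gives the root \<open>v\<close>.\<close>
      have min: "\<exists>j\<in>J. \<forall>j'\<in>J. w (w (x i) (x j)) (w (x i) (x j')) = w (x i) (x j)"
        if "finite J" "J \<noteq> {}" "J \<subseteq> I" "i \<in> I" for i J
        using that
      proof (induction rule: finite_ne_induct)
        case (singleton j)
        then show ?case using xS cl idem by auto
      next
        case (insert k J)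
        then obtain j where j: "j \<in> J" "\<forall>j'\<in>J. w (w (x i) (x j)) (w (x i) (x j')) = w (x i) (x j)" by auto
        have S: "x i \<in> S" "x k \<in> S" "x j \<in> S" "\<And>j'. j' \<in> J \<Longrightarrow> x j' \<in> S" using insert.prems j xS by auto
        have "w (w (x i) (x j)) (w (x i) (x k)) = w (x i) (x j) \<or> w (w (x i) (x j)) (w (x i) (x k)) = w (x i) (x k)"
          using chain[OF cl[OF S(1,3)] cl[OF S(1,2)] S(1)] below S by blast
        then show ?case
        proof
          assume "w (w (x i) (x j)) (w (x i) (x k)) = w (x i) (x j)"
          then show ?thesis using j by (intro bexI[of _ j]) auto
        next
          assume k: "w (w (x i) (x j)) (w (x i) (x k)) = w (x i) (x k)"
          have "w (w (x i) (x k)) (w (x i) (x j')) = w (x i) (x k)" if "j' \<in> insert k J" for j'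
          proof (cases "j' = k")
            case True then show ?thesis using S cl idem by auto
          next
            case False
            then have "j' \<in> J" using that by simp
            then show ?thesis
              using trans[of "w (x i) (x k)" "w (x i) (x j)" "w (x i) (x j')"] k j cl S comm by metis
          qed
          then show ?thesis by blast
        qed
      qed
      obtain i0 where i0: "i0 \<in> I" using less.prems by auto
      from min[OF less.prems(1,2) subset_refl i0] obtain j0 where j0: "j0 \<in> I"
        "\<forall>j'\<in>I. w (w (x i0) (x j0)) (w (x i0) (x j')) = w (x i0) (x j0)" by blast
      define v where "v = w (x i0) (x j0)"
      have vS: "v \<in> S" using cl xS i0 j0 by (simp add: v_def)
      have vle: "w v (x j) = v" if "j \<in> I" for j
      proof -
        have "w v (w (x i0) (x j)) = v" using j0(2) that by (simp add: v_def)
        moreover have "w (w (x i0) (x j)) (x j) = w (x i0) (x j)"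
          using below[OF xS[OF that] xS[OF i0]] comm xS that i0 by metis
        ultimately show ?thesis using trans vS xS cl i0 that by meson
      qed
      \<comment> \<open>The condition \<open>x i \<noteq> v\<close> puts \<open>i\<close> itself
        into \<open>C\<close>, and \<open>j\<close> outside it, so both sides are nonempty. One of
        the points may be \<open>v\<close>; injectivity then provides another point to play the role
        of \<open>x i\<close>.\<close>
      have "\<exists>i\<in>I. \<exists>j\<in>I. w (x i) (x j) = v \<and> x i \<noteq> v"
      proof (cases "x i0 = v")
        case False
        then have "w (x i0) (x j0) = v \<and> x i0 \<noteq> v" by (simp add: v_def)
        then show ?thesis using i0 j0(1) by blast
      next
        case True
        have "\<not> I \<subseteq> {i0}" using False less.prems(1) i0 by (metis is_singletonI is_singleton_altdef subset_singletonD empty_iff)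
        then obtain i1 where i1: "i1 \<in> I" "i1 \<noteq> i0" by blast
        then have "x i1 \<noteq> v" using True less.prems(3) i0 by (metis inj_onD)
        moreover have "w (x i1) (x i0) = v" using vle[OF i1(1)] comm True vS xS i1 by metis
        ultimately show ?thesis using i0 i1 by blast
      qed
      then obtain i j where ij: "i \<in> I" "j \<in> I" "w (x i) (x j) = v" "x i \<noteq> v" by blast
      define C where "C = {k \<in> I. w (x i) (x k) \<noteq> v}"
      have iC: "i \<in> C" using ij idem xS by (simp add: C_def)
      have jC: "j \<in> I - C" using ij by (simp add: C_def)
      have fin: "finite C" "C \<subseteq> I" "finite (I - C)" using less.prems(1) by (auto simp: C_def)
      have cards: "card C < card I" "card (I - C) < card I"
        using iC jC less.prems(1) fin by (auto intro!: psubset_card_mono)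
      \<comment> \<open>The meets \<open>?a\<close> and \<open>?b\<close> are both below
        \<open>x k\<close>, hence comparable. If \<open>?a\<close> were below \<open>?b\<close>, it
        would be below \<open>x l\<close> and so below \<open>v\<close>, against the choice of
        \<open>k\<close>. Hence \<open>?b\<close> is below \<open>?a\<close>, thus below
        \<open>x i\<close> and \<open>x l\<close>, and so equal to \<open>v\<close>.\<close>
      have cross: "w (x k) (x l) = v" if "k \<in> C" "l \<in> I - C" for k l
      proof -
        have kl: "k \<in> I" "l \<in> I" "w (x i) (x k) \<noteq> v" "w (x i) (x l) = v" using that by (auto simp: C_def)
        let ?a = "w (x i) (x k)" and ?b = "w (x k) (x l)"
        have S: "x i \<in> S" "x k \<in> S" "x l \<in> S" "?a \<in> S" "?b \<in> S" using xS kl ij cl by auto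
        have va: "w v ?a = v" "w v ?b = v" using glb vle vS S kl ij by auto
        have a: "w ?a (x i) = ?a" "w ?a (x k) = ?a" "w ?b (x k) = ?b" "w ?b (x l) = ?b"
          using below[OF S(1,2)] below[OF S(2,1)] below[OF S(2,3)] below[OF S(3,2)] comm S by metis+
        from chain[OF S(4,5) S(2) a(2,3)] show ?thesis
        proof
          assume "w ?a ?b = ?a"
          then have "w ?a (x l) = ?a" using trans a(4) S by meson
          then have "w ?a v = ?a" using glb[of ?a "x i" "x l"] a(1) S kl(4) by simp
          then have "?a = v" using va(1) comm vS S by metis
          then show ?thesis using kl by simp
        next
          assume "w ?a ?b = ?b"
          then have "w ?b ?a = ?b" using comm S by metis
          then have "w ?b (x i) = ?b" using trans a(1) S by meson
          then have "w ?b v = ?b" using glb[of ?b "x i" "x l"] a(4) S kl(4) by simp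
          then show ?thesis using va(2) comm vS S by metis
        qed
      qed
      have "\<exists>t. distinct_leaves t \<and> leaves t = C \<and> labs t \<subseteq> g ` S
          \<and> (\<forall>i\<in>C. \<forall>j\<in>C. i \<noteq> j \<longrightarrow> lca_lab t i j = g (w (x i) (x j)))"
        using less.prems fin iC by (intro less.hyps cards) (auto intro: inj_on_subset)
      then obtain s where s: "distinct_leaves s" "leaves s = C" "labs s \<subseteq> g ` S"
          "\<forall>i\<in>C. \<forall>j\<in>C. i \<noteq> j \<longrightarrow> lca_lab s i j = g (w (x i) (x j))" by (elim exE conjE) (rule that)
      have "\<exists>t. distinct_leaves t \<and> leaves t = I - C \<and> labs t \<subseteq> g ` S
          \<and> (\<forall>i\<in>I - C. \<forall>j\<in>I - C. i \<noteq> j \<longrightarrow> lca_lab t i j = g (w (x i) (x j)))"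
        using less.prems fin jC by (intro less.hyps cards) (auto intro: inj_on_subset)
      then obtain t where t: "distinct_leaves t" "leaves t = I - C" "labs t \<subseteq> g ` S"
          "\<forall>i\<in>I - C. \<forall>j\<in>I - C. i \<noteq> j \<longrightarrow> lca_lab t i j = g (w (x i) (x j))" by (elim exE conjE) (rule that)
      have "lca_lab (Node (g v) s t) k l = g (w (x k) (x l))" if kl: "k \<in> I" "l \<in> I" "k \<noteq> l" for k l
      proof -
        consider "k \<in> C" "l \<in> C" | "k \<in> I - C" "l \<in> I - C" | "k \<in> C" "l \<in> I - C" | "k \<in> I - C" "l \<in> C"
          using kl by blast
        then show ?thesis
        proof cases
          case 4
          then show ?thesis using cross[of l k] comm[of "x k" "x l"] xS kl by (auto simp: s(2) t(2))
        qed (use s(4) t(4) kl cross in \<open>auto simp: s(2) t(2)\<close>)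
      qed
      then show ?thesis
        by (intro exI[of _ "Node (g v) s t"] conjI) (use s t vS fin in auto)
    qed
  qed
qed

section \<open>Uniform measures and tuples with repeated entries\<close>

lemma prob_space_uniform: "finite V \<Longrightarrow> V \<noteq> {} \<Longrightarrow> prob_space (uniform_count_measure V)"
  by (rule prob_space_uniform_count_measure)

lemma sets_pair_uniform:
  "finite V \<Longrightarrow> sets (uniform_count_measure V \<Otimes>\<^sub>M uniform_count_measure V) = Pow (V \<times> V)"
proof -
  assume "finite V"
  have "sets (uniform_count_measure V \<Otimes>\<^sub>M uniform_count_measure V) = sets (count_space V \<Otimes>\<^sub>M count_space V)"
    by (intro sets_pair_measure_cong) (simp_all add: sets_uniform_count_measure)
  then show ?thesis by (simp only: pair_measure_count_space[OF \<open>finite V\<close> \<open>finite V\<close>] sets_count_space)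
qed

lemma measurable_pair_uniform:
  "finite V \<Longrightarrow> f \<in> uniform_count_measure V \<Otimes>\<^sub>M uniform_count_measure V \<rightarrow>\<^sub>M count_space UNIV"
  by (rule measurableI) (auto simp: sets_pair_uniform space_pair_measure space_uniform_count_measure)

lemma Collect_in_sets_pair_uniform:
  "finite V \<Longrightarrow> {z \<in> space (uniform_count_measure V \<Otimes>\<^sub>M uniform_count_measure V). P z}
     \<in> sets (uniform_count_measure V \<Otimes>\<^sub>M uniform_count_measure V)"
  by (auto simp: sets_pair_uniform space_pair_measure space_uniform_count_measure)

lemma measure_PiM_uniform:
  assumes V: "finite V" "V \<noteq> {}" and I: "finite I" and S: "S \<subseteq> I \<rightarrow>\<^sub>E V"
  shows "measure (\<Pi>\<^sub>M i\<in>I. uniform_count_measure V) S = real (card S) / real (card V) ^ card I"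
proof -
  let ?U = "uniform_count_measure V" let ?P = "\<Pi>\<^sub>M i\<in>I. ?U"
  interpret U: prob_space ?U using V by (rule prob_space_uniform)
  interpret product_prob_space "\<lambda>_. ?U" by unfold_locales
  have sing: "{h} \<in> sets ?P \<and> measure ?P {h} = 1 / real (card V) ^ card I" if "h \<in> I \<rightarrow>\<^sub>E V" for h
  proof -
    have h: "{h} = (\<Pi>\<^sub>E i\<in>I. {h i})" using that by (auto simp: PiE_iff extensional_def fun_eq_iff) metis
    have hs: "i \<in> I \<Longrightarrow> {h i} \<in> sets ?U" for i using that by (auto simp: sets_uniform_count_measure)
    have "emeasure ?P {h} = (\<Prod>i\<in>I. emeasure ?U {h i})"
      unfolding h using hs by (intro emeasure_PiM I) auto
    also have "\<dots> = (\<Prod>i\<in>I. ennreal (1 / real (card V)))"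
      using that V by (intro prod.cong refl) (simp add: emeasure_uniform_count_measure PiE_iff)
    also have "\<dots> = ennreal ((1 / real (card V)) ^ card I)" by (simp add: ennreal_power)
    finally have "measure ?P {h} = (1 / real (card V)) ^ card I"
      by (simp add: measure_def)
    moreover have "{h} \<in> sets ?P" unfolding h using hs by (intro sets_PiM_I_finite I)
    ultimately show ?thesis by (simp add: power_one_over)
  qed
  have "finite S" using S I V finite_subset finite_PiE[of I "\<lambda>_. V"] by blast
  then have "measure ?P S = (\<Sum>h\<in>S. measure ?P {h})"
    using sing S by (intro finite_measure_eq_sum_singleton) auto
  also have "\<dots> = (\<Sum>h\<in>S. 1 / real (card V) ^ card I)" using sing S by (intro sum.cong) auto
  finally show ?thesis by simp
qed

lemma measure_diagonal_le:
  assumes "prob_space \<nu>" "{z \<in> space (\<nu> \<Otimes>\<^sub>M \<nu>). fst z = snd z} \<in> sets (\<nu> \<Otimes>\<^sub>M \<nu>)"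
    and e: "\<And>x. x \<in> space \<nu> \<Longrightarrow> emeasure \<nu> {x} \<le> ennreal e" "0 \<le> e"
  shows "measure (\<nu> \<Otimes>\<^sub>M \<nu>) {z \<in> space (\<nu> \<Otimes>\<^sub>M \<nu>). fst z = snd z} \<le> e"
proof -
  interpret prob_space \<nu> by fact
  let ?D = "{z \<in> space (\<nu> \<Otimes>\<^sub>M \<nu>). fst z = snd z}"
  have "emeasure (\<nu> \<Otimes>\<^sub>M \<nu>) ?D = (\<integral>\<^sup>+x. emeasure \<nu> (Pair x -` ?D) \<partial>\<nu>)"
    using assms(2) by (rule emeasure_pair_measure_alt)
  also have "\<dots> \<le> (\<integral>\<^sup>+x. ennreal e \<partial>\<nu>)"
  proof (rule nn_integral_mono)
    fix x assume "x \<in> space \<nu>"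
    then have "Pair x -` ?D = {x}" by (auto simp: space_pair_measure)
    then show "emeasure \<nu> (Pair x -` ?D) \<le> ennreal e" using e \<open>x \<in> space \<nu>\<close> by simp
  qed
  also have "\<dots> = ennreal e" by (simp add: emeasure_space_1)
  finally show ?thesis using e(2) by (simp add: measure_def enn2real_leI)
qed

lemma non_inj_sets:
  assumes "{z \<in> space (\<nu> \<Otimes>\<^sub>M \<nu>). fst z = snd z} \<in> sets (\<nu> \<Otimes>\<^sub>M \<nu>)" "finite I"
  shows "{x \<in> space (\<Pi>\<^sub>M i\<in>I. \<nu>). \<not> inj_on x I} \<in> sets (\<Pi>\<^sub>M i\<in>I. \<nu>)"
proof -
  have 1: "(\<lambda>(x, y). x = y) \<in> \<nu> \<Otimes>\<^sub>M \<nu> \<rightarrow>\<^sub>M count_space UNIV"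
    using assms(1) by (simp add: pred_def case_prod_unfold)
  have "Measurable.pred (\<Pi>\<^sub>M i\<in>I. \<nu>) (\<lambda>x. x i = x j)" if "i \<in> I" "j \<in> I" for i j
    using pred_edges[OF 1, of "{(i, j)}" I] that by simp
  then have "Measurable.pred (\<Pi>\<^sub>M i\<in>I. \<nu>) (\<lambda>x. \<not> (\<forall>i\<in>I. \<forall>j\<in>I. i \<noteq> j \<longrightarrow> x i \<noteq> x j))"
    using assms(2) by (intro pred_intros_logic pred_intros_finite) auto
  then show ?thesis by (simp add: pred_def inj_on_def) (smt (verit, ccfv_threshold) Collect_cong)
qed

text \<open>Union bound over pairs of coordinates. The bound \<open>e\<close> on point masses is
  \<open>0\<close> for atomless measures and \<open>1 / card V\<close> for uniform ones, so one
  lemma serves the limit and the finite graphs.\<close>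

lemma measure_non_inj_le:
  assumes "prob_space \<nu>" "{z \<in> space (\<nu> \<Otimes>\<^sub>M \<nu>). fst z = snd z} \<in> sets (\<nu> \<Otimes>\<^sub>M \<nu>)"
    and e: "\<And>x. x \<in> space \<nu> \<Longrightarrow> emeasure \<nu> {x} \<le> ennreal e" "0 \<le> e" and I: "finite I"
  shows "measure (\<Pi>\<^sub>M i\<in>I. \<nu>) {x \<in> space (\<Pi>\<^sub>M i\<in>I. \<nu>). \<not> inj_on x I} \<le> real (card I) ^ 2 * e"
proof -
  let ?P = "\<Pi>\<^sub>M i\<in>I. \<nu>"
  interpret prob_space ?P using assms(1) by (intro prob_space_PiM)
  let ?S = "\<lambda>(i, j). {x \<in> space ?P. i \<noteq> j \<and> x i = x j}"
  have S: "?S z \<in> sets ?P \<and> measure ?P (?S z) \<le> e" if "z \<in> I \<times> I" for z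
  proof (cases "fst z = snd z")
    case True then show ?thesis using e(2) by (auto simp: case_prod_unfold)
  next
    case False
    obtain i j where z: "z = (i, j)" by force
    have ij: "i \<in> I" "j \<in> I" "i \<noteq> j" using that False z by auto
    have m: "(\<lambda>x. (x i, x j)) \<in> ?P \<rightarrow>\<^sub>M \<nu> \<Otimes>\<^sub>M \<nu>"
      using ij by (intro measurable_Pair measurable_component_singleton)
    have eq: "?S z = (\<lambda>x. (x i, x j)) -` {z \<in> space (\<nu> \<Otimes>\<^sub>M \<nu>). fst z = snd z} \<inter> space ?P"
      using ij measurable_space[OF m] by (auto simp: z)
    have "?S z \<in> sets ?P" unfolding eq using m assms(2) by (rule measurable_sets)
    moreover have "measure ?P (?S z) = measure (distr ?P (\<nu> \<Otimes>\<^sub>M \<nu>) (\<lambda>x. (x i, x j))) {z \<in> space (\<nu> \<Otimes>\<^sub>M \<nu>). fst z = snd z}"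
      unfolding eq using measure_distr[OF m assms(2)] by simp
    ultimately show ?thesis
      using measure_diagonal_le[OF assms(1,2) e] distr_PiM_pair[OF assms(1) ij] by simp
  qed
  have "{x \<in> space ?P. \<not> inj_on x I} = (\<Union>z\<in>I \<times> I. ?S z)" by (auto simp: inj_on_def)
  then have "measure ?P {x \<in> space ?P. \<not> inj_on x I} \<le> (\<Sum>z\<in>I \<times> I. measure ?P (?S z))"
    using S I by (simp only:) (intro finite_measure_subadditive_finite, auto)
  also have "\<dots> \<le> (\<Sum>z\<in>I \<times> I. e)" using S by (intro sum_mono) auto
  also have "\<dots> = real (card I) ^ 2 * e" by (simp add: card_cartesian_product power2_eq_square)
  finally show ?thesis .
qed

subsection \<open>Homomorphism densities\<close>

definition lt_edges :: "nat graph \<Rightarrow> (nat \<times> nat) set" where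
  "lt_edges F = {(i, j). i \<in> verts F \<and> j \<in> verts F \<and> i < j \<and> adj F i j}"

lemma lt_edges_subset: "lt_edges F \<subseteq> verts F \<times> verts F"
  by (auto simp: lt_edges_def)

lemma edge_dens_uniform:
  assumes "finite V" "V \<noteq> {}" "finite I"
  shows "edge_dens I D (uniform_count_measure V) E
    = real (card {h \<in> I \<rightarrow>\<^sub>E V. \<forall>(i, j)\<in>D. E (h i) (h j)}) / real (card V) ^ card I"
  unfolding edge_dens_def
  by (subst measure_PiM_uniform[OF assms]) (auto simp: space_PiM space_uniform_count_measure)

text \<open>Both graphs are symmetric and \<open>F\<close> is loopless, so testing every edge in its
  increasing orientation suffices.\<close>

lemma hom_density_eq_edge_dens:
  assumes F: "finite_graph F" and G: "finite_graph G" "verts G \<noteq> {}"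
  shows "hom_density F G = edge_dens (verts F) (lt_edges F) (uniform_count_measure (verts G)) (adj G)"
proof -
  have "(\<forall>x\<in>verts F. \<forall>y\<in>verts F. adj F x y \<longrightarrow> adj G (h x) (h y)) \<longleftrightarrow> (\<forall>(i, j)\<in>lt_edges F. adj G (h i) (h j))"
    if h: "h \<in> verts F \<rightarrow>\<^sub>E verts G" for h
  proof (intro iffI ballI impI)
    fix x y assume *: "\<forall>(i, j)\<in>lt_edges F. adj G (h i) (h j)"
      and xy: "x \<in> verts F" "y \<in> verts F" "adj F x y"
    have "x \<noteq> y" "adj F y x" using F xy by (auto simp: finite_graph_def)
    then have "x < y \<and> (x, y) \<in> lt_edges F \<or> y < x \<and> (y, x) \<in> lt_edges F"
      using xy by (auto simp: lt_edges_def)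
    then have "adj G (h x) (h y) \<or> adj G (h y) (h x)" using * by blast
    moreover have "h x \<in> verts G" "h y \<in> verts G" using h xy by auto
    ultimately show "adj G (h x) (h y)" using G(1) by (auto simp: finite_graph_def)
  qed (auto simp: lt_edges_def)
  then have "{h \<in> verts F \<rightarrow>\<^sub>E verts G. \<forall>x\<in>verts F. \<forall>y\<in>verts F. adj F x y \<longrightarrow> adj G (h x) (h y)}
     = {h \<in> verts F \<rightarrow>\<^sub>E verts G. \<forall>(i, j)\<in>lt_edges F. adj G (h i) (h j)}" by blast
  then show ?thesis
    using F G by (subst edge_dens_uniform) (auto simp: hom_density_def hom_count_def finite_graph_def)
qed

lemma graphon_density_eq_edge_dens:
  assumes "finite_graph F" "prob_space \<nu>" "(\<lambda>(x, y). E x y) \<in> \<nu> \<Otimes>\<^sub>M \<nu> \<rightarrow>\<^sub>M count_space UNIV"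
  shows "graphon_density F \<nu> (random_free_graphon E) = edge_dens (verts F) (lt_edges F) \<nu> E"
proof -
  let ?P = "\<Pi>\<^sub>M i\<in>verts F. \<nu>"
  interpret prob_space ?P using assms(2) by (intro prob_space_PiM)
  have fin: "finite (lt_edges F)"
    using assms(1) lt_edges_subset[of F] finite_subset by (fastforce simp: finite_graph_def)
  let ?S = "{x \<in> space ?P. \<forall>(i, j)\<in>lt_edges F. E (x i) (x j)}"
  have S: "?S \<in> sets ?P"
    using pred_edges[OF assms(3) fin lt_edges_subset] by (simp add: pred_def)
  have "graphon_density F \<nu> (random_free_graphon E) = (\<integral>x. indicator ?S x \<partial>?P)"
    unfolding graphon_density_def lt_edges_def[symmetric]
  proof (rule Bochner_Integration.integral_cong[OF refl])
    fix x assume x: "x \<in> space ?P"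
    show "(\<Prod>(i, j)\<in>lt_edges F. random_free_graphon E (x i) (x j)) = indicator ?S x"
    proof (cases "\<forall>(i, j)\<in>lt_edges F. E (x i) (x j)")
      case True
      then have "(\<Prod>(i, j)\<in>lt_edges F. random_free_graphon E (x i) (x j)) = (\<Prod>z\<in>lt_edges F. 1)"
        by (intro prod.cong) (auto simp: random_free_graphon_def)
      then show ?thesis using True x by (auto simp: indicator_def)
    next
      case False
      then obtain z where "z \<in> lt_edges F" "\<not> (case z of (i, j) \<Rightarrow> E (x i) (x j))" by blast
      then have "(\<Prod>(i, j)\<in>lt_edges F. random_free_graphon E (x i) (x j)) = 0"
        using fin by (intro prod_zero bexI[of _ z]) (auto simp: random_free_graphon_def split: prod.splits)
      then show ?thesis using False by (auto simp: indicator_def)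
    qed
  qed
  also have "\<dots> = measure ?P ?S" using S by simp
  finally show ?thesis by (simp add: edge_dens_def)
qed

subsection \<open>Quantifier-free formulas as combinations of edge monomials\<close>

definition all_edges :: "nat \<Rightarrow> (nat \<times> nat) set" where
  "all_edges p = {(i, j). i < j \<and> j < p}"

lemma finite_all_edges [simp]: "finite (all_edges p)"
  by (rule finite_subset[of _ "{..<p} \<times> {..<p}"]) (auto simp: all_edges_def)

text \<open>Coefficients of a formula as a multilinear polynomial in the edge indicators, valid on
  tuples with distinct entries, where an equation between different variables is false. Indicators
  are idempotent, so a product of monomials is the monomial of the union of their edge sets; this
  gives the clause for \<open>Conj\<close>.\<close>

primrec qf_coeff :: "nat \<Rightarrow> qf_formula \<Rightarrow> (nat \<times> nat) set \<Rightarrow> real" where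
  "qf_coeff p (Eq i j) D = of_bool (i = j \<and> D = {})"
| "qf_coeff p (Adj i j) D = of_bool (i \<noteq> j \<and> D = {(min i j, max i j)})"
| "qf_coeff p (Neg \<phi>) D = of_bool (D = {}) - qf_coeff p \<phi> D"
| "qf_coeff p (Conj \<phi> \<psi>) D = (\<Sum>(D1, D2)\<in>{z \<in> Pow (all_edges p) \<times> Pow (all_edges p). fst z \<union> snd z = D}.
     qf_coeff p \<phi> D1 * qf_coeff p \<psi> D2)"

lemma qf_sat_eq_sum:
  assumes "qf_vars \<phi> \<subseteq> {..<p}" "inj_on x {..<p}"
    "\<And>i j. i < p \<Longrightarrow> j < p \<Longrightarrow> E (x i) (x j) \<Longrightarrow> E (x j) (x i)" "\<And>i. i < p \<Longrightarrow> \<not> E (x i) (x i)"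
  shows "(of_bool (qf_sat E x \<phi>) :: real) =
    (\<Sum>D\<in>Pow (all_edges p). qf_coeff p \<phi> D * of_bool (\<forall>(i, j)\<in>D. E (x i) (x j)))"
  using assms(1)
proof (induction \<phi>)
  case (Eq i j)
  have "(\<Sum>D\<in>Pow (all_edges p). qf_coeff p (Eq i j) D * of_bool (\<forall>(i, j)\<in>D. E (x i) (x j)))
    = (\<Sum>D\<in>Pow (all_edges p). if D = {} then of_bool (i = j) else 0)"
    by (intro sum.cong) auto
  moreover have "x i = x j \<longleftrightarrow> i = j" using assms(2) Eq by (auto dest: inj_onD)
  ultimately show ?case by (simp add: sum.delta)
next
  case (Adj i j)
  have "(\<Sum>D\<in>Pow (all_edges p). qf_coeff p (Adj i j) D * of_bool (\<forall>(i, j)\<in>D. E (x i) (x j)))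
    = (\<Sum>D\<in>Pow (all_edges p). if D = {(min i j, max i j)} then of_bool (i \<noteq> j \<and> E (x (min i j)) (x (max i j))) else 0)"
    by (intro sum.cong) auto
  also have "\<dots> = (if {(min i j, max i j)} \<in> Pow (all_edges p) then of_bool (i \<noteq> j \<and> E (x (min i j)) (x (max i j))) else 0)"
    by (subst sum.delta) auto
  also have "\<dots> = of_bool (E (x i) (x j))"
    using Adj assms(3)[of i j] assms(3)[of j i] assms(4)[of i] by (auto simp: all_edges_def min_def max_def)
  finally show ?case by simp
next
  case (Neg \<phi>)
  have "(\<Sum>D\<in>Pow (all_edges p). qf_coeff p (Neg \<phi>) D * of_bool (\<forall>(i, j)\<in>D. E (x i) (x j)))
    = (\<Sum>D\<in>Pow (all_edges p). if D = {} then 1 else 0) - of_bool (qf_sat E x \<phi>)"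
  proof -
    have "of_bool (qf_sat E x \<phi>) = (\<Sum>D\<in>Pow (all_edges p). qf_coeff p \<phi> D * of_bool (\<forall>(i, j)\<in>D. E (x i) (x j)))"
      using Neg by simp
    then show ?thesis
      unfolding sum_subtractf[symmetric]
      by (simp only:) (simp only: sum_subtractf[symmetric], intro sum.cong, auto simp del: of_bool_eq_1_iff simp: algebra_simps)
  qed
  then show ?case by (simp add: sum.delta)
next
  case (Conj \<phi> \<psi>)
  let ?A = "Pow (all_edges p)" let ?m = "\<lambda>D. of_bool (\<forall>(i, j)\<in>D. E (x i) (x j)) :: real"
  have mm: "?m D1 * ?m D2 = ?m (D1 \<union> D2)" for D1 D2 by (auto simp: ball_Un)
  have "(of_bool (qf_sat E x (Conj \<phi> \<psi>)) :: real) = of_bool (qf_sat E x \<phi>) * of_bool (qf_sat E x \<psi>)" by simp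
  also have "\<dots> = (\<Sum>D1\<in>?A. qf_coeff p \<phi> D1 * ?m D1) * (\<Sum>D2\<in>?A. qf_coeff p \<psi> D2 * ?m D2)"
    using Conj by simp
  also have "\<dots> = (\<Sum>z\<in>?A \<times> ?A. qf_coeff p \<phi> (fst z) * qf_coeff p \<psi> (snd z) * ?m (fst z \<union> snd z))"
    unfolding sum_product sum.cartesian_product mm[symmetric]
    by (intro sum.cong) (auto simp: case_prod_unfold mult_ac)
  also have "\<dots> = (\<Sum>D\<in>?A. \<Sum>z\<in>{z \<in> ?A \<times> ?A. fst z \<union> snd z = D}.
      qf_coeff p \<phi> (fst z) * qf_coeff p \<psi> (snd z) * ?m (fst z \<union> snd z))"
    by (rule sum.group[symmetric]) auto
  also have "\<dots> = (\<Sum>D\<in>?A. qf_coeff p (Conj \<phi> \<psi>) D * ?m D)"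
    by (intro sum.cong refl) (auto simp: sum_distrib_right case_prod_unfold intro!: sum.cong)
  finally show ?case .
qed

text \<open>The formula and its polynomial agree on injective tuples; elsewhere they differ by at
  most one plus the sum of the absolute coefficients. Stated as an inequality, it is exact for an
  atomless measure and has an error of order \<open>1/n\<close> for a finite graph.\<close>

lemma qf_pairing_approx:
  assumes "prob_space \<nu>" and dm: "{z \<in> space (\<nu> \<Otimes>\<^sub>M \<nu>). fst z = snd z} \<in> sets (\<nu> \<Otimes>\<^sub>M \<nu>)"
    and Em: "(\<lambda>(x, y). E x y) \<in> \<nu> \<Otimes>\<^sub>M \<nu> \<rightarrow>\<^sub>M count_space UNIV"
    and sym: "\<And>x y. x \<in> space \<nu> \<Longrightarrow> y \<in> space \<nu> \<Longrightarrow> E x y \<Longrightarrow> E y x" and irr: "\<And>x. x \<in> space \<nu> \<Longrightarrow> \<not> E x x"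
    and vars: "qf_vars \<phi> \<subseteq> {..<p}"
  shows "\<bar>qf_pairing p \<phi> \<nu> E - (\<Sum>D\<in>Pow (all_edges p). qf_coeff p \<phi> D * edge_dens {..<p} D \<nu> E)\<bar>
    \<le> (1 + (\<Sum>D\<in>Pow (all_edges p). \<bar>qf_coeff p \<phi> D\<bar>)) *
       measure (\<Pi>\<^sub>M i\<in>{..<p}. \<nu>) {x \<in> space (\<Pi>\<^sub>M i\<in>{..<p}. \<nu>). \<not> inj_on x {..<p}}"
proof -
  let ?P = "\<Pi>\<^sub>M i\<in>{..<p}. \<nu>" let ?A = "Pow (all_edges p)"
  interpret prob_space ?P using assms(1) by (intro prob_space_PiM)
  let ?N = "{x \<in> space ?P. \<not> inj_on x {..<p}}"
  let ?S = "{x \<in> space ?P. qf_sat E x \<phi>}"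
  let ?M = "\<lambda>D. {x \<in> space ?P. \<forall>(i, j)\<in>D. E (x i) (x j)}"
  have N: "?N \<in> sets ?P" using non_inj_sets[OF dm] by blast
  have M: "?M D \<in> sets ?P" if "D \<in> ?A" for D
  proof -
    have "finite D" "D \<subseteq> {..<p} \<times> {..<p}"
      using that finite_subset[OF _ finite_all_edges] by (auto simp: all_edges_def)
    from pred_edges[OF Em this] show ?thesis by (simp add: pred_def)
  qed
  have eqm: "(\<lambda>(x, y). x = y) \<in> \<nu> \<Otimes>\<^sub>M \<nu> \<rightarrow>\<^sub>M count_space UNIV"
    using dm by (simp add: pred_def case_prod_unfold)
  have "Measurable.pred ?P (\<lambda>x. qf_sat E x \<phi>)" using vars
  proof (induction \<phi>)
    case (Eq i j) then show ?case using pred_edges[OF eqm, of "{(i, j)}" "{..<p}"] by simp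
  next
    case (Adj i j) then show ?case using pred_edges[OF Em, of "{(i, j)}" "{..<p}"] by simp
  next
    case (Conj \<phi> \<psi>) then show ?case by (auto intro: pred_intros_logic)
  qed (auto intro: pred_intros_logic)
  then have S: "?S \<in> sets ?P" by (simp add: pred_def)
  let ?g = "\<lambda>x. indicator ?S x - (\<Sum>D\<in>?A. qf_coeff p \<phi> D * indicator (?M D) x) :: real"
  let ?K = "1 + (\<Sum>D\<in>?A. \<bar>qf_coeff p \<phi> D\<bar>)"
  have intM: "integrable ?P (\<lambda>x. qf_coeff p \<phi> D * indicator (?M D) x)" if "D \<in> ?A" for D
    using M[OF that] by (intro integrable_mult_right integrable_real_indicator) (auto simp: emeasure_eq_measure)
  have intS: "integrable ?P (indicator ?S :: _ \<Rightarrow> real)"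
    using S by (intro integrable_real_indicator) (auto simp: emeasure_eq_measure)
  have intsum: "integrable ?P (\<lambda>x. \<Sum>D\<in>?A. qf_coeff p \<phi> D * indicator (?M D) x)"
    using intM by (intro Bochner_Integration.integrable_sum)
  have "(\<integral>x. ?g x \<partial>?P) = measure ?P ?S - (\<integral>x. (\<Sum>D\<in>?A. qf_coeff p \<phi> D * indicator (?M D) x) \<partial>?P)"
    using S by (subst Bochner_Integration.integral_diff[OF intS intsum]) simp
  also have "(\<integral>x. (\<Sum>D\<in>?A. qf_coeff p \<phi> D * indicator (?M D) x) \<partial>?P) = (\<Sum>D\<in>?A. qf_coeff p \<phi> D * measure ?P (?M D))"
    using intM M by (subst Bochner_Integration.integral_sum) (auto intro!: sum.cong)
  finally have eq: "(\<integral>x. ?g x \<partial>?P) = qf_pairing p \<phi> \<nu> E - (\<Sum>D\<in>?A. qf_coeff p \<phi> D * edge_dens {..<p} D \<nu> E)"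
    by (simp add: qf_pairing_def edge_dens_def)
  have bound: "\<bar>?g x\<bar> \<le> ?K * indicator ?N x" if x: "x \<in> space ?P" for x
  proof (cases "inj_on x {..<p}")
    case True
    have xs: "i < p \<Longrightarrow> x i \<in> space \<nu>" for i using x by (auto simp: space_PiM)
    have "(of_bool (qf_sat E x \<phi>) :: real) =
      (\<Sum>D\<in>?A. qf_coeff p \<phi> D * of_bool (\<forall>(i, j)\<in>D. E (x i) (x j)))"
      using vars True sym irr xs by (intro qf_sat_eq_sum) auto
    moreover have "indicator (?M D) x = (of_bool (\<forall>(i, j)\<in>D. E (x i) (x j)) :: real)" for D
      using x by (simp add: indicator_def)
    moreover have "indicator ?S x = (of_bool (qf_sat E x \<phi>) :: real)" using x by (simp add: indicator_def)
    ultimately have "?g x = 0" by simp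
    then show ?thesis by (simp add: True)
  next
    case False
    have "\<bar>\<Sum>D\<in>?A. qf_coeff p \<phi> D * indicator (?M D) x\<bar> \<le> (\<Sum>D\<in>?A. \<bar>qf_coeff p \<phi> D\<bar>)"
      by (rule order_trans[OF sum_abs], rule sum_mono) (simp add: indicator_def abs_mult)
    moreover have "\<bar>indicator ?S x :: real\<bar> \<le> 1" by (simp add: indicator_def)
    ultimately have "\<bar>?g x\<bar> \<le> ?K" by linarith
    then show ?thesis using False x by simp
  qed
  have "\<bar>\<integral>x. ?g x \<partial>?P\<bar> \<le> (\<integral>x. ?K * indicator ?N x \<partial>?P)"
    using bound N intS intsum
    by (intro order_trans[OF integral_abs_bound] integral_mono)
       (auto simp: emeasure_eq_measure intro!: integrable_abs Bochner_Integration.integrable_diff integrable_mult_right integrable_real_indicator)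
  also have "\<dots> = ?K * measure ?P ?N" using N by simp
  finally show ?thesis unfolding eq .
qed

text \<open>Convergence of edge densities passes to all formulas once repeated entries become
  negligible along the sequence; this is the purpose of the assumption that the vertex sets
  grow.\<close>

lemma qf_limitI:
  assumes \<nu>: "prob_space \<nu>" "atomless \<nu>" and dm: "{z \<in> space (\<nu> \<Otimes>\<^sub>M \<nu>). fst z = snd z} \<in> sets (\<nu> \<Otimes>\<^sub>M \<nu>)"
    and Em: "(\<lambda>(x, y). E x y) \<in> \<nu> \<Otimes>\<^sub>M \<nu> \<rightarrow>\<^sub>M count_space UNIV"
    and sym: "\<And>x y. x \<in> space \<nu> \<Longrightarrow> y \<in> space \<nu> \<Longrightarrow> E x y \<Longrightarrow> E y x" and irr: "\<And>x. x \<in> space \<nu> \<Longrightarrow> \<not> E x x"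
    and G: "\<And>n. finite_graph (G n)" "\<And>n. verts (G n) \<noteq> {}"
    and card: "filterlim (\<lambda>n. card (verts (G n))) at_top sequentially"
    and lim: "\<And>p D. D \<subseteq> all_edges p \<Longrightarrow>
      (\<lambda>n. edge_dens {..<p} D (uniform_count_measure (verts (G n))) (adj (G n))) \<longlonglongrightarrow> edge_dens {..<p} D \<nu> E"
  shows "qf_limit G \<nu> E"
  unfolding qf_limit_def
proof (intro allI impI)
  fix p \<phi> assume vars: "qf_vars \<phi> \<subseteq> {..<p}"
  let ?A = "Pow (all_edges p)"
  let ?U = "\<lambda>n. uniform_count_measure (verts (G n))"
  let ?K = "1 + (\<Sum>D\<in>?A. \<bar>qf_coeff p \<phi> D\<bar>)"
  let ?s = "\<lambda>\<nu> E. \<Sum>D\<in>?A. qf_coeff p \<phi> D * edge_dens {..<p} D \<nu> E"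
  have K: "0 \<le> ?K" by (simp add: add_nonneg_nonneg sum_nonneg)
  have fin: "finite (verts (G n))" for n using G(1) by (simp add: finite_graph_def)
  \<comment> \<open>The trailing \<open>0\<close> is the bound on point masses supplied by
    atomlessness.\<close>
  have "\<bar>qf_pairing p \<phi> \<nu> E - ?s \<nu> E\<bar> \<le> ?K * (real (card {..<p}) ^ 2 * 0)"
  proof (rule order_trans[OF qf_pairing_approx[OF \<nu>(1) dm Em sym irr vars]])
    show "?K * measure (\<Pi>\<^sub>M i\<in>{..<p}. \<nu>) {x \<in> space (\<Pi>\<^sub>M i\<in>{..<p}. \<nu>). \<not> inj_on x {..<p}}
      \<le> ?K * (real (card {..<p}) ^ 2 * 0)"
      using \<nu> dm by (intro mult_left_mono measure_non_inj_le K) (auto simp: atomless_def)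
  qed
  then have 1: "qf_pairing p \<phi> \<nu> E = ?s \<nu> E" by simp
  have 2: "\<bar>qf_pairing p \<phi> (?U n) (adj (G n)) - ?s (?U n) (adj (G n))\<bar>
      \<le> ?K * (real p ^ 2 * (1 / real (card (verts (G n)))))" for n
  proof -
    have pU: "prob_space (?U n)" using fin G(2) by (rule prob_space_uniform)
    have "measure (\<Pi>\<^sub>M i\<in>{..<p}. ?U n) {x \<in> space (\<Pi>\<^sub>M i\<in>{..<p}. ?U n). \<not> inj_on x {..<p}}
       \<le> real (card {..<p}) ^ 2 * (1 / real (card (verts (G n))))"
      using fin by (intro measure_non_inj_le pU Collect_in_sets_pair_uniform)
        (auto simp: emeasure_uniform_count_measure space_uniform_count_measure)
    then have *: "?K * measure (\<Pi>\<^sub>M i\<in>{..<p}. ?U n) {x \<in> space (\<Pi>\<^sub>M i\<in>{..<p}. ?U n). \<not> inj_on x {..<p}}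
       \<le> ?K * (real p ^ 2 * (1 / real (card (verts (G n)))))"
      using K by (intro mult_left_mono) auto
    have sg: "adj (G n) y x" if "x \<in> verts (G n)" "y \<in> verts (G n)" "adj (G n) x y" for x y
      using G(1)[of n] that by (auto simp: finite_graph_def)
    have ig: "\<not> adj (G n) x x" if "x \<in> verts (G n)" for x
      using G(1)[of n] that by (auto simp: finite_graph_def)
    show ?thesis
      by (rule order_trans[OF qf_pairing_approx[OF pU Collect_in_sets_pair_uniform[OF fin] measurable_pair_uniform[OF fin] _ _ vars] *])
         (auto simp only: space_uniform_count_measure intro: sg dest: ig)
  qed
  have "(\<lambda>n. ?K * (real p ^ 2 * (1 / real (card (verts (G n)))))) \<longlonglongrightarrow> ?K * (real p ^ 2 * 0)"
  proof (intro tendsto_mult tendsto_const)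
    have "filterlim (\<lambda>n. real (card (verts (G n)))) at_top sequentially"
      using card by (rule filterlim_compose[OF filterlim_real_sequentially])
    then show "(\<lambda>n. 1 / real (card (verts (G n)))) \<longlonglongrightarrow> 0"
      by (rule real_tendsto_divide_at_top[OF tendsto_const])
  qed
  then have "(\<lambda>n. qf_pairing p \<phi> (?U n) (adj (G n)) - ?s (?U n) (adj (G n))) \<longlonglongrightarrow> 0"
    using Lim_null_comparison[of "\<lambda>n. qf_pairing p \<phi> (?U n) (adj (G n)) - ?s (?U n) (adj (G n))"
        "\<lambda>n. ?K * (real p ^ 2 * (1 / real (card (verts (G n)))))" sequentially] 2
    by (simp only: real_norm_def eventually_sequentially mult_zero_right) blast
  moreover have "(\<lambda>n. ?s (?U n) (adj (G n))) \<longlonglongrightarrow> ?s \<nu> E"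
    using lim by (intro tendsto_sum tendsto_mult tendsto_const) auto
  ultimately have "(\<lambda>n. (qf_pairing p \<phi> (?U n) (adj (G n)) - ?s (?U n) (adj (G n))) + ?s (?U n) (adj (G n))) \<longlonglongrightarrow> 0 + ?s \<nu> E"
    by (rule tendsto_add)
  then show "(\<lambda>n. qf_pairing p \<phi> (?U n) (adj (G n))) \<longlonglongrightarrow> qf_pairing p \<phi> \<nu> E" using 1 by simp
qed

subsection \<open>Finite samples of a Borel graph\<close>

lemma edge_dens_cong:
  assumes "sets M = sets N" "\<And>x y. x \<in> space M \<Longrightarrow> y \<in> space M \<Longrightarrow> E x y = E' x y" "D \<subseteq> I \<times> I"
  shows "edge_dens I D M E = edge_dens I D M E'"
proof -
  have "{x \<in> space (\<Pi>\<^sub>M i\<in>I. M). \<forall>(i, j)\<in>D. E (x i) (x j)} = {x \<in> space (\<Pi>\<^sub>M i\<in>I. M). \<forall>(i, j)\<in>D. E' (x i) (x j)}"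
    using assms(2,3) by (fastforce simp: space_PiM PiE_iff)
  then show ?thesis by (simp add: edge_dens_def)
qed

lemma edge_dens_reindex:
  assumes "prob_space M" and E: "(\<lambda>(x, y). E x y) \<in> M \<Otimes>\<^sub>M M \<rightarrow>\<^sub>M count_space UNIV"
    and f: "inj_on f I" "f \<in> I \<rightarrow> K" and D: "finite D" "D \<subseteq> I \<times> I"
  shows "edge_dens K (map_prod f f ` D) M E = edge_dens I D M E"
proof -
  let ?t = "\<lambda>\<omega>. \<lambda>n\<in>I. \<omega> (f n)"
  have t: "?t \<in> (\<Pi>\<^sub>M i\<in>K. M) \<rightarrow>\<^sub>M (\<Pi>\<^sub>M i\<in>I. M)"
    using f by (intro measurable_restrict measurable_component_singleton) auto
  have S: "{x \<in> space (\<Pi>\<^sub>M i\<in>I. M). \<forall>(i, j)\<in>D. E (x i) (x j)} \<in> sets (\<Pi>\<^sub>M i\<in>I. M)"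
    using pred_edges[OF E D] by (simp add: pred_def)
  have "edge_dens I D M E = measure (distr (\<Pi>\<^sub>M i\<in>K. M) (\<Pi>\<^sub>M i\<in>I. M) ?t) {x \<in> space (\<Pi>\<^sub>M i\<in>I. M). \<forall>(i, j)\<in>D. E (x i) (x j)}"
    unfolding edge_dens_def using distr_PiM_reindex[of K "\<lambda>_. M" f I] assms by simp
  also have "\<dots> = measure (\<Pi>\<^sub>M i\<in>K. M) (?t -` {x \<in> space (\<Pi>\<^sub>M i\<in>I. M). \<forall>(i, j)\<in>D. E (x i) (x j)} \<inter> space (\<Pi>\<^sub>M i\<in>K. M))"
    by (rule measure_distr[OF t S])
  also have "?t -` {x \<in> space (\<Pi>\<^sub>M i\<in>I. M). \<forall>(i, j)\<in>D. E (x i) (x j)} \<inter> space (\<Pi>\<^sub>M i\<in>K. M)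
     = {x \<in> space (\<Pi>\<^sub>M i\<in>K. M). \<forall>(i, j)\<in>map_prod f f ` D. E (x i) (x j)}"
    using measurable_space[OF t] D(2) by fastforce
  finally show ?thesis by (simp add: edge_dens_def)
qed

lemma edge_dens_disjoint_union:
  assumes M: "prob_space M" and E: "(\<lambda>(x, y). E x y) \<in> M \<Otimes>\<^sub>M M \<rightarrow>\<^sub>M count_space UNIV"
    and I: "finite I" "finite J" "I \<inter> J = {}" and D: "D \<subseteq> I \<times> I" "C \<subseteq> J \<times> J"
  shows "edge_dens (I \<union> J) (D \<union> C) M E = edge_dens I D M E * edge_dens J C M E"
proof -
  interpret M: prob_space M by fact
  interpret product_prob_space "\<lambda>_. M" by unfold_locales
  let ?I = "\<Pi>\<^sub>M i\<in>I. M" and ?J = "\<Pi>\<^sub>M i\<in>J. M" and ?K = "\<Pi>\<^sub>M i\<in>I \<union> J. M"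
  interpret J: prob_space ?J using M by (intro prob_space_PiM)
  have fin: "finite D" "finite C" using I D by (auto intro: finite_subset)
  let ?S = "\<lambda>K D. {x \<in> space (\<Pi>\<^sub>M i\<in>K. M). \<forall>(i, j)\<in>D. E (x i) (x j)}"
  have S: "?S I D \<in> sets ?I" "?S J C \<in> sets ?J" "?S (I \<union> J) (D \<union> C) \<in> sets ?K"
    using pred_edges[OF E fin(1) D(1)] pred_edges[OF E fin(2) D(2)]
      pred_edges[OF E, of "D \<union> C" "I \<union> J"] fin D by (auto simp: pred_def)
  have m: "merge I J \<in> ?I \<Otimes>\<^sub>M ?J \<rightarrow>\<^sub>M ?K" by measurable
  have "edge_dens (I \<union> J) (D \<union> C) M E = measure (distr (?I \<Otimes>\<^sub>M ?J) ?K (merge I J)) (?S (I \<union> J) (D \<union> C))"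
    unfolding edge_dens_def using I by (simp add: distr_merge)
  also have "\<dots> = measure (?I \<Otimes>\<^sub>M ?J) (merge I J -` ?S (I \<union> J) (D \<union> C) \<inter> space (?I \<Otimes>\<^sub>M ?J))"
    by (rule measure_distr[OF m S(3)])
  also have "merge I J -` ?S (I \<union> J) (D \<union> C) \<inter> space (?I \<Otimes>\<^sub>M ?J) = ?S I D \<times> ?S J C"
  proof (rule set_eqI)
    fix z :: "('b \<Rightarrow> 'a) \<times> ('b \<Rightarrow> 'a)"
    obtain x y where z: "z = (x, y)" by force
    have 1: "merge I J (x, y) i = x i" if "i \<in> I" for i using that by (simp add: merge_def)
    have 2: "merge I J (x, y) i = y i" if "i \<in> J" for i using that I(3) by (auto simp: merge_def)
    have "(\<forall>(i, j)\<in>D. E (merge I J (x, y) i) (merge I J (x, y) j)) \<longleftrightarrow> (\<forall>(i, j)\<in>D. E (x i) (x j))"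
      using D(1) by (intro ball_cong refl) (auto simp: 1)
    moreover have "(\<forall>(i, j)\<in>C. E (merge I J (x, y) i) (merge I J (x, y) j)) \<longleftrightarrow> (\<forall>(i, j)\<in>C. E (y i) (y j))"
      using D(2) by (intro ball_cong refl) (auto simp: 2)
    moreover have "(x, y) \<in> space (?I \<Otimes>\<^sub>M ?J) \<Longrightarrow> merge I J (x, y) \<in> space ?K"
      using measurable_space[OF m] by blast
    ultimately show "z \<in> merge I J -` ?S (I \<union> J) (D \<union> C) \<inter> space (?I \<Otimes>\<^sub>M ?J) \<longleftrightarrow> z \<in> ?S I D \<times> ?S J C"
      unfolding z by (simp add: space_pair_measure ball_Un) blast
  qed
  also have "measure (?I \<Otimes>\<^sub>M ?J) (?S I D \<times> ?S J C) = measure ?I (?S I D) * measure ?J (?S J C)"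
    using S by (simp add: J.emeasure_pair_measure_Times measure_def enn2real_mult)
  finally show ?thesis by (simp add: edge_dens_def)
qed

text \<open>Two disjoint copies of the pattern, tagged by a Boolean. Their density is the square of
  the original one, which turns second moments of densities into first moments.\<close>

definition double_edges :: "('k \<times> 'k) set \<Rightarrow> (('k \<times> bool) \<times> ('k \<times> bool)) set" where
  "double_edges D = (\<lambda>(i, j). ((i, True), (j, True))) ` D \<union> (\<lambda>(i, j). ((i, False), (j, False))) ` D"

lemma double_edges_subset: "D \<subseteq> I \<times> I \<Longrightarrow> double_edges D \<subseteq> (I \<times> UNIV) \<times> (I \<times> UNIV)"
  by (auto simp: double_edges_def)

lemma edge_dens_double:
  assumes M: "prob_space M" and E: "(\<lambda>(x, y). E x y) \<in> M \<Otimes>\<^sub>M M \<rightarrow>\<^sub>M count_space UNIV"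
    and I: "finite I" and D: "D \<subseteq> I \<times> I"
  shows "edge_dens (I \<times> UNIV) (double_edges D) M E = (edge_dens I D M E)\<^sup>2"
proof -
  have fin: "finite D" using I D by (auto intro: finite_subset)
  let ?D = "\<lambda>b. map_prod (\<lambda>i. (i, b)) (\<lambda>i. (i, b)) ` D"
  have b: "edge_dens (I \<times> {b}) (?D b) M E = edge_dens I D M E" for b :: bool
    using fin D by (intro edge_dens_reindex M E) (auto simp: inj_on_def)
  have "double_edges D = ?D True \<union> ?D False" by (simp add: double_edges_def map_prod_def)
  moreover have "I \<times> (UNIV :: bool set) = I \<times> {True} \<union> I \<times> {False}" by (auto simp: UNIV_bool)
  ultimately have "edge_dens (I \<times> UNIV) (double_edges D) M E
    = edge_dens (I \<times> {True}) (?D True) M E * edge_dens (I \<times> {False}) (?D False) M E"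
    using D I by (simp only:) (intro edge_dens_disjoint_union M E, auto)
  then show ?thesis by (simp add: b power2_eq_square)
qed

lemma edge_dens_bounds:
  assumes "prob_space M" shows "0 \<le> edge_dens I D M E" "edge_dens I D M E \<le> 1"
proof -
  interpret prob_space "\<Pi>\<^sub>M i\<in>I. M" using assms by (intro prob_space_PiM)
  show "0 \<le> edge_dens I D M E" "edge_dens I D M E \<le> 1" by (simp_all add: edge_dens_def)
qed

lemma (in prob_space) exists_less_of_integral_less:
  fixes f :: "'a \<Rightarrow> real"
  assumes "integrable M f" "(\<integral>x. f x \<partial>M) < c" "AE x in M. P x"
  shows "\<exists>x\<in>space M. f x < c \<and> P x"
proof (rule ccontr)
  assume "\<not> ?thesis"
  then have "AE x in M. P x \<longrightarrow> c \<le> f x" by (intro AE_I2) (meson not_less)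
  then have "AE x in M. c \<le> f x" using assms(3) by (rule AE_mp[rotated])
  then have "(\<integral>x. c \<partial>M) \<le> (\<integral>x. f x \<partial>M)" using assms(1) by (intro integral_mono_AE) auto
  then show False using assms(2) by (simp add: prob_space)
qed

context
  fixes \<nu> :: "'a measure" and E :: "'a \<Rightarrow> 'a \<Rightarrow> bool"
  assumes \<nu>: "prob_space \<nu>" and E: "(\<lambda>(x, y). E x y) \<in> \<nu> \<Otimes>\<^sub>M \<nu> \<rightarrow>\<^sub>M count_space UNIV"
begin

text \<open>A random variable in the sample \<open>\<omega>\<close>. Maps into the sample may repeat
  indices, so it is only nearly unbiased.\<close>

definition sample_dens :: "'k set \<Rightarrow> ('k \<times> 'k) set \<Rightarrow> nat \<Rightarrow> (nat \<Rightarrow> 'a) \<Rightarrow> real" where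
  "sample_dens I D N \<omega> = edge_dens I D (uniform_count_measure {..<N}) (\<lambda>i j. E (\<omega> i) (\<omega> j))"

lemma sample_dens_eq_sum:
  assumes "finite I" "N > 0"
  shows "sample_dens I D N \<omega> =
    (\<Sum>h\<in>I \<rightarrow>\<^sub>E {..<N}. of_bool (\<forall>(i, j)\<in>D. E (\<omega> (h i)) (\<omega> (h j)))) / real N ^ card I"
proof -
  have fin: "finite (I \<rightarrow>\<^sub>E {..<N})" using assms by (intro finite_PiE) auto
  have "(\<Sum>h\<in>I \<rightarrow>\<^sub>E {..<N}. of_bool (\<forall>(i, j)\<in>D. E (\<omega> (h i)) (\<omega> (h j)))) =
    real (card {h \<in> I \<rightarrow>\<^sub>E {..<N}. \<forall>(i, j)\<in>D. E (\<omega> (h i)) (\<omega> (h j))})"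
    using fin by (simp add: Int_def)
  then show ?thesis using assms unfolding sample_dens_def
    by (subst edge_dens_uniform) (auto simp: lessThan_empty_iff)
qed

lemma pred_sample:
  assumes "finite D" "D \<subseteq> I \<times> I" "h \<in> I \<rightarrow>\<^sub>E {..<N}"
  shows "{\<omega> \<in> space (\<Pi>\<^sub>M i\<in>{..<N}. \<nu>). \<forall>(i, j)\<in>D. E (\<omega> (h i)) (\<omega> (h j))} \<in> sets (\<Pi>\<^sub>M i\<in>{..<N}. \<nu>)"
proof -
  have "map_prod h h ` D \<subseteq> {..<N} \<times> {..<N}" "finite (map_prod h h ` D)" using assms by auto
  from pred_edges[OF E this(2,1)]
  have "Measurable.pred (\<Pi>\<^sub>M i\<in>{..<N}. \<nu>) (\<lambda>\<omega>. \<forall>(i, j)\<in>map_prod h h ` D. E (\<omega> i) (\<omega> j))" .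
  then show ?thesis by (simp add: pred_def case_prod_unfold)
qed

lemma integrable_sample_dens:
  assumes "finite I" "D \<subseteq> I \<times> I" "N > 0"
  shows "integrable (\<Pi>\<^sub>M i\<in>{..<N}. \<nu>) (sample_dens I D N)"
proof -
  interpret P: prob_space "\<Pi>\<^sub>M i\<in>{..<N}. \<nu>" using \<nu> by (intro prob_space_PiM)
  have fin: "finite D" using assms by (auto intro: finite_subset)
  have "(\<lambda>\<omega>. of_bool (\<forall>(i, j)\<in>D. E (\<omega> (h i)) (\<omega> (h j))) :: real) \<in> borel_measurable (\<Pi>\<^sub>M i\<in>{..<N}. \<nu>)"
    if "h \<in> I \<rightarrow>\<^sub>E {..<N}" for h
    using pred_sample[OF fin assms(2) that] unfolding pred_def[symmetric] by measurable
  then have "sample_dens I D N \<in> borel_measurable (\<Pi>\<^sub>M i\<in>{..<N}. \<nu>)"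
    by (subst measurable_cong[OF sample_dens_eq_sum[OF assms(1,3)]]) (intro borel_measurable_divide borel_measurable_sum, auto)
  moreover have "norm (sample_dens I D N \<omega>) \<le> 1" for \<omega>
    using edge_dens_bounds[OF prob_space_uniform, of "{..<N}" I D "\<lambda>i j. E (\<omega> i) (\<omega> j)"] assms(3)
    by (simp add: sample_dens_def lessThan_empty_iff)
  ultimately show ?thesis by (intro P.integrable_const_bound[of _ 1]) auto
qed

text \<open>An injective index map picks independent points and contributes exactly
  \<open>edge_dens I D \<nu> E\<close>. The other maps make up at most a fraction
  \<open>(card I)^2 / N\<close>, each with an error of at most one.\<close>

lemma expected_sample_dens:
  assumes "finite I" "D \<subseteq> I \<times> I" "N > 0"
  shows "\<bar>(\<integral>\<omega>. sample_dens I D N \<omega> \<partial>(\<Pi>\<^sub>M i\<in>{..<N}. \<nu>)) - edge_dens I D \<nu> E\<bar> \<le> real (card I) ^ 2 / real N"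
proof -
  let ?P = "\<Pi>\<^sub>M i\<in>{..<N}. \<nu>" let ?H = "I \<rightarrow>\<^sub>E {..<N}" let ?t = "edge_dens I D \<nu> E"
  interpret P: prob_space ?P using \<nu> by (intro prob_space_PiM)
  have fin: "finite D" "finite ?H" using assms by (auto intro: finite_subset finite_PiE)
  let ?S = "\<lambda>h. {\<omega> \<in> space ?P. \<forall>(i, j)\<in>D. E (\<omega> (h i)) (\<omega> (h j))}"
  have S: "?S h \<in> sets ?P" if "h \<in> ?H" for h using pred_sample[OF fin(1) assms(2) that] .
  have inj: "measure ?P (?S h) = ?t" if "h \<in> ?H" "inj_on h I" for h
  proof -
    have "edge_dens {..<N} (map_prod h h ` D) \<nu> E = ?t"
      using that fin assms by (intro edge_dens_reindex \<nu> E) auto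
    then show ?thesis by (simp add: edge_dens_def case_prod_unfold)
  qed
  have cH: "real (card ?H) = real N ^ card I" using assms by (simp add: card_PiE)
  have "(\<integral>\<omega>. sample_dens I D N \<omega> \<partial>?P) = (\<integral>\<omega>. (\<Sum>h\<in>?H. indicator (?S h) \<omega>) / real N ^ card I \<partial>?P)"
    using sample_dens_eq_sum[OF assms(1,3)]
    by (intro Bochner_Integration.integral_cong refl) (auto simp: indicator_def intro!: sum.cong arg_cong2[where f = "(/)"])
  also have "\<dots> = (\<Sum>h\<in>?H. measure ?P (?S h)) / real N ^ card I"
    using S by (subst Bochner_Integration.integral_divide_zero, subst Bochner_Integration.integral_sum)
      (auto intro!: integrable_real_indicator sum.cong simp: P.emeasure_eq_measure)
  finally have e: "(\<integral>\<omega>. sample_dens I D N \<omega> \<partial>?P) - ?t = (\<Sum>h\<in>?H. measure ?P (?S h) - ?t) / real N ^ card I"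
    using assms(3) by (simp add: sum_subtractf cH field_simps)
  have "\<bar>\<Sum>h\<in>?H. measure ?P (?S h) - ?t\<bar> \<le> (\<Sum>h\<in>?H. of_bool (\<not> inj_on h I))"
  proof (rule order_trans[OF sum_abs], rule sum_mono)
    fix h assume h: "h \<in> ?H"
    have "0 \<le> measure ?P (?S h)" "measure ?P (?S h) \<le> 1" by simp_all
    then have "\<bar>measure ?P (?S h) - ?t\<bar> \<le> 1" using edge_dens_bounds[OF \<nu>, of I D E] by linarith
    then show "\<bar>measure ?P (?S h) - ?t\<bar> \<le> of_bool (\<not> inj_on h I)"
      using inj[OF h] by (cases "inj_on h I") auto
  qed
  also have "\<dots> = real (card {h \<in> ?H. \<not> inj_on h I})" using fin by (simp add: Int_def)
  finally have "\<bar>(\<integral>\<omega>. sample_dens I D N \<omega> \<partial>?P) - ?t\<bar> \<le> real (card {h \<in> ?H. \<not> inj_on h I}) / real N ^ card I"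
    unfolding e abs_divide by (simp add: divide_right_mono)
  also have "\<dots> = measure (\<Pi>\<^sub>M i\<in>I. uniform_count_measure {..<N})
      {x \<in> space (\<Pi>\<^sub>M i\<in>I. uniform_count_measure {..<N}). \<not> inj_on x I}"
    using assms by (subst measure_PiM_uniform) (auto simp: space_PiM space_uniform_count_measure lessThan_empty_iff)
  also have "\<dots> \<le> real (card I) ^ 2 * (1 / real N)"
    using assms by (intro measure_non_inj_le prob_space_uniform Collect_in_sets_pair_uniform)
      (auto simp: emeasure_uniform_count_measure space_uniform_count_measure lessThan_empty_iff)
  finally show ?thesis by simp
qed

text \<open>Expanding the square leaves \<open>(E X\<^sup>2 - t\<^sup>2) - 2 t (E X - t)\<close>,
  where \<open>X\<^sup>2\<close> is the sample density of the doubled pattern, so the bound on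
  expectations applies twice. The constant is \<open>6 = 4 + 2\<close>, as doubling \<open>I\<close>
  multiplies \<open>(card I)^2\<close> by four.\<close>

lemma variance_sample_dens:
  assumes "finite I" "D \<subseteq> I \<times> I" "N > 0"
  shows "integrable (\<Pi>\<^sub>M i\<in>{..<N}. \<nu>) (\<lambda>\<omega>. (sample_dens I D N \<omega> - edge_dens I D \<nu> E)\<^sup>2)"
    and "(\<integral>\<omega>. (sample_dens I D N \<omega> - edge_dens I D \<nu> E)\<^sup>2 \<partial>(\<Pi>\<^sub>M i\<in>{..<N}. \<nu>)) \<le> 6 * real (card I) ^ 2 / real N"
proof -
  let ?P = "\<Pi>\<^sub>M i\<in>{..<N}. \<nu>" let ?t = "edge_dens I D \<nu> E"
  let ?I = "I \<times> (UNIV :: bool set)" let ?D = "double_edges D"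
  interpret P: prob_space ?P using \<nu> by (intro prob_space_PiM)
  have sq: "(sample_dens I D N \<omega>)\<^sup>2 = sample_dens ?I ?D N \<omega>" for \<omega>
    unfolding sample_dens_def using assms
    by (intro edge_dens_double[symmetric] prob_space_uniform measurable_pair_uniform) (auto simp: lessThan_empty_iff)
  have I2: "finite ?I" "?D \<subseteq> ?I \<times> ?I" using assms double_edges_subset by (auto simp del: UNIV_Times_UNIV)
  have eq: "(sample_dens I D N \<omega> - ?t)\<^sup>2 = sample_dens ?I ?D N \<omega> - 2 * ?t * sample_dens I D N \<omega> + ?t\<^sup>2" for \<omega>
    unfolding power2_diff sq by simp
  note int = integrable_sample_dens[OF assms] integrable_sample_dens[OF I2 assms(3)]
  show "integrable ?P (\<lambda>\<omega>. (sample_dens I D N \<omega> - ?t)\<^sup>2)"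
    unfolding eq using int by (intro Bochner_Integration.integrable_add Bochner_Integration.integrable_diff integrable_mult_right) auto
  let ?a = "\<integral>\<omega>. sample_dens I D N \<omega> \<partial>?P" and ?b = "\<integral>\<omega>. sample_dens ?I ?D N \<omega> \<partial>?P"
  have "(\<integral>\<omega>. (sample_dens I D N \<omega> - ?t)\<^sup>2 \<partial>?P) = ?b - 2 * ?t * ?a + ?t\<^sup>2"
    unfolding eq using int by (simp add: P.prob_space)
  also have "\<dots> = (?b - ?t\<^sup>2) - 2 * ?t * (?a - ?t)" by (simp add: power2_eq_square algebra_simps)
  also have "\<dots> \<le> \<bar>?b - ?t\<^sup>2\<bar> + 2 * \<bar>?a - ?t\<bar>"
  proof -
    have "\<bar>?t * (?a - ?t)\<bar> \<le> 1 * \<bar>?a - ?t\<bar>"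
      unfolding abs_mult using edge_dens_bounds[OF \<nu>, of I D E] by (intro mult_right_mono) auto
    then show ?thesis by linarith
  qed
  also have "\<dots> \<le> real (card ?I) ^ 2 / real N + 2 * (real (card I) ^ 2 / real N)"
    using expected_sample_dens[OF assms] expected_sample_dens[OF I2 assms(3)]
      edge_dens_double[OF \<nu> E assms(1,2)] by (intro add_mono mult_left_mono) auto
  also have "\<dots> = 6 * real (card I) ^ 2 / real N"
    by (simp add: card_cartesian_product power_mult_distrib add_divide_distrib[symmetric])
  finally show "(\<integral>\<omega>. (sample_dens I D N \<omega> - ?t)\<^sup>2 \<partial>?P) \<le> 6 * real (card I) ^ 2 / real N" .
qed

text \<open>At stage \<open>n\<close> only the finitely many patterns on at most \<open>n\<close>
  variables are controlled, by the sum of their squared errors. A small expectation of this sum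
  yields one sample good for all of them, and almost every sample is injective.\<close>

lemma exists_good_samples:
  assumes at: "atomless \<nu>" and dm: "{z \<in> space (\<nu> \<Otimes>\<^sub>M \<nu>). fst z = snd z} \<in> sets (\<nu> \<Otimes>\<^sub>M \<nu>)"
  shows "\<exists>N \<omega>. (\<forall>n. n < N n \<and> \<omega> n \<in> {..<N n} \<rightarrow>\<^sub>E space \<nu> \<and> inj_on (\<omega> n) {..<N n})
    \<and> (\<forall>p D. D \<subseteq> all_edges p \<longrightarrow> (\<lambda>n. sample_dens {..<p} D (N n) (\<omega> n)) \<longlonglongrightarrow> edge_dens {..<p} D \<nu> E)"
proof -
  have sub: "D \<subseteq> all_edges p \<Longrightarrow> D \<subseteq> {..<p} \<times> {..<p}" for D p by (auto simp: all_edges_def)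
  have "\<exists>N \<omega>. n < N \<and> \<omega> \<in> {..<N} \<rightarrow>\<^sub>E space \<nu> \<and> inj_on \<omega> {..<N} \<and>
     (\<forall>p D. p \<le> n \<and> D \<subseteq> all_edges p \<longrightarrow> (sample_dens {..<p} D N \<omega> - edge_dens {..<p} D \<nu> E)\<^sup>2 < 1 / Suc n)" for n
  proof -
    let ?Q = "SIGMA p:{..n}. Pow (all_edges p)"
    have finQ: "finite ?Q" by auto
    define C where "C = (\<Sum>z\<in>?Q. 6 * real (card {..<fst z}) ^ 2)"
    have C: "0 \<le> C" by (auto simp: C_def intro: sum_nonneg)
    obtain N0 :: nat where N0: "C * Suc n < real N0" using reals_Archimedean2 by blast
    \<comment> \<open>\<open>N0\<close> makes the summed variances smaller than
      \<open>1 / (n + 1)\<close>; the second argument forces the samples to grow.\<close>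
    define N where "N = max N0 (Suc n)"
    have N: "N > 0" "n < N" "C / real N < 1 / Suc n"
      using N0 by (auto simp: N_def field_simps max_def split: if_splits)
    let ?P = "\<Pi>\<^sub>M i\<in>{..<N}. \<nu>"
    interpret P: prob_space ?P using \<nu> by (intro prob_space_PiM)
    let ?d = "\<lambda>z \<omega>. (sample_dens {..<fst z} (snd z) N \<omega> - edge_dens {..<fst z} (snd z) \<nu> E)\<^sup>2"
    have v: "integrable ?P (?d z)" "(\<integral>\<omega>. ?d z \<omega> \<partial>?P) \<le> 6 * real (card {..<fst z}) ^ 2 / real N" if "z \<in> ?Q" for z
      using variance_sample_dens[of "{..<fst z}" "snd z" N] sub[of "snd z" "fst z"] N(1) that by auto
    have "(\<integral>\<omega>. (\<Sum>z\<in>?Q. ?d z \<omega>) \<partial>?P) = (\<Sum>z\<in>?Q. \<integral>\<omega>. ?d z \<omega> \<partial>?P)"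
      using v(1) by (rule Bochner_Integration.integral_sum)
    also have "\<dots> \<le> (\<Sum>z\<in>?Q. 6 * real (card {..<fst z}) ^ 2 / real N)" using v(2) by (rule sum_mono)
    also have "\<dots> = C / real N" by (simp add: C_def sum_divide_distrib)
    finally have lt: "(\<integral>\<omega>. (\<Sum>z\<in>?Q. ?d z \<omega>) \<partial>?P) < 1 / Suc n" using N by linarith
    have int: "integrable ?P (\<lambda>\<omega>. \<Sum>z\<in>?Q. ?d z \<omega>)" using v(1) by (rule Bochner_Integration.integrable_sum)
    obtain \<omega> where w: "\<omega> \<in> space ?P" "(\<Sum>z\<in>?Q. ?d z \<omega>) < 1 / Suc n" "inj_on \<omega> {..<N}"
      using P.exists_less_of_integral_less[OF int lt atomless_AE_inj[OF \<nu> at dm finite_lessThan]] by blast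
    have "?d (p, D) \<omega> < 1 / Suc n" if "p \<le> n" "D \<subseteq> all_edges p" for p D
    proof -
      have "?d (p, D) \<omega> \<le> (\<Sum>z\<in>?Q. ?d z \<omega>)" using that finQ by (intro member_le_sum) auto
      then show ?thesis using w(2) by linarith
    qed
    then show ?thesis using w N by (intro exI[of _ N] exI[of _ \<omega>]) (auto simp: space_PiM)
  qed
  then obtain N \<omega> where *: "\<And>n. n < N n \<and> \<omega> n \<in> {..<N n} \<rightarrow>\<^sub>E space \<nu> \<and> inj_on (\<omega> n) {..<N n} \<and>
     (\<forall>p D. p \<le> n \<and> D \<subseteq> all_edges p \<longrightarrow>
       (sample_dens {..<p} D (N n) (\<omega> n) - edge_dens {..<p} D \<nu> E)\<^sup>2 < 1 / Suc n)"
    by metis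
  have "(\<lambda>n. sample_dens {..<p} D (N n) (\<omega> n)) \<longlonglongrightarrow> edge_dens {..<p} D \<nu> E" if "D \<subseteq> all_edges p" for p D
  proof -
    have "(\<lambda>n. (sample_dens {..<p} D (N n) (\<omega> n) - edge_dens {..<p} D \<nu> E)\<^sup>2) \<longlonglongrightarrow> 0"
    proof (rule tendsto_sandwich[OF _ _ tendsto_const LIMSEQ_inverse_real_of_nat])
      show "\<forall>\<^sub>F n in sequentially. (sample_dens {..<p} D (N n) (\<omega> n) - edge_dens {..<p} D \<nu> E)\<^sup>2 \<le> inverse (real (Suc n))"
        by (rule eventually_mono[OF eventually_ge_at_top[of p]]) (use * that in \<open>auto simp: inverse_eq_divide intro!: less_imp_le\<close>)
    qed simp
    then have "(\<lambda>n. sample_dens {..<p} D (N n) (\<omega> n) - edge_dens {..<p} D \<nu> E) \<longlonglongrightarrow> 0"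
      using tendsto_real_sqrt[of _ 0 sequentially] by (fastforce intro: tendsto_rabs_zero_cancel)
    then show ?thesis by (rule LIM_zero_cancel)
  qed
  then show ?thesis
    by (intro exI[of _ N] exI[of _ \<omega>] conjI allI impI) (simp_all add: *)
qed

end

section \<open>Sampled interpretations are m-partite cographs\<close>

text \<open>New leaves are attached one by one above the root, so every meet involving one of them
  carries \<open>l\<close>. With the zero map as \<open>l\<close> they become isolated
  vertices.\<close>

lemma ltree_add_leaves:
  assumes "distinct_leaves t" "finite J" "J \<inter> leaves t = {}"
  shows "\<exists>t'. distinct_leaves t' \<and> leaves t' = leaves t \<union> J \<and> labs t' \<subseteq> insert l (labs t)
    \<and> (\<forall>x\<in>leaves t'. \<forall>y\<in>leaves t'. x \<noteq> y \<longrightarrow>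
        lca_lab t' x y = (if x \<in> leaves t \<and> y \<in> leaves t then lca_lab t x y else l))"
  using assms(2,3)
proof (induction J rule: finite_induct)
  case empty
  show ?case by (rule exI[of _ t]) (use assms(1) in auto)
next
  case (insert a J)
  then obtain t' where t': "distinct_leaves t'" "leaves t' = leaves t \<union> J" "labs t' \<subseteq> insert l (labs t)"
    "\<And>x y. x \<in> leaves t' \<Longrightarrow> y \<in> leaves t' \<Longrightarrow> x \<noteq> y \<Longrightarrow>
        lca_lab t' x y = (if x \<in> leaves t \<and> y \<in> leaves t then lca_lab t x y else l)" by auto
  show ?case
  proof (intro exI[of _ "Node l (Leaf a) t'"] conjI ballI impI)
    fix x y assume "x \<in> leaves (Node l (Leaf a) t')" "y \<in> leaves (Node l (Leaf a) t')" "x \<noteq> y"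
    then show "lca_lab (Node l (Leaf a) t') x y = (if x \<in> leaves t \<and> y \<in> leaves t then lca_lab t x y else l)"
      using insert.prems insert.hyps t'(4)[of x y] t'(2) by auto
  qed (use t'(1-3) insert in auto)
qed

text \<open>Three things separate the sampled structure from a cotree: a point may carry no colour,
  a node may carry several maps or none, and these maps may be asymmetric. Uncoloured points become
  isolated leaves, and the maps at a node are merged into one symmetric map.\<close>

lemma interp_sample_m_partite:
  assumes m: "m \<ge> 1" and T: "colored_borel_tree_semilattice m T" and N: "N > 0"
    and x: "x ` {..<N} \<subseteq> space (borel_space T)" "inj_on x {..<N}"
    and sym: "\<And>i j. i < N \<Longrightarrow> j < N \<Longrightarrow> interp_adj m T (x i) (x j) \<Longrightarrow> interp_adj m T (x j) (x i)"
  shows "m_partite_cograph m \<lparr>verts = {..<N}, adj = \<lambda>i j. interp_adj m T (x i) (x j)\<rparr>" (is "m_partite_cograph m ?G")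
proof -
  define labelled where "labelled i \<longleftrightarrow> (\<exists>k\<in>{1..m}. x i \<in> leaf_label T k)" for i
  \<comment> \<open>Disjointness of the labels makes the choice unique. The default \<open>1\<close>
    is a legal colour because \<open>m \<ge> 1\<close>; it has no effect, since uncoloured points
    meet everything at \<open>f0\<close>.\<close>
  define c where "c i = (if labelled i then (SOME k. k \<in> {1..m} \<and> x i \<in> leaf_label T k) else 1)" for i
  have c: "c i \<in> {1..m} \<and> x i \<in> leaf_label T (c i)" if "labelled i" for i
  proof -
    have "\<exists>k. k \<in> {1..m} \<and> x i \<in> leaf_label T k" using that by (auto simp: labelled_def)
    from someI_ex[OF this] show ?thesis using that by (simp only: c_def if_True)
  qed
  have c1: "c i \<in> {1..m}" for i using c m by (cases "labelled i") (auto simp: c_def)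
  have cu: "k = c i" if "k \<in> {1..m}" "x i \<in> leaf_label T k" for i k
  proof -
    have "labelled i" using that by (auto simp: labelled_def)
    then have "c i \<in> {1..m}" "x i \<in> leaf_label T (c i)" using c by auto
    moreover have "disjoint_family_on (leaf_label T) {1..m}" using T by (simp add: colored_borel_tree_semilattice_def)
    ultimately show ?thesis using that unfolding disjoint_family_on_def by blast
  qed
  let ?Z = "{1..m} \<times> {1..m}"
  \<comment> \<open>The union of all maps at \<open>v\<close>, symmetrised. Symmetrising adds no
    edges, since adjacency on the sample is assumed symmetric and the meet is commutative.\<close>
  define g where "g v = (\<lambda>z\<in>?Z. if \<exists>f\<in>binary_maps m. v \<in> node_label T f \<and> (f z = 1 \<or> f (snd z, fst z) = 1)
    then 1 else 0 :: nat)" for v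
  define f0 where "f0 = (\<lambda>z\<in>?Z. 0 :: nat)"
  have g: "g v \<in> sym_maps m" for v by (auto simp: g_def sym_maps_def binary_maps_def)
  have g1: "g v (c i, c j) = 1 \<longleftrightarrow> (\<exists>f\<in>binary_maps m. v \<in> node_label T f \<and> (f (c i, c j) = 1 \<or> f (c j, c i) = 1))" for v i j
    unfolding g_def using c1[of i] c1[of j] by simp
  have f0: "f0 \<in> sym_maps m" by (auto simp: f0_def sym_maps_def binary_maps_def)
  have adj: "interp_adj m T (x i) (x j) \<longleftrightarrow> labelled i \<and> labelled j \<and> g (meet T (x i) (x j)) (c i, c j) = 1"
    if ij: "i < N" "j < N" "i \<noteq> j" for i j
  proof
    assume "interp_adj m T (x i) (x j)"
    then obtain k l f where klf: "k \<in> {1..m}" "l \<in> {1..m}" "f \<in> binary_maps m" "f (k, l) = 1"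
      "x i \<in> leaf_label T k" "x j \<in> leaf_label T l" "meet T (x i) (x j) \<in> node_label T f"
      unfolding interp_adj_def by blast
    then have "k = c i" "l = c j" using cu by blast+
    then show "labelled i \<and> labelled j \<and> g (meet T (x i) (x j)) (c i, c j) = 1"
      unfolding g1 labelled_def using klf by blast
  next
    assume *: "labelled i \<and> labelled j \<and> g (meet T (x i) (x j)) (c i, c j) = 1"
    then obtain f where f: "f \<in> binary_maps m" "meet T (x i) (x j) \<in> node_label T f" "f (c i, c j) = 1 \<or> f (c j, c i) = 1"
      unfolding g1 by blast
    have ne: "x i \<noteq> x j" using x(2) ij by (auto dest: inj_onD)
    have "x i \<in> space (borel_space T)" "x j \<in> space (borel_space T)" using x(1) ij by auto
    then have mc: "meet T (x i) (x j) = meet T (x j) (x i)"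
      using T by (auto simp: colored_borel_tree_semilattice_def tree_semilattice_def)
    from f(3) show "interp_adj m T (x i) (x j)"
    proof
      assume "f (c i, c j) = 1"
      then show ?thesis unfolding interp_adj_def using ne c * f by blast
    next
      assume "f (c j, c i) = 1"
      then have "interp_adj m T (x j) (x i)" unfolding interp_adj_def using ne[symmetric] c * f mc by metis
      then show ?thesis using sym ij by blast
    qed
  qed
  have "\<exists>t. distinct_leaves t \<and> leaves t = {..<N} \<and> labs t \<subseteq> sym_maps m \<and>
      (\<forall>i\<in>{..<N}. \<forall>j\<in>{..<N}. i \<noteq> j \<longrightarrow> lca_lab t i j = (if labelled i \<and> labelled j then g (meet T (x i) (x j)) else f0))"
  proof (cases "{i\<in>{..<N}. labelled i} = {}")
    case True
    \<comment> \<open>No point is coloured here, so the semilattice gives no tree to extend;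
      \<open>N > 0\<close> provides the leaf \<open>0\<close> to start from.\<close>
    let ?t0 = "Leaf 0 :: (nat \<times> nat \<Rightarrow> nat, nat) ltree"
    have d: "distinct_leaves ?t0" "finite {1..<N}" "{1..<N} \<inter> leaves ?t0 = {}" by simp_all
    from ltree_add_leaves[OF d, of f0]
    obtain t' where t': "distinct_leaves t'" "leaves t' = leaves ?t0 \<union> {1..<N}" "labs t' \<subseteq> insert f0 (labs ?t0)"
      "\<forall>x\<in>leaves t'. \<forall>y\<in>leaves t'. x \<noteq> y \<longrightarrow>
        lca_lab t' x y = (if x \<in> leaves ?t0 \<and> y \<in> leaves ?t0 then lca_lab ?t0 x y else f0)"
      by (elim exE conjE) (rule that)
    have "{..<N} = {0} \<union> {1..<N}" using N by (intro set_eqI) (simp, linarith)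
    then have l: "leaves t' = {..<N}" unfolding t'(2) by simp
    have la: "labs t' \<subseteq> sym_maps m" using t'(3) f0 by auto
    show ?thesis
    proof (rule exI[of _ t'], intro conjI ballI impI)
      fix i j assume ij: "i \<in> {..<N}" "j \<in> {..<N}" "i \<noteq> j"
      then have *: "i \<in> leaves t'" "j \<in> leaves t'" "\<not> (i = 0 \<and> j = 0)" unfolding l by auto
      have "lca_lab t' i j = f0" using bspec[OF bspec[OF t'(4) *(1)] *(2)] ij(3) *(3) by simp
      then show "lca_lab t' i j = (if labelled i \<and> labelled j then g (meet T (x i) (x j)) else f0)"
        using True ij by auto
    qed (use t' l la in auto)
  next
    case False
    let ?I = "{i\<in>{..<N}. labelled i}"
    have ts: "tree_semilattice (space (borel_space T)) (meet T)" using T by (simp add: colored_borel_tree_semilattice_def)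
    obtain t where t: "distinct_leaves t" "leaves t = ?I" "labs t \<subseteq> g ` space (borel_space T)"
      "\<forall>i\<in>?I. \<forall>j\<in>?I. i \<noteq> j \<longrightarrow> lca_lab t i j = g (meet T (x i) (x j))"
    proof -
      assume *: "\<And>t. distinct_leaves t \<Longrightarrow> leaves t = ?I \<Longrightarrow> labs t \<subseteq> g ` space (borel_space T) \<Longrightarrow>
        \<forall>i\<in>?I. \<forall>j\<in>?I. i \<noteq> j \<longrightarrow> lca_lab t i j = g (meet T (x i) (x j)) \<Longrightarrow> thesis"
      have "finite ?I" "?I \<subseteq> {..<N}" "x ` ?I \<subseteq> space (borel_space T)" using x(1) by auto
      from tree_semilattice_ltree[OF ts this(1) False inj_on_subset[OF x(2) this(2)] this(3), of g]
      show thesis by (elim exE conjE) (rule *)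
    qed
    have "finite ({..<N} - ?I)" "({..<N} - ?I) \<inter> leaves t = {}" using t(2) by auto
    from ltree_add_leaves[OF t(1) this, of f0]
    obtain t' where t': "distinct_leaves t'" "leaves t' = leaves t \<union> ({..<N} - ?I)" "labs t' \<subseteq> insert f0 (labs t)"
      "\<forall>x\<in>leaves t'. \<forall>y\<in>leaves t'. x \<noteq> y \<longrightarrow>
        lca_lab t' x y = (if x \<in> leaves t \<and> y \<in> leaves t then lca_lab t x y else f0)"
      by (elim exE conjE) (rule that)
    have l: "leaves t' = {..<N}" unfolding t'(2) t(2) by blast
    have la: "labs t' \<subseteq> sym_maps m" using t'(3) t(3) f0 g by blast
    show ?thesis
    proof (rule exI[of _ t'], intro conjI ballI impI)
      fix i j assume "i \<in> {..<N}" "j \<in> {..<N}" "i \<noteq> j"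
      then show "lca_lab t' i j = (if labelled i \<and> labelled j then g (meet T (x i) (x j)) else f0)"
        using t'(4) t(2,4) l by simp
    qed (use t' l la in auto)
  qed
  then obtain t where t: "distinct_leaves t" "leaves t = {..<N}" "labs t \<subseteq> sym_maps m"
    "\<forall>i\<in>{..<N}. \<forall>j\<in>{..<N}. i \<noteq> j \<longrightarrow> lca_lab t i j = (if labelled i \<and> labelled j then g (meet T (x i) (x j)) else f0)"
    by (elim exE conjE) (rule that)
  have "\<not> interp_adj m T a a" for a by (simp add: interp_adj_def)
  then have G: "finite_graph ?G" unfolding finite_graph_def graph.simps using sym by blast
  show ?thesis
  proof (rule ltree_imp_m_partite_cograph[OF G t(1), where c = c])
    fix i j assume "i \<in> verts ?G" "j \<in> verts ?G" "i \<noteq> j"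
    then show "adj ?G i j \<longleftrightarrow> lca_lab t i j (c i, c j) = 1"
      using adj[of i j] t(4) c1[of i] c1[of j] by (auto simp: f0_def)
  qed (use t c1 in auto)
qed

subsection \<open>Limits of digit laws\<close>

text \<open>Compactness of the unit interval and a diagonal sequence over the countably many indices
  \<open>i\<close>.\<close>

lemma exists_convergent_subsequence:
  fixes f :: "nat \<Rightarrow> nat \<Rightarrow> real"
  assumes "\<And>n i. f n i \<in> {0..1}"
  shows "\<exists>r. strict_mono r \<and> (\<forall>i. convergent (\<lambda>n. f (r n) i))"
proof -
  interpret subseqs "\<lambda>i s. convergent (\<lambda>k. f (s k) i)"
  proof
    fix i and s :: "nat \<Rightarrow> nat"
    have "seq_compact {0..1::real}" by (simp add: compact_imp_seq_compact)
    moreover have "\<forall>k. f (s k) i \<in> {0..1}" using assms by blast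
    ultimately obtain l r' where r': "strict_mono r'" "((\<lambda>k. f (s k) i) \<circ> r') \<longlonglongrightarrow> l"
      by (rule seq_compactE)
    have "convergent (\<lambda>k. f ((s \<circ> r') k) i)"
      using r'(2) unfolding convergent_def comp_def by blast
    then show "\<exists>r'. strict_mono r' \<and> convergent (\<lambda>k. f ((s \<circ> r') k) i)"
      using r'(1) by blast
  qed
  have "convergent (\<lambda>n. f (diagseq n) i)" for i
  proof -
    have "convergent (\<lambda>n. f ((diagseq \<circ> (+) (Suc i)) n) i)"
    proof (rule diagseq_holds)
      fix r s :: "nat \<Rightarrow> nat" and j assume "strict_mono r" "convergent (\<lambda>k. f (s k) j)"
      then show "convergent (\<lambda>k. f ((s \<circ> r) k) j)"
        using convergent_subseq_convergent[of "\<lambda>k. f (s k) j" r] by (simp add: comp_def)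
    qed
    then have "convergent (\<lambda>n. f (diagseq (n + Suc i)) i)"
      unfolding comp_def by (subst add.commute)
    then show ?thesis by (rule convergent_ignore_initial_segment[THEN iffD1])
  qed
  then show ?thesis using subseq_diagseq by blast
qed

section \<open>Random digits with prescribed prefix laws\<close>

abbreviation unit_interval :: "real measure" where
  "unit_interval \<equiv> restrict_space lborel {0..<1}"

lemma prob_space_unit_interval: "prob_space unit_interval"
  by (rule prob_spaceI) (simp add: space_restrict_space emeasure_restrict_space)

text \<open>Inverse distribution function: the words of length \<open>s\<close> label consecutive intervals whose lengths
  are their masses.\<close>

context
  fixes p :: "nat \<Rightarrow> (nat \<Rightarrow> nat) \<Rightarrow> real" and d :: "nat \<Rightarrow> nat"
  assumes p0: "\<And>w. p 0 w = 1" and p_nonneg: "\<And>s w. 0 \<le> p s w"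
    and p_Suc: "\<And>s w. p s w = (\<Sum>l<d s. p (Suc s) (w(s := l)))"
    and p_cong: "\<And>s w w'. (\<And>j. j < s \<Longrightarrow> w j = w' j) \<Longrightarrow> p s w = p s w'"
begin

primrec left_end :: "nat \<Rightarrow> (nat \<Rightarrow> nat) \<Rightarrow> real" where
  "left_end 0 w = 0"
| "left_end (Suc s) w = left_end s w + (\<Sum>l<w s. p (Suc s) (w(s := l)))"

text \<open>Digit \<open>s\<close> is the index of the subinterval containing \<open>u\<close>.
  Entries not yet determined are \<open>0\<close> and later stages leave earlier entries alone, so
  digit \<open>j\<close> of the infinite word is read at stage \<open>Suc j\<close>.\<close>

primrec word_at :: "real \<Rightarrow> nat \<Rightarrow> nat \<Rightarrow> nat" where
  "word_at u 0 = (\<lambda>_. 0)"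
| "word_at u (Suc s) = (word_at u s)(s :=
     LEAST i. u < left_end s (word_at u s) + (\<Sum>l<Suc i. p (Suc s) ((word_at u s)(s := l))))"

lemma left_end_cong: "(\<And>j. j < s \<Longrightarrow> w j = w' j) \<Longrightarrow> left_end s w = left_end s w'"
proof (induction s)
  case (Suc s)
  have "p (Suc s) (w(s := l)) = p (Suc s) (w'(s := l))" for l
    by (rule p_cong) (use Suc.prems in auto)
  then show ?case using Suc by simp
qed simp

lemma word_at_stable: "j < s \<Longrightarrow> word_at u s j = word_at u (Suc j) j"
proof (induction s)
  case (Suc s)
  show ?case
  proof (cases "j = s")
    case False
    then have "word_at u (Suc s) j = word_at u s j" by simp
    then show ?thesis using Suc False by (simp only: less_Suc_eq)
  qed (simp only:)
qed simp

text \<open>By \<open>p_Suc\<close> the subintervals fill their parent exactly, so a subinterval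
  containing \<open>u\<close> exists and its index is below \<open>d s\<close>.\<close>

lemma word_at_in_interval:
  assumes "u \<in> {0..<1}"
  shows "left_end s (word_at u s) \<le> u \<and> u < left_end s (word_at u s) + p s (word_at u s)"
    and "word_at u (Suc s) s < d s"
proof -
  have step: "word_at u (Suc s) s < d s \<and> left_end (Suc s) (word_at u (Suc s)) \<le> u
     \<and> u < left_end (Suc s) (word_at u (Suc s)) + p (Suc s) (word_at u (Suc s))"
    if IH: "left_end s (word_at u s) \<le> u" "u < left_end s (word_at u s) + p s (word_at u s)" for s
  proof -
    let ?w = "word_at u s" let ?q = "\<lambda>l. p (Suc s) (?w(s := l))"
    let ?P = "\<lambda>i. u < left_end s ?w + (\<Sum>l<Suc i. ?q l)"
    define i where "i = (LEAST i. ?P i)"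
    have "d s \<noteq> 0" using IH p_Suc[of s ?w] by (intro notI) simp
    then obtain e where e: "d s = Suc e" by (cases "d s") auto
    have Pe: "?P e" using IH(2) p_Suc[of s ?w] e by simp
    have Pi: "?P i" unfolding i_def by (rule LeastI[of ?P, OF Pe])
    have "i \<le> e" unfolding i_def by (rule Least_le[of ?P, OF Pe])
    have lower: "left_end s ?w + (\<Sum>l<i. ?q l) \<le> u"
    proof (cases i)
      case 0 then show ?thesis using IH by simp
    next
      case (Suc k)
      then have "\<not> ?P k" using not_less_Least[of k ?P] by (simp add: i_def)
      then show ?thesis using Suc by simp
    qed
    have w: "word_at u (Suc s) = ?w(s := i)" by (simp add: i_def)
    have "left_end s (?w(s := i)) = left_end s ?w" by (rule left_end_cong) simp
    then have "left_end (Suc s) (word_at u (Suc s)) = left_end s ?w + (\<Sum>l<i. ?q l)"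
      unfolding w by simp
    then show ?thesis using lower Pi \<open>i \<le> e\<close> e unfolding w by simp
  qed
  have all: "left_end s (word_at u s) \<le> u \<and> u < left_end s (word_at u s) + p s (word_at u s)" for s
  proof (induction s)
    case 0 then show ?case using assms by (simp add: p0)
  next
    case (Suc s) then show ?case using step[of s] by blast
  qed
  show "left_end s (word_at u s) \<le> u \<and> u < left_end s (word_at u s) + p s (word_at u s)" by (rule all)
  show "word_at u (Suc s) s < d s" using step[of s] all by blast
qed

lemma interval_nested:
  assumes "w s < d s"
  shows "left_end s w \<le> left_end (Suc s) w" "left_end (Suc s) w + p (Suc s) w \<le> left_end s w + p s w"
proof -
  show "left_end s w \<le> left_end (Suc s) w" by (simp add: sum_nonneg p_nonneg)
  have "(\<Sum>l<w s. p (Suc s) (w(s := l))) + p (Suc s) w = (\<Sum>l<Suc (w s). p (Suc s) (w(s := l)))" by simp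
  also have "\<dots> \<le> (\<Sum>l<d s. p (Suc s) (w(s := l)))"
    using assms by (intro sum_mono2) (auto simp: p_nonneg)
  finally show "left_end (Suc s) w + p (Suc s) w \<le> left_end s w + p s w" using p_Suc[of s w] by simp
qed

text \<open>Intervals of different words of the same length are disjoint: by nestedness the prefixes
  agree inductively, and the last digit is the least index whose right end exceeds
  \<open>u\<close>.\<close>

lemma word_at_unique:
  assumes "u \<in> {0..<1}" "\<And>j. j < s \<Longrightarrow> w j < d j" "left_end s w \<le> u" "u < left_end s w + p s w" "j < s"
  shows "w j = word_at u (Suc j) j"
  using assms(2-)
proof (induction s arbitrary: j)
  case (Suc s)
  have "left_end s w \<le> u" "u < left_end s w + p s w"
    using Suc.prems interval_nested[of w s] by auto
  then have IH: "w j = word_at u (Suc j) j" if "j < s" for j using Suc.IH Suc.prems(1) that by simp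
  show ?case
  proof (cases "j = s")
    case False then show ?thesis using IH Suc.prems by simp
  next
    case True
    let ?v = "word_at u s"
    have agree: "w j = ?v j" if "j < s" for j using IH[OF that] word_at_stable[OF that] by simp
    have le: "left_end s ?v = left_end s w" using agree by (intro left_end_cong) simp
    have q: "p (Suc s) (?v(s := l)) = p (Suc s) (w(s := l))" for l using agree by (intro p_cong) auto
    let ?P = "\<lambda>i. u < left_end s ?v + (\<Sum>l<Suc i. p (Suc s) (?v(s := l)))"
    have Pw: "?P (w s)" using Suc.prems(3) unfolding le q by simp
    have "(LEAST i. ?P i) = w s"
    proof (rule Least_equality)
      show "?P (w s)" by (rule Pw)
    next
      fix i assume i: "?P i"
      show "w s \<le> i"
      proof (rule ccontr)
        assume "\<not> w s \<le> i"
        then have "(\<Sum>l<Suc i. p (Suc s) (w(s := l))) \<le> (\<Sum>l<w s. p (Suc s) (w(s := l)))"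
          by (intro sum_mono2) (auto simp: p_nonneg)
        then show False using i Suc.prems(2) unfolding le q by simp
      qed
    qed
    then show ?thesis using True by simp
  qed
qed simp

lemma interval_in_unit:
  "(\<And>j. j < s \<Longrightarrow> w j < d j) \<Longrightarrow> 0 \<le> left_end s w \<and> left_end s w + p s w \<le> 1"
proof (induction s)
  case (Suc s)
  then show ?case using interval_nested[of w s] by force
qed (simp add: p0)

lemma word_at_vimage:
  assumes "\<And>j. j < s \<Longrightarrow> w j < d j"
  shows "{u \<in> {0..<1}. \<forall>j<s. word_at u (Suc j) j = w j} = {left_end s w..<left_end s w + p s w}"
proof (intro equalityI subsetI)
  fix u assume u: "u \<in> {u \<in> {0..<1}. \<forall>j<s. word_at u (Suc j) j = w j}"
  then have agree: "word_at u s j = w j" if "j < s" for j using that word_at_stable[OF that] by simp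
  have "left_end s (word_at u s) = left_end s w" "p s (word_at u s) = p s w"
    using agree by (auto intro: left_end_cong p_cong)
  then show "u \<in> {left_end s w..<left_end s w + p s w}" using word_at_in_interval(1)[of u s] u by simp
next
  fix u assume u: "u \<in> {left_end s w..<left_end s w + p s w}"
  then have "u \<in> {0..<1}" using interval_in_unit[of s w] assms by auto
  then show "u \<in> {u \<in> {0..<1}. \<forall>j<s. word_at u (Suc j) j = w j}"
    using word_at_unique[of u s w] assms u by (auto simp del: word_at.simps)
qed

text \<open>An extension theorem for consistent prefix laws, realised on the unit interval: the
  event that a word starts with \<open>w\<close> is a half-open interval of length
  \<open>p s w\<close>.\<close>

lemma exists_digits_of_law:
  "\<exists>Z. (\<forall>j. Z j \<in> unit_interval \<rightarrow>\<^sub>M count_space UNIV) \<and> (\<forall>j. \<forall>u\<in>{0..<1}. Z j u < d j)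
    \<and> (\<forall>s w. (\<forall>j<s. w j < d j) \<longrightarrow> measure unit_interval {u \<in> space unit_interval. \<forall>j<s. Z j u = w j} = p s w)"
proof (intro exI[of _ "\<lambda>j u. word_at u (Suc j) j"] conjI allI impI ballI)
  have sp: "space unit_interval = {0..<1}" by (simp add: space_restrict_space)
  have ivl: "{a..<b} \<in> sets unit_interval" if "0 \<le> a" "b \<le> 1" for a b :: real
    using that by (auto simp: sets_restrict_space_iff)
  show lt: "word_at u (Suc j) j < d j" if "u \<in> {0..<1}" for u j using word_at_in_interval(2)[OF that] .
  show "(\<lambda>u. word_at u (Suc j) j) \<in> unit_interval \<rightarrow>\<^sub>M count_space UNIV" for j
  proof (rule measurable_count_space_eq2_countable[THEN iffD2], intro conjI ballI)
    fix i
    \<comment> \<open>Words compatible with digit \<open>j\<close> being \<open>i\<close>. The crude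
      common bound on the digits places them in a finite function space, so that the preimage is a
      finite union of intervals.\<close>
    let ?W = "{w \<in> {..<Suc j} \<rightarrow>\<^sub>E {..<Max (d ` {..j}) + 1}. w j = i \<and> (\<forall>k<Suc j. w k < d k)}"
    have fin: "finite ?W" by (rule finite_subset[of _ "{..<Suc j} \<rightarrow>\<^sub>E {..<Max (d ` {..j}) + 1}"]) (auto intro!: finite_PiE)
    have "(\<lambda>u. word_at u (Suc j) j) -` {i} \<inter> space unit_interval =
      (\<Union>w\<in>?W. {u \<in> {0..<1}. \<forall>k<Suc j. word_at u (Suc k) k = w k})" (is "?L = ?R")
    proof (intro equalityI subsetI)
      fix u assume u: "u \<in> ?L"
      let ?w = "\<lambda>k\<in>{..<Suc j}. word_at u (Suc k) k"
      have "word_at u (Suc k) k < Max (d ` {..j}) + 1" if "k < Suc j" for k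
        
      proof -
        have "u \<in> {0..<1}" using u by (simp add: sp)
        then have "word_at u (Suc k) k < d k" by (rule lt)
        moreover have "d k \<le> Max (d ` {..j})" using that by (intro Max_ge) auto
        ultimately show ?thesis by linarith
      qed
      then have "?w \<in> ?W" using u lt[of u] by (auto simp: sp simp del: word_at.simps)
      then show "u \<in> ?R" using u by (intro UN_I[of ?w]) (auto simp: sp simp del: word_at.simps)
    qed (auto simp: sp simp del: word_at.simps)
    also have "?R \<in> sets unit_interval"
    proof (rule sets.finite_UN[OF fin])
      fix w assume "w \<in> ?W"
      then have w: "\<And>k. k < Suc j \<Longrightarrow> w k < d k" by blast
      show "{u \<in> {0..<1}. \<forall>k<Suc j. word_at u (Suc k) k = w k} \<in> sets unit_interval"
        using interval_in_unit[of "Suc j" w] w by (subst word_at_vimage) (auto intro!: ivl simp del: left_end.simps word_at.simps)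
    qed
    finally show "(\<lambda>u. word_at u (Suc j) j) -` {i} \<inter> space unit_interval \<in> sets unit_interval" .
  qed auto
  fix s w assume "\<forall>j<s. w j < d j"
  then have w: "\<And>j. j < s \<Longrightarrow> w j < d j" by blast
  have "measure unit_interval {left_end s w..<left_end s w + p s w} = p s w"
    using interval_in_unit[of s w] w p_nonneg[of s w] by (simp add: measure_restrict_space)
  then show "measure unit_interval {u \<in> space unit_interval. \<forall>j<s. word_at u (Suc j) j = w j} = p s w"
    unfolding sp using word_at_vimage[of s w] w by simp
qed

end

section \<open>Joint laws of finitely many digits\<close>

lemma prefix_law_sum:
  fixes Y :: "nat \<Rightarrow> 'a \<Rightarrow> nat"
  assumes "prob_space M" "\<And>j. Y j \<in> M \<rightarrow>\<^sub>M count_space UNIV" "\<And>x. x \<in> space M \<Longrightarrow> Y s x < d"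
  shows "measure M {x \<in> space M. \<forall>j<s. Y j x = w j}
    = (\<Sum>l<d. measure M {x \<in> space M. \<forall>j<Suc s. Y j x = (w(s := l)) j})"
proof -
  interpret prob_space M by fact
  note [measurable] = assms(2)
  have "{x \<in> space M. \<forall>j<s. Y j x = w j} = (\<Union>l\<in>{..<d}. {x \<in> space M. \<forall>j<Suc s. Y j x = (w(s := l)) j})"
    using assms(3) by (auto simp: less_Suc_eq)
  also have "measure M \<dots> = (\<Sum>l<d. measure M {x \<in> space M. \<forall>j<Suc s. Y j x = (w(s := l)) j})"
    by (intro finite_measure_finite_Union) (auto simp: disjoint_family_on_def)
  finally show ?thesis .
qed

text \<open>An event depending on the first \<open>s\<close> digits of finitely many independent
  points is a finite disjoint union of boxes. Its probability is a polynomial in the prefix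
  probabilities, so convergence of these suffices for all \<open>R\<close>.\<close>

lemma measure_PiM_digits:
  fixes R :: "('k \<Rightarrow> nat \<Rightarrow> nat) \<Rightarrow> bool"
  assumes M: "prob_space M" and Y[measurable]: "\<And>j. Y j \<in> M \<rightarrow>\<^sub>M count_space UNIV"
    and d: "\<And>j x. x \<in> space M \<Longrightarrow> Y j x < d j" and I: "finite I"
  shows "measure (\<Pi>\<^sub>M i\<in>I. M) {x \<in> space (\<Pi>\<^sub>M i\<in>I. M). R (\<lambda>i\<in>I. \<lambda>j\<in>{..<s}. Y j (x i))}
    = (\<Sum>w\<in>{w \<in> I \<rightarrow>\<^sub>E (\<Pi>\<^sub>E j\<in>{..<s}. {..<d j}). R w}. \<Prod>i\<in>I. measure M {x \<in> space M. \<forall>j<s. Y j x = w i j})"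
    and "{x \<in> space (\<Pi>\<^sub>M i\<in>I. M). R (\<lambda>i\<in>I. \<lambda>j\<in>{..<s}. Y j (x i))} \<in> sets (\<Pi>\<^sub>M i\<in>I. M)"
proof -
  interpret M: prob_space M by fact
  interpret product_prob_space "\<lambda>_. M" by unfold_locales
  interpret P: prob_space "\<Pi>\<^sub>M i\<in>I. M" using M by (intro prob_space_PiM)
  let ?P = "\<Pi>\<^sub>M i\<in>I. M"
  let ?W = "{w \<in> I \<rightarrow>\<^sub>E (\<Pi>\<^sub>E j\<in>{..<s}. {..<d j}). R w}"
  let ?B = "\<lambda>w. {x \<in> space M. \<forall>j<s. Y j x = w j}"
  have B: "?B w \<in> sets M" for w by measurable
  have fin: "finite ?W"
    by (rule finite_subset[of _ "I \<rightarrow>\<^sub>E (\<Pi>\<^sub>E j\<in>{..<s}. {..<d j})"]) (auto intro!: finite_PiE simp: I)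
  have eq: "{x \<in> space ?P. R (\<lambda>i\<in>I. \<lambda>j\<in>{..<s}. Y j (x i))} = (\<Union>w\<in>?W. \<Pi>\<^sub>E i\<in>I. ?B (w i))" (is "?L = ?R")
  proof (intro equalityI subsetI)
    fix x assume x: "x \<in> ?L"
    let ?w = "\<lambda>i\<in>I. \<lambda>j\<in>{..<s}. Y j (x i)"
    have "?w \<in> ?W" using x d by (auto simp: space_PiM PiE_iff)
    moreover have "x \<in> (\<Pi>\<^sub>E i\<in>I. ?B (?w i))" using x by (auto simp: space_PiM PiE_iff)
    ultimately show "x \<in> ?R" by blast
  next
    fix x assume "x \<in> ?R"
    then obtain w where w: "w \<in> ?W" "x \<in> (\<Pi>\<^sub>E i\<in>I. ?B (w i))" by blast
    have "(\<lambda>i\<in>I. \<lambda>j\<in>{..<s}. Y j (x i)) = w"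
    proof
      fix i
      show "(\<lambda>i\<in>I. \<lambda>j\<in>{..<s}. Y j (x i)) i = w i"
      proof (cases "i \<in> I")
        case True
        have wi: "w i \<in> (\<Pi>\<^sub>E j\<in>{..<s}. {..<d j})" using w(1) True by auto
        have "(\<lambda>j\<in>{..<s}. Y j (x i)) = w i"
        proof
          fix j show "(\<lambda>j\<in>{..<s}. Y j (x i)) j = w i j"
            using wi w(2) True by (cases "j < s") (auto simp: PiE_iff extensional_def)
        qed
        then show ?thesis using True by simp
      next
        case False then show ?thesis using w(1) by (auto simp: PiE_iff extensional_def)
      qed
    qed
    then show "x \<in> ?L" using w by (auto simp: space_PiM PiE_iff)
  qed
  have sets: "(\<Pi>\<^sub>E i\<in>I. ?B (w i)) \<in> sets ?P" for w using B I by (intro sets_PiM_I_finite)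
  then show "?L \<in> sets ?P" unfolding eq using fin by auto
  have disj: "disjoint_family_on (\<lambda>w. \<Pi>\<^sub>E i\<in>I. ?B (w i)) ?W"
    unfolding disjoint_family_on_def
  proof (intro ballI impI)
    fix w w' assume w: "w \<in> ?W" "w' \<in> ?W" "w \<noteq> w'"
    show "(\<Pi>\<^sub>E i\<in>I. ?B (w i)) \<inter> (\<Pi>\<^sub>E i\<in>I. ?B (w' i)) = {}"
    proof (rule equals0I)
      fix x assume x: "x \<in> (\<Pi>\<^sub>E i\<in>I. ?B (w i)) \<inter> (\<Pi>\<^sub>E i\<in>I. ?B (w' i))"
      have "w i j = w' i j" if "i \<in> I" "j < s" for i j using x that by (auto simp: PiE_iff)
      then have "w i = w' i" if "i \<in> I" for i
        using w that by (intro PiE_ext[of "w i" "{..<s}" "\<lambda>j. {..<d j}" "w' i"]) auto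
      then have "w = w'" using w by (intro PiE_ext[of w I _ w']) auto
      then show False using w by simp
    qed
  qed
  have "measure ?P ?L = (\<Sum>w\<in>?W. measure ?P (\<Pi>\<^sub>E i\<in>I. ?B (w i)))"
    unfolding eq using sets fin disj by (intro P.finite_measure_finite_Union) auto
  also have "\<dots> = (\<Sum>w\<in>?W. \<Prod>i\<in>I. measure M (?B (w i)))"
  proof (rule sum.cong[OF refl])
    fix w
    have "emeasure ?P (\<Pi>\<^sub>E i\<in>I. ?B (w i)) = (\<Prod>i\<in>I. emeasure M (?B (w i)))"
      using B by (intro emeasure_PiM I)
    also have "\<dots> = ennreal (\<Prod>i\<in>I. measure M (?B (w i)))"
      by (simp add: M.emeasure_eq_measure prod_ennreal)
    finally show "measure ?P (\<Pi>\<^sub>E i\<in>I. ?B (w i)) = (\<Prod>i\<in>I. measure M (?B (w i)))"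
      by (simp add: measure_def prod_nonneg)
  qed
  finally show "measure ?P ?L = (\<Sum>w\<in>?W. \<Prod>i\<in>I. measure M (?B (w i)))" .
qed

text \<open>Prefix laws converge along a diagonal subsequence, and the limits inherit consistency
  because the sum over the next digit is finite. The limit law is then realised on the unit
  interval.\<close>

lemma exists_limit_digits:
  fixes M :: "nat \<Rightarrow> 'a measure" and Y :: "nat \<Rightarrow> nat \<Rightarrow> 'a \<Rightarrow> nat"
  assumes M: "\<And>n. prob_space (M n)" and Y[measurable]: "\<And>n j. Y n j \<in> M n \<rightarrow>\<^sub>M count_space UNIV"
    and d: "\<And>n j x. x \<in> space (M n) \<Longrightarrow> Y n j x < d j"
  shows "\<exists>r Z. strict_mono (r :: nat \<Rightarrow> nat) \<and> (\<forall>j. Z j \<in> unit_interval \<rightarrow>\<^sub>M count_space UNIV)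
    \<and> (\<forall>j. \<forall>u\<in>{0..<1}. Z j u < d j)
    \<and> (\<forall>(I :: nat set) s R. finite I \<longrightarrow>
       (\<lambda>n. measure (\<Pi>\<^sub>M i\<in>I. M (r n)) {x \<in> space (\<Pi>\<^sub>M i\<in>I. M (r n)). R (\<lambda>i\<in>I. \<lambda>j\<in>{..<s}. Y (r n) j (x i))})
        \<longlonglongrightarrow> measure (\<Pi>\<^sub>M i\<in>I. unit_interval) {x \<in> space (\<Pi>\<^sub>M i\<in>I. unit_interval). R (\<lambda>i\<in>I. \<lambda>j\<in>{..<s}. Z j (x i))})"
proof -
  let ?q = "\<lambda>n s (w :: nat \<Rightarrow> nat). measure (M n) {x \<in> space (M n). \<forall>j<s. Y n j x = w j}"
  \<comment> \<open>A prefix law depends only on the first \<open>s\<close> entries of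
    \<open>w\<close>; lists of naturals therefore index all of them by a countable set.\<close>
  let ?l = "\<lambda>i. from_nat i :: nat list"
  have "?q n s w \<in> {0..1}" for n s w using prob_space.prob_le_1[OF M] by simp
  then obtain r where r: "strict_mono r" "\<And>i. convergent (\<lambda>n. ?q (r n) (length (?l i)) (nth (?l i)))"
    using exists_convergent_subsequence[of "\<lambda>n i. ?q n (length (?l i)) (nth (?l i))"] by blast
  have conv: "convergent (\<lambda>n. ?q (r n) s w)" for s w
  proof -
    have "?q n s w = ?q n s (nth (map w [0..<s]))" for n by (intro arg_cong2[where f = measure]) auto
    then show ?thesis using r(2)[of "to_nat (map w [0..<s])"] by simp
  qed
  define p where "p s w = lim (\<lambda>n. ?q (r n) s w)" for s w
  have p: "(\<lambda>n. ?q (r n) s w) \<longlonglongrightarrow> p s w" for s w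
    using conv[of s w] by (simp add: p_def convergent_LIMSEQ_iff)
  have law: "\<exists>Z :: nat \<Rightarrow> real \<Rightarrow> nat. (\<forall>j. Z j \<in> unit_interval \<rightarrow>\<^sub>M count_space UNIV) \<and> (\<forall>j. \<forall>u\<in>{0..<1}. Z j u < d j)
    \<and> (\<forall>s w. (\<forall>j<s. w j < d j) \<longrightarrow> measure unit_interval {u \<in> space unit_interval. \<forall>j<s. Z j u = w j} = p s w)"
  proof (rule exists_digits_of_law)
    have "?q (r n) 0 w = 1" for n w using prob_space.prob_space[OF M] by simp
    then show "p 0 w = 1" for w using p[of 0 w] by (simp add: LIMSEQ_const_iff)
    show "0 \<le> p s w" for s w using p[of s w] by (rule LIMSEQ_le_const) simp
    show "p s w = (\<Sum>l<d s. p (Suc s) (w(s := l)))" for s w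
    proof (rule LIMSEQ_unique[OF p])
      have "?q (r n) s w = (\<Sum>l<d s. ?q (r n) (Suc s) (w(s := l)))" for n
        using d by (intro prefix_law_sum M Y) 
      then show "(\<lambda>n. ?q (r n) s w) \<longlonglongrightarrow> (\<Sum>l<d s. p (Suc s) (w(s := l)))"
        by (simp only:) (intro tendsto_sum p)
    qed
    fix s and w w' :: "nat \<Rightarrow> nat" assume "\<And>j. j < s \<Longrightarrow> w j = w' j"
    then have "?q n s w = ?q n s w'" for n by (intro arg_cong2[where f = measure]) auto
    then show "p s w = p s w'" by (simp add: p_def)
  qed
  then obtain Z where Z: "\<And>j. Z j \<in> unit_interval \<rightarrow>\<^sub>M count_space UNIV" "\<And>j u. u \<in> {0..<1} \<Longrightarrow> Z j u < d j"
    "\<And>s w. (\<And>j. j < s \<Longrightarrow> w j < d j) \<Longrightarrow> measure unit_interval {u \<in> space unit_interval. \<forall>j<s. Z j u = w j} = p s w"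
    by blast
  have "(\<lambda>n. measure (\<Pi>\<^sub>M i\<in>I. M (r n)) {x \<in> space (\<Pi>\<^sub>M i\<in>I. M (r n)). R (\<lambda>i\<in>I. \<lambda>j\<in>{..<s}. Y (r n) j (x i))})
        \<longlonglongrightarrow> measure (\<Pi>\<^sub>M i\<in>I. unit_interval) {x \<in> space (\<Pi>\<^sub>M i\<in>I. unit_interval). R (\<lambda>i\<in>I. \<lambda>j\<in>{..<s}. Z j (x i))}"
    if I: "finite I" for I :: "nat set" and s R
  proof -
    let ?W = "{w \<in> I \<rightarrow>\<^sub>E (\<Pi>\<^sub>E j\<in>{..<s}. {..<d j}). R w}"
    have "x \<in> space unit_interval \<Longrightarrow> Z j x < d j" for x j using Z(2) by (simp add: space_restrict_space)
    from measure_PiM_digits(1)[OF prob_space_unit_interval Z(1) this I, where R = R and s = s]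
    have "measure (\<Pi>\<^sub>M i\<in>I. unit_interval) {x \<in> space (\<Pi>\<^sub>M i\<in>I. unit_interval). R (\<lambda>i\<in>I. \<lambda>j\<in>{..<s}. Z j (x i))}
      = (\<Sum>w\<in>?W. \<Prod>i\<in>I. measure unit_interval {x \<in> space unit_interval. \<forall>j<s. Z j x = w i j})" .
    also have "\<dots> = (\<Sum>w\<in>?W. \<Prod>i\<in>I. p s (w i))"
      by (intro sum.cong prod.cong refl Z(3)) (auto simp: PiE_iff)
    finally have lim: "measure (\<Pi>\<^sub>M i\<in>I. unit_interval) {x \<in> space (\<Pi>\<^sub>M i\<in>I. unit_interval). R (\<lambda>i\<in>I. \<lambda>j\<in>{..<s}. Z j (x i))}
      = (\<Sum>w\<in>?W. \<Prod>i\<in>I. p s (w i))" .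
    have "measure (\<Pi>\<^sub>M i\<in>I. M (r n)) {x \<in> space (\<Pi>\<^sub>M i\<in>I. M (r n)). R (\<lambda>i\<in>I. \<lambda>j\<in>{..<s}. Y (r n) j (x i))}
      = (\<Sum>w\<in>?W. \<Prod>i\<in>I. ?q (r n) s (w i))" for n
      by (rule measure_PiM_digits(1)[OF M Y _ I]) (rule d)
    then show ?thesis unfolding lim by (simp only:) (intro tendsto_sum tendsto_prod p)
  qed
  then show ?thesis using r(1) Z(1,2) by (intro exI[of _ r] exI[of _ Z]) blast
qed

subsection \<open>A tree semilattice on sequences\<close>

text \<open>The coordinates of a sequence are ordered by fractional part first, so that a coordinate
  \<open>l + t\<close> with \<open>0 < t < 1\<close> carries a position \<open>t\<close> and a label \<open>l\<close>; \<open>0\<close> is the least element and marks the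
  end of a finite sequence.\<close>

lemma not_frac_less_0 [simp]: "\<not> frac x < 0"
  using frac_ge_0[of x] by linarith

definition key_less :: "real \<Rightarrow> real \<Rightarrow> bool" where
  "key_less a b \<longleftrightarrow> frac a < frac b \<or> frac a = frac b \<and> a \<noteq> b \<and> (a = 0 \<or> b \<noteq> 0 \<and> a < b)"

definition key_min :: "real \<Rightarrow> real \<Rightarrow> real" where
  "key_min a b = (if key_less a b then a else b)"

lemma key_less_linear: "key_less a b \<or> a = b \<or> key_less b a"
  by (auto simp: key_less_def)

lemma key_less_irrefl [simp]: "\<not> key_less a a"
  by (simp add: key_less_def)

lemma key_less_trans: "key_less a b \<Longrightarrow> key_less b c \<Longrightarrow> key_less a c"
  by (auto simp: key_less_def)

lemma not_key_less_0 [simp]: "\<not> key_less a 0"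
  by (auto simp: key_less_def)

lemma key_min_idem [simp]: "key_min a a = a"
  by (simp add: key_min_def)

lemma key_min_commute: "key_min a b = key_min b a"
  using key_less_linear[of a b] key_less_trans[of a b a] by (auto simp: key_min_def)

lemma key_min_assoc: "key_min (key_min a b) c = key_min a (key_min b c)"
proof -
  interpret ko: linorder "\<lambda>a b. a = b \<or> key_less a b" key_less
    by unfold_locales (use key_less_linear key_less_trans key_less_irrefl in \<open>blast+\<close>)
  have "key_min a b = ko.min a b" for a b by (simp add: key_min_def ko.min_def)
  then show ?thesis by (simp only: ko.min.assoc)
qed

lemma key_min_0 [simp]: "key_min 0 a = 0" "key_min a 0 = 0"
  using key_less_linear[of a 0] key_min_commute[of 0 a] by (auto simp: key_min_def)

text \<open>The smaller entry survives at the first difference: it belongs to the path that turns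
  left and thus carries the label of the meet.\<close>

definition seq_meet :: "(nat \<Rightarrow> real) \<Rightarrow> (nat \<Rightarrow> real) \<Rightarrow> nat \<Rightarrow> real" where
  "seq_meet x y i = (if \<forall>j<i. x j = y j then key_min (x i) (y i) else 0)"

lemma seq_meet_idem [simp]: "seq_meet x x = x"
  by (simp add: seq_meet_def fun_eq_iff)

lemma seq_meet_commute: "seq_meet x y = seq_meet y x"
  by (rule ext) (simp add: seq_meet_def key_min_commute, metis)

text \<open>A description that is symmetric in the three sequences, from which associativity follows
  by commutativity.\<close>

lemma seq_meet_meet:
  "seq_meet (seq_meet x y) z i =
    (if \<forall>j<i. x j = y j \<and> y j = z j then key_min (key_min (x i) (y i)) (z i) else 0)"
proof (cases "\<forall>j<i. x j = y j")
  case True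
  then have "seq_meet x y j = y j" if "j < i" for j using that by (simp add: seq_meet_def)
  then have "(\<forall>j<i. seq_meet x y j = z j) \<longleftrightarrow> (\<forall>j<i. x j = y j \<and> y j = z j)" using True by auto
  moreover have "seq_meet x y i = key_min (x i) (y i)" using True by (simp add: seq_meet_def)
  ultimately show ?thesis unfolding seq_meet_def[of "seq_meet x y"] by (simp only:)
next
  case False
  then have "seq_meet x y i = 0" by (auto simp: seq_meet_def)
  then have "seq_meet (seq_meet x y) z i = 0" by (simp add: seq_meet_def[of "seq_meet x y"])
  then show ?thesis using False by auto
qed

lemma seq_meet_assoc: "seq_meet (seq_meet x y) z = seq_meet x (seq_meet y z)"
proof
  fix i
  have "seq_meet x (seq_meet y z) i = seq_meet (seq_meet y z) x i" by (simp add: seq_meet_commute)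
  also have "\<dots> = (if \<forall>j<i. x j = y j \<and> y j = z j then key_min (key_min (x i) (y i)) (z i) else 0)"
    unfolding seq_meet_meet by (metis key_min_assoc key_min_commute)
  finally show "seq_meet (seq_meet x y) z i = seq_meet x (seq_meet y z) i" by (simp add: seq_meet_meet)
qed

text \<open>Let \<open>x\<close> be the smaller one at the first difference \<open>k\<close> of
  \<open>x\<close> and \<open>y\<close>. As \<open>y\<close> lies below \<open>z\<close>, the entry
  \<open>y k\<close> is at most \<open>z k\<close>, so \<open>x\<close> differs from
  \<open>z\<close> at \<open>k\<close>. Being below \<open>z\<close>, it vanishes from then on and
  is itself the meet with \<open>y\<close>.\<close>

lemma seq_meet_chain:
  assumes "seq_meet x z = x" "seq_meet y z = y"
  shows "seq_meet x y = x \<or> seq_meet x y = y"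
proof -
  have aux: "seq_meet x y = x"
    if xz: "seq_meet x z = x" and yz: "seq_meet y z = y"
      and k: "\<forall>j<k. x j = y j" "key_less (x k) (y k)" for x y k
  proof -
    \<comment> \<open>If \<open>y\<close> left \<open>z\<close> before \<open>k\<close>, then
      \<open>y k\<close> would be \<open>0\<close>, and nothing is smaller than
      \<open>0\<close>.\<close>
    have pre: "\<forall>j<k. y j = z j"
    proof (rule ccontr)
      assume "\<not> ?thesis"
      then have "seq_meet y z k = 0" by (auto simp: seq_meet_def)
      then show False using yz k(2) by simp
    qed
    have "y k = key_min (y k) (z k)" using pre yz by (metis seq_meet_def)
    then have "x k \<noteq> z k" using k(2) key_less_trans[of "y k" "z k" "y k"] key_less_trans[of "x k" "y k" "x k"]
      by (auto simp: key_min_def split: if_splits)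
    then have tail: "x i = 0" if "k < i" for i using that xz by (metis seq_meet_def)
    have "x k \<noteq> y k" using k(2) by auto
    show ?thesis
    proof
      fix i
      consider "i < k" | "i = k" | "k < i" by linarith
      then show "seq_meet x y i = x i"
      proof cases
        case 1 then show ?thesis using k(1) by (auto simp: seq_meet_def)
      next
        case 2 then show ?thesis using k by (simp add: seq_meet_def key_min_def)
      next
        case 3 then show ?thesis using \<open>x k \<noteq> y k\<close> tail by (auto simp: seq_meet_def)
      qed
    qed
  qed
  show ?thesis
  proof (cases "x = y")
    case False
    then have ex: "\<exists>i. x i \<noteq> y i" by auto
    then obtain k where k: "x k \<noteq> y k" "\<forall>j<k. x j = y j"
      using exists_least_iff[of "\<lambda>i. x i \<noteq> y i"] by blast
    then consider "key_less (x k) (y k)" | "key_less (y k) (x k)" using key_less_linear by blast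
    then show ?thesis
    proof cases
      case 1 then show ?thesis using aux[OF assms k(2)] by blast
    next
      case 2
      have "seq_meet y x = y" using aux[OF assms(2,1) _ 2] k(2) by (metis (full_types))
      then show ?thesis by (simp add: seq_meet_commute)
    qed
  qed simp
qed

lemma seq_meet_eqI:
  assumes "\<forall>j<k. x j = y j" "key_less (x k) (y k)"
  shows "seq_meet x y k = x k" "j > k \<Longrightarrow> seq_meet x y j = 0"
proof -
  show "seq_meet x y k = x k" using assms by (simp add: seq_meet_def key_min_def)
  have "x k \<noteq> y k" using assms(2) by auto
  then show "j > k \<Longrightarrow> seq_meet x y j = 0" by (auto simp: seq_meet_def)
qed

definition seq_nodes :: "nat \<Rightarrow> (nat \<Rightarrow> real) set" where
  "seq_nodes l = {z. \<exists>k. z k \<noteq> 0 \<and> (\<forall>j>k. z j = 0) \<and> \<lfloor>z k\<rfloor> = int l}"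

lemma seq_meet_in_nodes:
  assumes "\<forall>j<k. x j = y j" "key_less (x k) (y k)" "x k \<noteq> 0"
  shows "seq_meet x y \<in> seq_nodes l \<longleftrightarrow> \<lfloor>x k\<rfloor> = int l"
proof
  assume "seq_meet x y \<in> seq_nodes l"
  then obtain i where i: "seq_meet x y i \<noteq> 0" "\<forall>j>i. seq_meet x y j = 0" "\<lfloor>seq_meet x y i\<rfloor> = int l"
    by (auto simp: seq_nodes_def)
  have "i = k" using i seq_meet_eqI[OF assms(1,2)] assms(3) by (metis linorder_neqE_nat)
  then show "\<lfloor>x k\<rfloor> = int l" using i seq_meet_eqI(1)[OF assms(1,2)] by simp
next
  assume "\<lfloor>x k\<rfloor> = int l"
  then show "seq_meet x y \<in> seq_nodes l"
    using seq_meet_eqI[OF assms(1,2)] assms(3) unfolding seq_nodes_def by (intro CollectI exI[of _ k]) auto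
qed

text \<open>Leaves are coloured sequences; nodes are the sequences of colour \<open>0\<close>.\<close>

definition color_meet :: "(nat \<Rightarrow> real) \<times> real \<Rightarrow> (nat \<Rightarrow> real) \<times> real \<Rightarrow> (nat \<Rightarrow> real) \<times> real" where
  "color_meet p q = (if p = q then p else (seq_meet (fst p) (fst q), 0))"

text \<open>An element below \<open>r\<close> either equals \<open>r\<close> or has colour
  \<open>0\<close>, so the chain condition reduces to that of \<open>seq_meet\<close>.\<close>

lemma tree_semilattice_color_meet: "tree_semilattice UNIV color_meet"
  unfolding tree_semilattice_def
proof (intro conjI ballI impI)
  fix p q r :: "(nat \<Rightarrow> real) \<times> real"
  show "color_meet p p = p" by (simp add: color_meet_def)
  show "color_meet p q = color_meet q p" by (simp add: color_meet_def seq_meet_commute)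
  have sub: "seq_meet x (seq_meet x y) = seq_meet x y" "seq_meet x (seq_meet y z) = seq_meet y (seq_meet x z)"
     for x y z by (metis seq_meet_assoc seq_meet_idem, metis seq_meet_assoc seq_meet_commute)
  show "color_meet (color_meet p q) r = color_meet p (color_meet q r)"
    by (auto simp: color_meet_def sub seq_meet_assoc seq_meet_commute)
  assume "color_meet p r = p \<and> color_meet q r = q"
  then have "p = r \<or> snd p = 0" "q = r \<or> snd q = 0" "seq_meet (fst p) (fst r) = fst p" "seq_meet (fst q) (fst r) = fst q"
    by (auto simp: color_meet_def prod_eq_iff split: if_splits)
  then show "color_meet p q \<in> {p, q}"
    using seq_meet_chain[of "fst p" "fst r" "fst q"] seq_meet_commute
    by (auto simp: color_meet_def prod_eq_iff)
qed simp

definition label_index :: "nat \<Rightarrow> (nat \<times> nat \<Rightarrow> nat) \<Rightarrow> nat" where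
  "label_index m = (SOME g. inj_on g (sym_maps m) \<and> g ` sym_maps m = {..<card (sym_maps m)})"

lemma finite_sym_maps: "finite (sym_maps m)"
  by (rule finite_subset[OF _ finite_PiE[of "{1..m} \<times> {1..m}" "\<lambda>_. {0, 1}"]]) (auto simp: sym_maps_def binary_maps_def)

lemma label_index: "inj_on (label_index m) (sym_maps m)" "f \<in> sym_maps m \<Longrightarrow> label_index m f < card (sym_maps m)"
proof -
  obtain g where "bij_betw g (sym_maps m) {..<card (sym_maps m)}"
    using ex_bij_betw_finite_nat[OF finite_sym_maps] by (auto simp: atLeast0LessThan)
  then have "\<exists>g. inj_on g (sym_maps m) \<and> g ` sym_maps m = {..<card (sym_maps m)}" by (auto simp: bij_betw_def)
  from someI_ex[OF this] show "inj_on (label_index m) (sym_maps m)"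
    "f \<in> sym_maps m \<Longrightarrow> label_index m f < card (sym_maps m)" by (auto simp: label_index_def)
qed

text \<open>Asymmetric maps mark no node at all, which makes the resulting adjacency
  symmetric.\<close>

definition seq_tree :: "nat \<Rightarrow> ((nat \<Rightarrow> real) \<times> real) colored_tree" where
  "seq_tree m = \<lparr>borel_space = borel, meet = color_meet, leaf_label = (\<lambda>i. {p. snd p = real i}),
     node_label = (\<lambda>f. if f \<in> sym_maps m then {p. fst p \<in> seq_nodes (label_index m f)} else {})\<rparr>"

lemma second_countable_euclidean: "second_countable (euclidean :: 'a :: second_countable_topology topology)"
proof -
  obtain B :: "'a set set" where "countable B" "topological_basis B" using ex_countable_basis by blast
  then show ?thesis unfolding second_countable_def open_openin[symmetric]
    by (intro exI[of _ B] conjI ballI allI impI) (meson topological_basis_open topological_basisE)+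
qed

lemma compatible_polish_borel: "compatible_polish_topology euclidean (borel :: 'a :: {complete_space, second_countable_topology} measure)"
  unfolding compatible_polish_topology_def
  using second_countable_euclidean completely_metrizable_space_euclidean by (auto simp: borel_def sets_measure_of)

lemma key_less_measurable [measurable (raw)]:
  assumes [measurable]: "f \<in> borel_measurable M" "g \<in> borel_measurable M"
  shows "Measurable.pred M (\<lambda>x. key_less (f x) (g x))"
  unfolding key_less_def frac_def by measurable

lemma color_meet_measurable:
  "(\<lambda>(p, q). color_meet p q) \<in> borel \<Otimes>\<^sub>M borel \<rightarrow>\<^sub>M borel"
proof -
  let ?M = "borel \<Otimes>\<^sub>M borel :: (((nat \<Rightarrow> real) \<times> real) \<times> ((nat \<Rightarrow> real) \<times> real)) measure"
  have co [measurable]: "(\<lambda>x. fst (fst x) j) \<in> borel_measurable ?M" "(\<lambda>x. fst (snd x) j) \<in> borel_measurable ?M"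
     "(\<lambda>x. snd (fst x)) \<in> borel_measurable ?M" "(\<lambda>x. snd (snd x)) \<in> borel_measurable ?M" for j
  proof -
    have c: "(\<lambda>p :: (nat \<Rightarrow> real) \<times> real. fst p j) \<in> borel_measurable borel"
      by (intro borel_measurable_continuous_onI continuous_intros continuous_on_product_then_coordinatewise)
    have s: "(\<lambda>p :: (nat \<Rightarrow> real) \<times> real. snd p) \<in> borel_measurable borel"
      by (intro borel_measurable_continuous_onI continuous_intros)
    show "(\<lambda>x. fst (fst x) j) \<in> borel_measurable ?M" using measurable_compose[OF measurable_fst c] .
    show "(\<lambda>x. fst (snd x) j) \<in> borel_measurable ?M" using measurable_compose[OF measurable_snd c] .
    show "(\<lambda>x. snd (fst x)) \<in> borel_measurable ?M" using measurable_compose[OF measurable_fst s] .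
    show "(\<lambda>x. snd (snd x)) \<in> borel_measurable ?M" using measurable_compose[OF measurable_snd s] .
  qed
  have eq: "Measurable.pred ?M (\<lambda>x. fst x = snd x)"
  proof -
    have "Measurable.pred ?M (\<lambda>x. (\<forall>j. fst (fst x) j = fst (snd x) j) \<and> snd (fst x) = snd (snd x))" by measurable
    then show ?thesis by (simp add: prod_eq_iff fun_eq_iff)
  qed
  have sm: "(\<lambda>x. seq_meet (fst (fst x)) (fst (snd x))) \<in> borel_measurable ?M"
    unfolding seq_meet_def[abs_def] key_min_def by (intro measurable_coordinatewise_then_product) measurable
  have "(\<lambda>x. (seq_meet (fst (fst x)) (fst (snd x)), 0 :: real)) \<in> borel_measurable ?M"
    using sm by (intro borel_measurable_Pair) auto
  moreover have "(\<lambda>x. fst x) \<in> borel_measurable ?M" by simp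
  ultimately have "(\<lambda>x. if fst x = snd x then fst x else (seq_meet (fst (fst x)) (fst (snd x)), 0)) \<in> borel_measurable ?M"
    using eq by (intro measurable_If) (auto simp: pred_def)
  then show ?thesis by (simp add: color_meet_def case_prod_unfold)
qed

lemma seq_tree_colored: "colored_borel_tree_semilattice m (seq_tree m)"
proof -
  have c [measurable]: "(\<lambda>p :: (nat \<Rightarrow> real) \<times> real. fst p j) \<in> borel_measurable borel" for j
      by (intro borel_measurable_continuous_onI continuous_intros continuous_on_product_then_coordinatewise)
  have s [measurable]: "(\<lambda>p :: (nat \<Rightarrow> real) \<times> real. snd p) \<in> borel_measurable borel"
      by (intro borel_measurable_continuous_onI continuous_intros)
  have "Measurable.pred borel (\<lambda>p :: (nat \<Rightarrow> real) \<times> real. snd p = real i)" for i by measurable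
  then have 1: "{p :: (nat \<Rightarrow> real) \<times> real. snd p = real i} \<in> sets borel" for i by (simp add: pred_def)
  have "Measurable.pred borel (\<lambda>p :: (nat \<Rightarrow> real) \<times> real.
     \<exists>k. fst p k \<noteq> 0 \<and> (\<forall>j. j > k \<longrightarrow> fst p j = 0) \<and> real_of_int \<lfloor>fst p k\<rfloor> = real_of_int (int l))" for l
    by measurable
  then have 2: "{p :: (nat \<Rightarrow> real) \<times> real. fst p \<in> seq_nodes l} \<in> sets borel" for l
    by (simp add: pred_def seq_nodes_def)
  have sb: "standard_borel (borel :: ((nat \<Rightarrow> real) \<times> real) measure)"
    unfolding standard_borel_def using compatible_polish_borel by blast
  show ?thesis
    unfolding colored_borel_tree_semilattice_def seq_tree_def
    using 1 2 tree_semilattice_color_meet color_meet_measurable sb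
    by (auto simp: disjoint_family_on_def)
qed

text \<open>The last nonzero entry of the meet determines its label and \<open>label_index\<close>
  is injective, so the existential over maps collapses to \<open>f\<close>.\<close>

lemma seq_tree_adj:
  assumes f: "f \<in> sym_maps m" and k: "\<forall>l<k. x l = y l" "key_less (x k) (y k)" "x k \<noteq> 0" "\<lfloor>x k\<rfloor> = int (label_index m f)"
    and ij: "i \<in> {1..m}" "j \<in> {1..m}"
  shows "interp_adj m (seq_tree m) (x, real i) (y, real j) \<longleftrightarrow> f (i, j) = 1"
proof -
  have ne: "x \<noteq> y" using k(2) by auto
  then have meet: "meet (seq_tree m) (x, real i) (y, real j) = (seq_meet x y, 0)" by (simp add: seq_tree_def color_meet_def)
  have node: "(seq_meet x y, 0) \<in> node_label (seq_tree m) g \<longleftrightarrow> g = f" for g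
    using seq_meet_in_nodes[OF k(1-3)] k(4) f inj_onD[OF label_index(1)] by (auto simp: seq_tree_def)
  have leaf: "(z, real c) \<in> leaf_label (seq_tree m) c' \<longleftrightarrow> c' = c" for z c c'
    by (auto simp: seq_tree_def)
  have "f \<in> binary_maps m" using f by (simp add: sym_maps_def)
  then show ?thesis using ne ij unfolding interp_adj_def meet node leaf by auto
qed

lemma seq_tree_adj_sym: "interp_adj m (seq_tree m) p q \<Longrightarrow> interp_adj m (seq_tree m) q p"
proof -
  assume "interp_adj m (seq_tree m) p q"
  then obtain i j f where *: "p \<noteq> q" "i \<in> {1..m}" "j \<in> {1..m}" "f \<in> binary_maps m" "f (i, j) = 1"
    "p \<in> leaf_label (seq_tree m) i" "q \<in> leaf_label (seq_tree m) j" "meet (seq_tree m) p q \<in> node_label (seq_tree m) f"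
    unfolding interp_adj_def by blast
  then have "f \<in> sym_maps m" by (auto simp: seq_tree_def split: if_splits)
  then have "f (j, i) = 1" using *(2,3,5) unfolding sym_maps_def by force
  moreover have "meet (seq_tree m) q p = meet (seq_tree m) p q"
    by (simp add: seq_tree_def color_meet_def seq_meet_commute)
  ultimately show ?thesis using * unfolding interp_adj_def by metis
qed

subsection \<open>Transport along an injection\<close>

text \<open>The map \<open>h\<close> is merely injective. Its range receives the transported
  \<sigma>-algebra and topology; those of the real line play no part, so no Borel property of
  \<open>h\<close> has to be established.\<close>

definition transport_tree :: "('a \<Rightarrow> 'b) \<Rightarrow> 'a colored_tree \<Rightarrow> 'b colored_tree" where
  "transport_tree h T = \<lparr>borel_space = embed_measure (borel_space T) h,
     meet = \<lambda>x y. h (meet T (inv h x) (inv h y)),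
     leaf_label = \<lambda>i. h ` leaf_label T i, node_label = \<lambda>f. h ` node_label T f\<rparr>"

definition transport_topology :: "('a \<Rightarrow> 'b) \<Rightarrow> 'a topology \<Rightarrow> 'b topology" where
  "transport_topology h X = pullback_topology (h ` topspace X) (inv h) X"

context
  fixes h :: "'a \<Rightarrow> 'b" and T :: "'a colored_tree"
  assumes h: "inj h"
begin

lemma inv_measurable_embed: "inv h \<in> embed_measure M h \<rightarrow>\<^sub>M M"
  using h by (intro measurable_embed_measure1) simp

text \<open>For the pulled-back topology \<open>h\<close> is a homeomorphism onto its range, so the
  Polish properties carry over, and generating a \<sigma>-algebra commutes with taking
  preimages.\<close>

lemma transport_compatible:
  assumes "compatible_polish_topology X M"
  shows "compatible_polish_topology (transport_topology h X) (embed_measure M h)"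
proof -
  let ?Y = "transport_topology h X"
  have X: "completely_metrizable_space X" "second_countable X" "topspace X = space M"
    "sets M = sigma_sets (topspace X) {U. openin X U}"
    using assms by (auto simp: compatible_polish_topology_def)
  have top: "topspace ?Y = h ` topspace X"
    using h by (auto simp: transport_topology_def topspace_pullback_topology)
  have opn: "openin ?Y U \<longleftrightarrow> (\<exists>V. openin X V \<and> U = inv h -` V \<inter> h ` topspace X)" for U
    by (simp add: transport_topology_def openin_pullback_topology)
  have "continuous_map X ?Y h"
    unfolding continuous_map_def top
  proof (intro conjI allI impI)
    fix U assume "openin ?Y U"
    then obtain V where V: "openin X V" "U = inv h -` V \<inter> h ` topspace X" using opn by blast
    then have "{x \<in> topspace X. h x \<in> U} = V" using h openin_subset[OF V(1)] by auto
    then show "openin X {x \<in> topspace X. h x \<in> U}" using V by simp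
  qed auto
  moreover have "continuous_map ?Y X (inv h)"
    unfolding continuous_map_def top
  proof (intro conjI allI impI)
    fix V assume V: "openin X V"
    have "{x \<in> h ` topspace X. inv h x \<in> V} = inv h -` V \<inter> h ` topspace X" by auto
    then show "openin ?Y {x \<in> h ` topspace X. inv h x \<in> V}" using V opn by blast
  qed (use h in auto)
  ultimately have "homeomorphic_maps X ?Y h (inv h)" using h by (auto simp: homeomorphic_maps_def top)
  then have hom: "X homeomorphic_space ?Y" by (auto simp: homeomorphic_space_def)
  have "sets (embed_measure M h) = {inv h -` A \<inter> h ` space M |A. A \<in> sets M}"
  proof -
    have "h ` A = inv h -` A \<inter> h ` space M" if "A \<in> sets M" for A
      using h sets.sets_into_space[OF that] by auto
    then show ?thesis unfolding sets_embed_measure[OF h] by metis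
  qed
  also have "\<dots> = sigma_sets (h ` space M) {inv h -` A \<inter> h ` space M |A. A \<in> {U. openin X U}}"
    unfolding X(4) X(3)[symmetric] using h by (intro sigma_sets_vimage_commute) auto
  also have "{inv h -` A \<inter> h ` space M |A. A \<in> {U. openin X U}} = {U. openin ?Y U}"
    using opn X(3) by auto
  finally show ?thesis
    unfolding compatible_polish_topology_def top
    using X homeomorphic_completely_metrizable_space[OF hom] homeomorphic_space_second_countability[OF hom]
    by (auto simp: space_embed_measure)
qed

lemma transport_adj:
  "interp_adj m (transport_tree h T) (h x) (h y) \<longleftrightarrow> interp_adj m T x y"
  using h by (simp add: interp_adj_def transport_tree_def inj_image_mem_iff inj_eq)

lemma transport_colored:
  assumes "colored_borel_tree_semilattice m T"
  shows "colored_borel_tree_semilattice m (transport_tree h T)"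
proof -
  let ?M = "borel_space T" let ?N = "embed_measure ?M h"
  have T: "standard_borel ?M" "tree_semilattice (space ?M) (meet T)"
     and mm: "(\<lambda>(x, y). meet T x y) \<in> ?M \<Otimes>\<^sub>M ?M \<rightarrow>\<^sub>M ?M"
     and l: "\<forall>i\<in>{1..m}. leaf_label T i \<in> sets ?M" "\<forall>f\<in>binary_maps m. node_label T f \<in> sets ?M"
       "disjoint_family_on (leaf_label T) {1..m}"
    using assms by (auto simp: colored_borel_tree_semilattice_def)
  have ts: "tree_semilattice (h ` space ?M) (\<lambda>x y. h (meet T (inv h x) (inv h y)))"
  proof -
    let ?S = "space ?M" and ?w = "meet T"
    have w: "\<And>x y. x \<in> ?S \<Longrightarrow> y \<in> ?S \<Longrightarrow> ?w x y \<in> ?S" "\<And>x. x \<in> ?S \<Longrightarrow> ?w x x = x"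
      "\<And>x y. x \<in> ?S \<Longrightarrow> y \<in> ?S \<Longrightarrow> ?w x y = ?w y x"
      "\<And>x y z. x \<in> ?S \<Longrightarrow> y \<in> ?S \<Longrightarrow> z \<in> ?S \<Longrightarrow> ?w (?w x y) z = ?w x (?w y z)"
      "\<And>x y z. x \<in> ?S \<Longrightarrow> y \<in> ?S \<Longrightarrow> z \<in> ?S \<Longrightarrow> ?w x z = x \<Longrightarrow> ?w y z = y \<Longrightarrow> ?w x y \<in> {x, y}"
      using T(2) unfolding tree_semilattice_def by blast+
    show ?thesis
      unfolding tree_semilattice_def using h w(1,2,4,5)
      by (intro conjI ballI impI; elim imageE) (simp_all add: inj_eq inj_image_mem_iff w(3)[symmetric], (metis w(3))?)
  qed
  have m: "(\<lambda>(x, y). h (meet T (inv h x) (inv h y))) \<in> ?N \<Otimes>\<^sub>M ?N \<rightarrow>\<^sub>M ?N"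
  proof -
    have "(\<lambda>z. (inv h (fst z), inv h (snd z))) \<in> ?N \<Otimes>\<^sub>M ?N \<rightarrow>\<^sub>M ?M \<Otimes>\<^sub>M ?M"
      using inv_measurable_embed by (intro measurable_Pair) (auto intro: measurable_compose[rotated])
    from measurable_compose[OF measurable_compose[OF this mm] measurable_embed_measure2[OF h]]
    show ?thesis by (simp add: case_prod_unfold)
  qed
  have "standard_borel ?N" using T(1) transport_compatible unfolding standard_borel_def by blast
  moreover have "disjoint_family_on (\<lambda>i. h ` leaf_label T i) {1..m}"
    using l(3) h unfolding disjoint_family_on_def by (simp add: image_Int[symmetric])
  ultimately show ?thesis
    unfolding colored_borel_tree_semilattice_def transport_tree_def
    using ts m l(1,2) by (auto simp: space_embed_measure in_sets_embed_measure)
qed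

end

section \<open>Injecting coloured sequences into the reals\<close>

text \<open>Expansions with digits \<open>0\<close> and \<open>1\<close> in base three: the tail
  after place \<open>n\<close> is at most half of \<open>(1/3)^n\<close>, so the first difference
  decides. In base two such expansions would not be unique.\<close>

lemma inj_nat_set_real: "\<exists>g :: nat set \<Rightarrow> real. inj g"
proof -
  define g :: "nat set \<Rightarrow> real" where "g S = (\<Sum>n. of_bool (n \<in> S) * (1/3) ^ n)" for S
  have summ: "summable (\<lambda>n. of_bool (n \<in> S) * (1/3 :: real) ^ n)" for S
    by (rule summable_comparison_test'[of "\<lambda>n. (1/3 :: real) ^ n" 0]) (auto intro: summable_geometric)
  have sep: "g S' < g S" if n: "n \<in> S" "n \<notin> S'" "\<And>k. k < n \<Longrightarrow> k \<in> S \<longleftrightarrow> k \<in> S'" for S S' n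
  proof -
    let ?a = "\<lambda>S k. of_bool (k \<in> S) * (1/3 :: real) ^ k"
    have split: "g S = (\<Sum>k. ?a S (k + Suc n)) + (\<Sum>k<Suc n. ?a S k)" for S
      unfolding g_def using suminf_split_initial_segment[OF summ] by blast
    have "(\<Sum>k. ?a S' (k + Suc n)) \<le> (\<Sum>k. (1/3) ^ k * (1/3) ^ Suc n)"
    proof (rule suminf_le)
      show "summable (\<lambda>k. ?a S' (k + Suc n))" by (rule summable_ignore_initial_segment[OF summ])
      show "summable (\<lambda>k. (1/3 :: real) ^ k * (1/3) ^ Suc n)" by (intro summable_mult2 summable_geometric) simp
    qed (auto simp: power_add)
    also have "\<dots> = (3/2) * (1/3) ^ Suc n"
      using suminf_mult2[OF summable_geometric[of "1/3 :: real"], of "(1/3) ^ Suc n"] suminf_geometric[of "1/3 :: real"] by simp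
    also have "\<dots> < (1/3) ^ n" by simp
    finally have 1: "(\<Sum>k. ?a S' (k + Suc n)) < (1/3) ^ n" .
    have 2: "0 \<le> (\<Sum>k. ?a S (k + Suc n))" by (rule suminf_nonneg[OF summable_ignore_initial_segment[OF summ]]) simp
    have 3: "(\<Sum>k<n. ?a S k) = (\<Sum>k<n. ?a S' k)" using n(3) by (intro sum.cong) auto
    show ?thesis unfolding split using 1 2 3 n(1,2) by simp
  qed
  have "S = S'" if "g S = g S'" for S S'
  proof (rule ccontr)
    assume "S \<noteq> S'"
    then have ex: "\<exists>n. (n \<in> S) \<noteq> (n \<in> S')" by auto
    then obtain n where n: "(n \<in> S) \<noteq> (n \<in> S')" "\<forall>k<n. k \<in> S \<longleftrightarrow> k \<in> S'"
      using exists_least_iff[of "\<lambda>n. (n \<in> S) \<noteq> (n \<in> S')"] by blast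
    show False
    proof (cases "n \<in> S")
      case True
      then have "g S' < g S" using n by (intro sep[of n]) blast+
      then show ?thesis using that by simp
    next
      case False
      then have "g S < g S'" using n by (intro sep[of n]) blast+
      then show ?thesis using that by simp
    qed
  qed
  then show ?thesis by (auto simp: inj_def)
qed

text \<open>A sequence is determined by the rational lower cuts of its coordinates, which together
  form a subset of a countable set.\<close>

lemma inj_seq_real: "\<exists>h :: (nat \<Rightarrow> real) \<times> real \<Rightarrow> real. inj h"
proof -
  obtain g :: "nat set \<Rightarrow> real" where g: "inj g" using inj_nat_set_real by blast
  define c :: "(nat \<Rightarrow> real) \<times> real \<Rightarrow> nat \<Rightarrow> real" where "c p i = (case i of 0 \<Rightarrow> snd p | Suc j \<Rightarrow> fst p j)" for p i
  define S :: "(nat \<Rightarrow> real) \<times> real \<Rightarrow> (nat \<times> rat) set" where "S p = {(i, q). of_rat q < c p i}" for p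
  have "p = p'" if "S p = S p'" for p p'
  proof -
    have "c p i = c p' i" for i
    proof (rule ccontr)
      assume "c p i \<noteq> c p' i"
      then have "min (c p i) (c p' i) < max (c p i) (c p' i)" by auto
      from of_rat_dense[OF this] obtain q where "min (c p i) (c p' i) < of_rat q" "of_rat q < max (c p i) (c p' i)" by blast
      then have "((i, q) \<in> S p) \<noteq> ((i, q) \<in> S p')" by (auto simp: S_def min_def max_def split: if_splits)
      then show False using that by simp
    qed
    note this[of 0] this[of "Suc _"]
    then show ?thesis by (auto simp: c_def prod_eq_iff)
  qed
  then have "inj (\<lambda>p. g (to_nat ` S p))"
    using g by (intro injI) (metis injD inj_image_eq_iff inj_to_nat)
  then show ?thesis by blast
qed

subsection \<open>Digits of leaves and approximate adjacency\<close>

text \<open>Layout of the digits: place \<open>0\<close> holds the colour, the later places are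
  indexed by pairs whose first component is the level; second component \<open>0\<close> is the
  label, \<open>Suc s\<close> the position cut to \<open>s\<close> binary places.\<close>

definition lab_digit :: "(nat \<Rightarrow> nat) \<Rightarrow> nat \<Rightarrow> nat" where
  "lab_digit \<delta> k = \<delta> (Suc (prod_encode (k, 0)))"

definition cut_digit :: "(nat \<Rightarrow> nat) \<Rightarrow> nat \<Rightarrow> nat \<Rightarrow> nat" where
  "cut_digit \<delta> k s = \<delta> (Suc (prod_encode (k, Suc s)))"

text \<open>Positions are divided by the number of leaves, so trees of different sizes share one
  scale. Levels after the last left turn get the zero map as label.\<close>

definition leaf_digit :: "nat \<Rightarrow> (nat \<times> nat \<Rightarrow> nat, 'v) ltree \<Rightarrow> ('v \<Rightarrow> nat) \<Rightarrow> nat \<Rightarrow> 'v \<Rightarrow> nat" where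
  "leaf_digit m t c j x = (case j of 0 \<Rightarrow> c x | Suc i \<Rightarrow>
     (case prod_decode i of (k, 0) \<Rightarrow> label_index m (code_lab (\<lambda>z\<in>{1..m} \<times> {1..m}. 0) t x k)
        | (k, Suc s) \<Rightarrow> (2 ^ s * code_pos t 0 x k) div card (leaves t)))"

definition digit_bound :: "nat \<Rightarrow> nat \<Rightarrow> nat" where
  "digit_bound m j = (case j of 0 \<Rightarrow> Suc m | Suc i \<Rightarrow>
     (case prod_decode i of (k, 0) \<Rightarrow> card (sym_maps m) | (k, Suc s) \<Rightarrow> 2 ^ s))"

text \<open>\<open>key_less\<close> at precision \<open>2^-s\<close>: labels break the tie only when
  neither position is clearly smaller.\<close>

definition digit_less :: "nat \<Rightarrow> nat \<Rightarrow> (nat \<Rightarrow> nat) \<Rightarrow> (nat \<Rightarrow> nat) \<Rightarrow> bool" where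
  "digit_less s k \<delta> \<epsilon> \<longleftrightarrow> cut_digit \<delta> k s + 1 < cut_digit \<epsilon> k s
     \<or> \<not> cut_digit \<epsilon> k s + 1 < cut_digit \<delta> k s \<and> lab_digit \<delta> k < lab_digit \<epsilon> k"

definition label_val :: "nat \<Rightarrow> nat \<Rightarrow> nat \<Rightarrow> nat \<Rightarrow> bool" where
  "label_val m l i j \<longleftrightarrow> i \<in> {1..m} \<and> j \<in> {1..m} \<and> (\<exists>f\<in>sym_maps m. label_index m f = l \<and> f (i, j) = 1)"

text \<open>Adjacency as read from finitely many digits: the first level at which the two codes are
  distinguishable plays the role of the first difference.\<close>

definition approx_adj :: "nat \<Rightarrow> nat \<Rightarrow> (nat \<Rightarrow> nat) \<Rightarrow> (nat \<Rightarrow> nat) \<Rightarrow> bool" where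
  "approx_adj m s \<delta> \<epsilon> \<longleftrightarrow> (\<exists>k\<le>s. (\<forall>j<k. \<not> digit_less s j \<delta> \<epsilon> \<and> \<not> digit_less s j \<epsilon> \<delta>)
     \<and> (digit_less s k \<delta> \<epsilon> \<and> label_val m (lab_digit \<delta> k) (\<delta> 0) (\<epsilon> 0)
       \<or> digit_less s k \<epsilon> \<delta> \<and> label_val m (lab_digit \<epsilon> k) (\<delta> 0) (\<epsilon> 0)))"

definition digits_near :: "nat \<Rightarrow> (nat \<Rightarrow> nat) \<Rightarrow> (nat \<Rightarrow> nat) \<Rightarrow> bool" where
  "digits_near s \<delta> \<epsilon> \<longleftrightarrow> (\<forall>k\<le>s. \<not> digit_less s k \<delta> \<epsilon> \<and> \<not> digit_less s k \<epsilon> \<delta>)"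

text \<open>The number of initial digits that stage \<open>s\<close> may read. It makes the stage
  \<open>s\<close> predicates events of the kind for which convergence is known.\<close>

definition stage_bound :: "nat \<Rightarrow> nat" where
  "stage_bound s = Suc (Suc (Max (prod_encode ` ({..s} \<times> {..Suc s}))))"

lemma less_stage_bound: "k \<le> s \<Longrightarrow> i \<le> Suc s \<Longrightarrow> Suc (prod_encode (k, i)) < stage_bound s"
proof -
  assume "k \<le> s" "i \<le> Suc s"
  then have "prod_encode (k, i) \<le> Max (prod_encode ` ({..s} \<times> {..Suc s}))" by (intro Max_ge) auto
  then show ?thesis by (simp add: stage_bound_def)
qed

lemma digit_less_restrict:
  "k \<le> s \<Longrightarrow> digit_less s k (\<lambda>j\<in>{..<stage_bound s}. \<delta> j) (\<lambda>j\<in>{..<stage_bound s}. \<epsilon> j) = digit_less s k \<delta> \<epsilon>"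
  by (simp add: digit_less_def cut_digit_def lab_digit_def less_stage_bound)

lemma lab_digit_restrict: "k \<le> s \<Longrightarrow> lab_digit (\<lambda>j\<in>{..<stage_bound s}. \<delta> j) k = lab_digit \<delta> k"
  by (simp add: lab_digit_def less_stage_bound)

lemma approx_adj_restrict:
  "approx_adj m s (\<lambda>j\<in>{..<stage_bound s}. \<delta> j) (\<lambda>j\<in>{..<stage_bound s}. \<epsilon> j) = approx_adj m s \<delta> \<epsilon>"
proof -
  have z: "(\<lambda>j\<in>{..<stage_bound s}. \<delta> j) 0 = \<delta> 0" for \<delta> :: "nat \<Rightarrow> nat" by (simp add: stage_bound_def)
  show ?thesis unfolding approx_adj_def z
    by (intro ex_cong1 conj_cong refl all_cong imp_cong)
       (simp_all add: digit_less_restrict lab_digit_restrict)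
qed

lemma digits_near_restrict:
  "digits_near s (\<lambda>j\<in>{..<stage_bound s}. \<delta> j) (\<lambda>j\<in>{..<stage_bound s}. \<epsilon> j) = digits_near s \<delta> \<epsilon>"
  unfolding digits_near_def by (simp add: digit_less_restrict cong: imp_cong)

context
  fixes m :: nat and t :: "(nat \<times> nat \<Rightarrow> nat, 'v) ltree" and c :: "'v \<Rightarrow> nat"
  assumes t: "distinct_leaves t" "left_light t" "labs t \<subseteq> sym_maps m"
    and c: "\<forall>x\<in>leaves t. c x \<in> {1..m}"
begin

lemma color_range: "x \<in> leaves t \<Longrightarrow> c x \<in> {1..m}"
  using c by blast

definition leaf_adj :: "'v \<Rightarrow> 'v \<Rightarrow> bool" where
  "leaf_adj x y \<longleftrightarrow> x \<noteq> y \<and> lca_lab t x y (c x, c y) = 1"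

abbreviation "dig x \<equiv> (\<lambda>j. leaf_digit m t c j x)"

abbreviation "nl \<equiv> card (leaves t)"

lemma code_pos_less: "x \<in> leaves t \<Longrightarrow> code_pos t 0 x k < nl"
  using code_pos_bounds[OF t(1), of x 0 k] leaf_pos_bounds[OF t(1), of x 0] by simp

lemma cut_dig: "cut_digit (dig x) k s = (2 ^ s * code_pos t 0 x k) div nl"
  by (simp add: cut_digit_def leaf_digit_def)

lemma lab_dig: "lab_digit (dig x) k = label_index m (code_lab (\<lambda>z\<in>{1..m} \<times> {1..m}. 0) t x k)"
  by (simp add: lab_digit_def leaf_digit_def)

lemma code_lab_sym_maps:
  assumes "x \<in> leaves t"
  shows "code_lab (\<lambda>z\<in>{1..m} \<times> {1..m}. 0) t x k \<in> sym_maps m"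
proof -
  have 0: "(\<lambda>z\<in>{1..m} \<times> {1..m}. 0) \<in> sym_maps m" by (auto simp: sym_maps_def binary_maps_def)
  show ?thesis using code_lab_in[OF assms, of "\<lambda>z\<in>{1..m} \<times> {1..m}. 0" k] t(3) 0 by (auto simp del: restrict_apply)
qed

lemma leaf_digit_bound: "x \<in> leaves t \<Longrightarrow> leaf_digit m t c j x < digit_bound m j"
proof (cases j)
  case 0 then show "x \<in> leaves t \<Longrightarrow> ?thesis" using color_range[of x] by (auto simp: leaf_digit_def digit_bound_def)
next
  case (Suc i)
  assume x: "x \<in> leaves t"
  obtain k i' where p: "prod_decode i = (k, i')" by force
  show ?thesis
  proof (cases i')
    case 0
    then show ?thesis using Suc p label_index(2)[OF code_lab_sym_maps[OF x]] by (simp add: leaf_digit_def digit_bound_def)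
  next
    case (Suc s)
    have "2 ^ s * code_pos t 0 x k < 2 ^ s * nl" using code_pos_less[OF x] by simp
    then have "(2 ^ s * code_pos t 0 x k) div nl < 2 ^ s" by (simp add: less_mult_imp_div_less)
    then show ?thesis using Suc \<open>j = Suc i\<close> p by (simp add: leaf_digit_def digit_bound_def)
  qed
qed

text \<open>Outside \<open>error_set s\<close> the digits up to stage \<open>s\<close> determine adjacency. A difference of two units
  between cut digits is required because a digit of the limit may be off by one when the position
  hits a multiple of \<open>2\<^sup>-\<^sup>s\<close>.\<close>

definition undetected :: "nat \<Rightarrow> nat \<Rightarrow> ('v \<times> 'v) set" where
  "undetected s k = {(x, y). x \<in> leaves t \<and> y \<in> leaves t \<and> leaf_pos t 0 x < code_pos t 0 y k
     \<and> 2 ^ s * code_pos t 0 y k < 2 ^ s * leaf_pos t 0 x + 2 * nl}"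

definition error_set :: "nat \<Rightarrow> ('v \<times> 'v) set" where
  "error_set s = {(x, y). x \<in> leaves t \<and> y \<in> leaves t \<and> (\<forall>j\<le>s. code_pos t 0 y j = code_pos t 0 x j)}
     \<union> (\<Union>k\<le>s. undetected s k \<union> (undetected s k)\<inverse>)"

text \<open>The block of \<open>x\<close> begins at or before \<open>x\<close>, so a gap of
  \<open>2 * nl\<close> on the enlarged scale persists, and the two quotients differ by at least
  two.\<close>

lemma detected:
  assumes "x \<in> leaves t" "y \<in> leaves t" "leaf_pos t 0 x < code_pos t 0 y k" "(x, y) \<notin> undetected s k"
  shows "cut_digit (dig x) k s + 1 < cut_digit (dig y) k s"
proof -
  have "2 ^ s * code_pos t 0 x k + 2 * nl \<le> 2 ^ s * leaf_pos t 0 x + 2 * nl"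
    using code_pos_bounds[OF t(1) assms(1), of 0 k] by simp
  also have "\<dots> \<le> 2 ^ s * code_pos t 0 y k" using assms by (simp add: undetected_def)
  finally have "(2 ^ s * code_pos t 0 x k + 2 * nl) div nl \<le> (2 ^ s * code_pos t 0 y k) div nl"
    by (rule div_le_mono)
  then show ?thesis using card_leaves_pos[of t] by (simp add: cut_dig)
qed

text \<open>Below the level \<open>k\<close> separating the codes all digits coincide. At
  \<open>k\<close> the gap is detected in the right direction, so the label found is that of the
  true meet.\<close>

lemma approx_adj_leaf:
  assumes x: "x \<in> leaves t" and y: "y \<in> leaves t" and ne: "(x, y) \<notin> error_set s"
  shows "approx_adj m s (dig x) (dig y) \<longleftrightarrow> leaf_adj x y" "\<not> digits_near s (dig x) (dig y)"
proof -
  let ?d = "\<lambda>z\<in>{1..m} \<times> {1..m}. 0 :: nat"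
  have xy: "x \<noteq> y" using ne x by (auto simp: error_set_def)
  obtain k where k: "\<forall>j<k. code_pos t 0 x j = code_pos t 0 y j \<and> code_lab ?d t x j = code_lab ?d t y j"
    and sep: "leaf_pos t 0 x < code_pos t 0 y k \<and> lca_lab t x y = code_lab ?d t x k
      \<or> leaf_pos t 0 y < code_pos t 0 x k \<and> lca_lab t x y = code_lab ?d t y k"
    using code_separates[OF t(1) x y xy, of 0 ?d] by blast
  \<comment> \<open>Otherwise all block positions up to level \<open>s\<close> agree and the pair
    belongs to the first component of \<open>error_set\<close>.\<close>
  have ks: "k \<le> s"
  proof (rule ccontr)
    assume "\<not> k \<le> s"
    then have "\<forall>j\<le>s. code_pos t 0 y j = code_pos t 0 x j" using k by simp
    then show False using ne x y unfolding error_set_def by blast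
  qed
  have eq: "\<not> digit_less s j (dig x) (dig y) \<and> \<not> digit_less s j (dig y) (dig x)" if "j < k" for j
    using k that by (simp add: digit_less_def cut_dig lab_dig)
  have uniq: "approx_adj m s \<delta> \<epsilon> \<longleftrightarrow> (digit_less s k \<delta> \<epsilon> \<and> label_val m (lab_digit \<delta> k) (\<delta> 0) (\<epsilon> 0)
       \<or> digit_less s k \<epsilon> \<delta> \<and> label_val m (lab_digit \<epsilon> k) (\<delta> 0) (\<epsilon> 0))"
    if "\<delta> = dig x" "\<epsilon> = dig y" "digit_less s k \<delta> \<epsilon> \<or> digit_less s k \<epsilon> \<delta>" for \<delta> \<epsilon>
    unfolding approx_adj_def using eq that ks by (metis linorder_neqE_nat)
  have val: "label_val m (label_index m f) (c x) (c y) \<longleftrightarrow> f (c x, c y) = 1" if "f \<in> sym_maps m" for f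
    using that color_range[OF x] color_range[OF y] inj_onD[OF label_index(1)] by (fastforce simp: label_val_def)
  have d0: "dig z 0 = c z" for z by (simp add: leaf_digit_def)
  have nu: "(x, y) \<notin> undetected s k" "(y, x) \<notin> undetected s k" using ne ks unfolding error_set_def by blast+
  have "(approx_adj m s (dig x) (dig y) \<longleftrightarrow> leaf_adj x y) \<and> \<not> digits_near s (dig x) (dig y)"
    using sep
  proof
    assume *: "leaf_pos t 0 x < code_pos t 0 y k \<and> lca_lab t x y = code_lab ?d t x k"
    then have "cut_digit (dig x) k s + 1 < cut_digit (dig y) k s" using detected x y nu by blast
    then have "digit_less s k (dig x) (dig y)" "\<not> digit_less s k (dig y) (dig x)" by (auto simp: digit_less_def)
    then show ?thesis
      using uniq[OF refl refl] ks * xy val[OF code_lab_sym_maps[OF x]]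
      by (auto simp: digits_near_def lab_dig d0 leaf_adj_def)
  next
    assume *: "leaf_pos t 0 y < code_pos t 0 x k \<and> lca_lab t x y = code_lab ?d t y k"
    then have "cut_digit (dig y) k s + 1 < cut_digit (dig x) k s" using detected x y nu by blast
    then have "digit_less s k (dig y) (dig x)" "\<not> digit_less s k (dig x) (dig y)" by (auto simp: digit_less_def)
    then show ?thesis
      using uniq[OF refl refl] ks * xy val[OF code_lab_sym_maps[OF y]]
      by (auto simp: digits_near_def lab_dig d0 leaf_adj_def)
  qed
  then show "approx_adj m s (dig x) (dig y) \<longleftrightarrow> leaf_adj x y" "\<not> digits_near s (dig x) (dig y)" by blast+
qed

text \<open>For fixed \<open>y\<close> the distances from the block of \<open>y\<close> down to the
  undetected positions are distinct integers between \<open>1\<close> and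
  \<open>2 * nl / 2^s\<close>.\<close>

lemma card_undetected: "2 ^ s * card (undetected s k) \<le> 2 * nl\<^sup>2"
proof -
  let ?F = "\<lambda>y. {x \<in> leaves t. leaf_pos t 0 x < code_pos t 0 y k \<and> 2 ^ s * code_pos t 0 y k < 2 ^ s * leaf_pos t 0 x + 2 * nl}"
  have F: "2 ^ s * card (?F y) \<le> 2 * nl" for y
  proof -
    let ?q = "code_pos t 0 y k"
    have "card (?F y) = card ((\<lambda>x. ?q - leaf_pos t 0 x) ` ?F y)"
    proof (rule card_image[symmetric], rule inj_onI)
      fix x x' assume *: "x \<in> ?F y" "x' \<in> ?F y" "?q - leaf_pos t 0 x = ?q - leaf_pos t 0 x'"
      then have "leaf_pos t 0 x = leaf_pos t 0 x'" by auto
      then show "x = x'" using * inj_onD[OF leaf_pos_inj[OF t(1)]] by blast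
    qed
    also have "\<dots> \<le> card {1..2 * nl div 2 ^ s}"
    proof (rule card_mono)
      show "(\<lambda>x. ?q - leaf_pos t 0 x) ` ?F y \<subseteq> {1..2 * nl div 2 ^ s}"
      proof
        fix d assume "d \<in> (\<lambda>x. ?q - leaf_pos t 0 x) ` ?F y"
        then obtain x where x: "d = ?q - leaf_pos t 0 x" "leaf_pos t 0 x < ?q" "2 ^ s * ?q < 2 ^ s * leaf_pos t 0 x + 2 * nl" by auto
        then have "2 ^ s * leaf_pos t 0 x \<le> 2 ^ s * ?q" by simp
        then have "2 ^ s * d < 2 * nl" using x unfolding x(1) diff_mult_distrib2 by linarith
        then have "d \<le> 2 * nl div 2 ^ s" by (simp add: less_eq_div_iff_mult_less_eq mult.commute)
        then show "d \<in> {1..2 * nl div 2 ^ s}" using x by simp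
      qed
    qed simp
    finally have "2 ^ s * card (?F y) \<le> 2 ^ s * (2 * nl div 2 ^ s)" by simp
    also have "\<dots> \<le> 2 * nl" by simp
    finally show ?thesis .
  qed
  have "undetected s k = (\<Union>y\<in>leaves t. (\<lambda>x. (x, y)) ` ?F y)" by (auto simp: undetected_def)
  then have "card (undetected s k) \<le> (\<Sum>y\<in>leaves t. card ((\<lambda>x. (x, y)) ` ?F y))"
    by (simp only:) (rule card_UN_le, simp)
  also have "\<dots> \<le> (\<Sum>y\<in>leaves t. card (?F y))" by (intro sum_mono card_image_le) auto
  finally have "2 ^ s * card (undetected s k) \<le> (\<Sum>y\<in>leaves t. 2 ^ s * card (?F y))"
    by (simp add: sum_distrib_left[symmetric])
  also have "\<dots> \<le> (\<Sum>y\<in>leaves t. 2 * nl)" using F by (intro sum_mono) auto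
  finally show ?thesis by (simp add: power2_eq_square)
qed

text \<open>Equal blocks up to level \<open>s\<close> contribute \<open>1 / nl + 1 / 2^s\<close>.
  Each of the \<open>s + 1\<close> levels contributes \<open>4 / 2^s\<close>, namely
  \<open>2 / 2^s\<close> for either orientation; together
  \<open>4 * (s + 1) + 1 = 4 * s + 5\<close>.\<close>

lemma card_error_set:
  "real (card (error_set s)) / real nl ^ 2 \<le> 1 / real nl + (4 * real s + 5) / 2 ^ s"
proof -
  let ?A = "{(x, y). x \<in> leaves t \<and> y \<in> leaves t \<and> (\<forall>j\<le>s. code_pos t 0 y j = code_pos t 0 x j)}"
  let ?C = "\<lambda>x. {y \<in> leaves t. \<forall>j\<le>s. code_pos t 0 y j = code_pos t 0 x j}"
  have n: "real nl > 0" using card_leaves_pos[of t] by simp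
  have C: "real (card (?C x)) \<le> 1 + real nl / 2 ^ s" if "x \<in> leaves t" for x
  proof -
    have "2 ^ Suc s * card (?C x) \<le> max (2 ^ Suc s) nl" by (rule code_class_card[OF t(1,2) that])
    then have "real (2 ^ Suc s * card (?C x)) \<le> real (2 ^ Suc s + nl)" by linarith
    then have "real (card (?C x)) \<le> 1 + real nl / 2 ^ Suc s" by (simp add: field_simps)
    also have "\<dots> \<le> 1 + real nl / 2 ^ s" by (simp add: field_simps)
    finally show ?thesis .
  qed
  have "?A = (SIGMA x:leaves t. ?C x)" by auto
  then have "real (card ?A) = (\<Sum>x\<in>leaves t. real (card (?C x)))" by simp
  also have "\<dots> \<le> (\<Sum>x\<in>leaves t. 1 + real nl / 2 ^ s)" using C by (rule sum_mono)
  finally have A: "real (card ?A) \<le> real nl * (1 + real nl / 2 ^ s)" by simp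
  have fin: "finite (undetected s k)" for k
    by (rule finite_subset[of _ "leaves t \<times> leaves t"]) (auto simp: undetected_def)
  have U: "real (card (undetected s k \<union> (undetected s k)\<inverse>)) \<le> 4 * real nl ^ 2 / 2 ^ s" for k
  proof -
    have "card (undetected s k \<union> (undetected s k)\<inverse>) \<le> 2 * card (undetected s k)"
      using card_Un_le[of "undetected s k" "(undetected s k)\<inverse>"] by simp
    then have "2 ^ s * card (undetected s k \<union> (undetected s k)\<inverse>) \<le> 2 ^ s * (2 * card (undetected s k))"
      by (rule mult_le_mono2)
    also have "\<dots> \<le> 4 * nl\<^sup>2" using card_undetected[of s k] by (simp add: mult_ac)
    finally have "real (2 ^ s * card (undetected s k \<union> (undetected s k)\<inverse>)) \<le> real (4 * nl\<^sup>2)" by (simp only: of_nat_le_iff)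
    then show ?thesis by (simp add: field_simps)
  qed
  have "card (error_set s) \<le> card ?A + (\<Sum>k\<le>s. card (undetected s k \<union> (undetected s k)\<inverse>))"
    unfolding error_set_def by (rule order_trans[OF card_Un_le]) (intro add_mono card_UN_le order_refl, simp)
  then have "real (card (error_set s)) \<le> real (card ?A) + (\<Sum>k\<le>s. real (card (undetected s k \<union> (undetected s k)\<inverse>)))"
    unfolding of_nat_sum[symmetric] of_nat_add[symmetric] of_nat_le_iff .
  also have "\<dots> \<le> real nl * (1 + real nl / 2 ^ s) + (\<Sum>k\<le>s. 4 * real nl ^ 2 / 2 ^ s)"
    using A U by (intro add_mono sum_mono) auto
  also have "\<dots> = real nl ^ 2 * (1 / real nl + (4 * real s + 5) / 2 ^ s)"
    using n by (simp add: field_simps power2_eq_square)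
  finally show ?thesis using n by (simp add: divide_le_eq mult.commute)
qed

end

subsection \<open>Limit points of digit sequences\<close>

text \<open>The dyadic intervals named by the cut digits of one level overlap pairwise. Each
  instance concerns two digits and holds for every leaf, so it survives in the limit, unlike the
  exact rounding of a position.\<close>

definition consistent :: "(nat \<Rightarrow> nat) \<Rightarrow> bool" where
  "consistent \<delta> \<longleftrightarrow> (\<forall>k. cut_digit \<delta> k 0 = 0)
     \<and> (\<forall>k s s'. cut_digit \<delta> k s * 2 ^ s' < (cut_digit \<delta> k s' + 1) * 2 ^ s)"

definition cut_point :: "(nat \<Rightarrow> nat) \<Rightarrow> nat \<Rightarrow> real" where
  "cut_point \<delta> k = (SUP s. real (cut_digit \<delta> k s) / 2 ^ s)"

text \<open>Limit positions fill the closed unit interval. Squeezing them into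
  \<open>[1/3, 2/3]\<close> keeps the label as the integer part and keeps the entry away from the
  end marker \<open>0\<close>.\<close>

definition seq_point :: "(nat \<Rightarrow> nat) \<Rightarrow> nat \<Rightarrow> real" where
  "seq_point \<delta> k = real (lab_digit \<delta> k) + (1 + cut_point \<delta> k) / 3"

text \<open>Every lower dyadic end is below every upper one. The upper bound is not strict: a limit
  position may sit at the right end of its dyadic interval.\<close>

lemma cut_point_bounds:
  assumes "consistent \<delta>"
  shows "real (cut_digit \<delta> k s) / 2 ^ s \<le> cut_point \<delta> k"
    "cut_point \<delta> k \<le> (real (cut_digit \<delta> k s) + 1) / 2 ^ s"
    "0 \<le> cut_point \<delta> k" "cut_point \<delta> k \<le> 1"
proof -
  have le: "real (cut_digit \<delta> k s) / 2 ^ s \<le> (real (cut_digit \<delta> k s') + 1) / 2 ^ s'" for s s'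
  proof -
    have "cut_digit \<delta> k s * 2 ^ s' < (cut_digit \<delta> k s' + 1) * 2 ^ s"
      using assms by (simp add: consistent_def)
    then have "real (cut_digit \<delta> k s * 2 ^ s') < real ((cut_digit \<delta> k s' + 1) * 2 ^ s)"
      by (simp only: of_nat_less_iff)
    then show ?thesis by (simp add: field_simps)
  qed
  have bdd: "bdd_above (range (\<lambda>s. real (cut_digit \<delta> k s) / 2 ^ s))"
    using le[of _ 0] by (intro bdd_aboveI2)
  show lower: "real (cut_digit \<delta> k s) / 2 ^ s \<le> cut_point \<delta> k" for s
    unfolding cut_point_def by (rule cSUP_upper[OF UNIV_I bdd])
  show upper: "cut_point \<delta> k \<le> (real (cut_digit \<delta> k s) + 1) / 2 ^ s" for s
    unfolding cut_point_def by (rule cSUP_least) (use le in auto)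
  have "cut_digit \<delta> k 0 = 0" using assms by (simp add: consistent_def)
  then show "0 \<le> cut_point \<delta> k" "cut_point \<delta> k \<le> 1" using lower[of 0] upper[of 0] by auto
qed

lemma seq_point_key:
  assumes "consistent \<delta>"
  shows "\<lfloor>seq_point \<delta> k\<rfloor> = int (lab_digit \<delta> k)" "frac (seq_point \<delta> k) = (1 + cut_point \<delta> k) / 3" "seq_point \<delta> k \<noteq> 0"
proof -
  note b = cut_point_bounds(3,4)[OF assms, of k]
  show f: "\<lfloor>seq_point \<delta> k\<rfloor> = int (lab_digit \<delta> k)"
    using b by (intro floor_unique) (auto simp: seq_point_def)
  show "frac (seq_point \<delta> k) = (1 + cut_point \<delta> k) / 3" unfolding frac_def f by (simp add: seq_point_def)
  show "seq_point \<delta> k \<noteq> 0" using b unfolding seq_point_def by (smt (verit) divide_pos_pos of_nat_0_le_iff)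
qed

lemma key_less_seq_point:
  assumes "consistent \<delta>" "consistent \<epsilon>"
  shows "key_less (seq_point \<delta> k) (seq_point \<epsilon> k) \<longleftrightarrow>
    cut_point \<delta> k < cut_point \<epsilon> k \<or> cut_point \<delta> k = cut_point \<epsilon> k \<and> lab_digit \<delta> k < lab_digit \<epsilon> k"
  unfolding key_less_def seq_point_key(2)[OF assms(1)] seq_point_key(2)[OF assms(2)]
  using seq_point_key(3)[OF assms(1), of k] seq_point_key(3)[OF assms(2), of k]
  by (auto simp: seq_point_def)

text \<open>The gap of two units makes the middle inequality strict, compensating for the weak upper
  bound on \<open>cut_point\<close>.\<close>

lemma cut_digit_less_imp:
  assumes "consistent \<delta>" "consistent \<epsilon>" "cut_digit \<delta> k s + 1 < cut_digit \<epsilon> k s"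
  shows "cut_point \<delta> k < cut_point \<epsilon> k"
proof -
  have "cut_point \<delta> k \<le> (real (cut_digit \<delta> k s) + 1) / 2 ^ s" by (rule cut_point_bounds(2)[OF assms(1)])
  also have "\<dots> < real (cut_digit \<epsilon> k s) / 2 ^ s" using assms(3) by (intro divide_strict_right_mono) auto
  also have "\<dots> \<le> cut_point \<epsilon> k" by (rule cut_point_bounds(1)[OF assms(2)])
  finally show ?thesis .
qed

lemma eventually_cut_digit_less:
  assumes "consistent \<delta>" "consistent \<epsilon>" "cut_point \<delta> k < cut_point \<epsilon> k"
  shows "\<forall>\<^sub>F s in sequentially. cut_digit \<delta> k s + 1 < cut_digit \<epsilon> k s"
proof -
  have lim: "(\<lambda>s. 2 * (1 / 2) ^ s) \<longlonglongrightarrow> 2 * (0 :: real)" by (intro tendsto_intros) simp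
  have "\<forall>\<^sub>F s in sequentially. 2 * (1 / 2) ^ s < cut_point \<epsilon> k - cut_point \<delta> k"
    by (rule order_tendstoD(2)[OF lim]) (use assms(3) in simp)
  then show ?thesis
  proof eventually_elim
    case (elim s)
    have "real (cut_digit \<delta> k s) / 2 ^ s + 2 / 2 ^ s < (real (cut_digit \<epsilon> k s) + 1) / 2 ^ s"
      using elim[unfolded power_one_over times_divide_eq_right mult_1_right]
        cut_point_bounds(1)[OF assms(1), of k s] cut_point_bounds(2)[OF assms(2), of k s]
      by linarith
    then have "real (cut_digit \<delta> k s) + 2 < real (cut_digit \<epsilon> k s) + 1"
      unfolding add_divide_distrib[symmetric] by (simp add: divide_less_cancel)
    then show ?case by linarith
  qed
qed

text \<open>Different positions are told apart at sufficient precision. Equal positions are never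
  told apart, so the labels decide at every stage.\<close>

lemma eventually_digit_less:
  assumes "consistent \<delta>" "consistent \<epsilon>"
  shows "\<forall>\<^sub>F s in sequentially. digit_less s k \<delta> \<epsilon> \<longleftrightarrow> key_less (seq_point \<delta> k) (seq_point \<epsilon> k)"
proof -
  consider "cut_point \<delta> k < cut_point \<epsilon> k" | "cut_point \<epsilon> k < cut_point \<delta> k" | "cut_point \<delta> k = cut_point \<epsilon> k"
    by linarith
  then show ?thesis
  proof cases
    case 1
    show ?thesis using eventually_cut_digit_less[OF assms 1]
      by eventually_elim (use 1 key_less_seq_point[OF assms] in \<open>auto simp: digit_less_def\<close>)
  next
    case 2
    show ?thesis using eventually_cut_digit_less[OF assms(2,1) 2]
      by eventually_elim (use 2 key_less_seq_point[OF assms] in \<open>auto simp: digit_less_def\<close>)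
  next
    case 3
    have "\<not> cut_digit \<delta> k s + 1 < cut_digit \<epsilon> k s" "\<not> cut_digit \<epsilon> k s + 1 < cut_digit \<delta> k s" for s
      using cut_digit_less_imp[OF assms] cut_digit_less_imp[OF assms(2,1)] 3 by (metis less_irrefl)+
    then show ?thesis using 3 key_less_seq_point[OF assms] by (simp add: digit_less_def)
  qed
qed

text \<open>Used contrapositively: digits distinguishable at some stage yield different points of
  the limit tree.\<close>

lemma digits_near_of_eq:
  assumes "consistent \<delta>" "consistent \<epsilon>" "seq_point \<delta> = seq_point \<epsilon>"
  shows "digits_near s \<delta> \<epsilon>"
proof -
  have lab: "lab_digit \<delta> k = lab_digit \<epsilon> k" for k
    using seq_point_key(1)[OF assms(1), of k] seq_point_key(1)[OF assms(2), of k] assms(3) by simp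
  have "cut_point \<delta> k = cut_point \<epsilon> k" for k
    using seq_point_key(2)[OF assms(1), of k] seq_point_key(2)[OF assms(2), of k] assms(3) by simp
  then have "\<not> cut_digit \<delta> k s + 1 < cut_digit \<epsilon> k s" "\<not> cut_digit \<epsilon> k s + 1 < cut_digit \<delta> k s" for k
    using cut_digit_less_imp[OF assms(1,2)] cut_digit_less_imp[OF assms(2,1)] by (metis less_irrefl)+
  then show ?thesis using lab by (simp add: digits_near_def digit_less_def)
qed

lemma label_index_surj:
  assumes "l < card (sym_maps m)" obtains f where "f \<in> sym_maps m" "label_index m f = l"
proof -
  have "label_index m ` sym_maps m \<subseteq> {..<card (sym_maps m)}" using label_index(2) by auto
  moreover have "card (label_index m ` sym_maps m) = card {..<card (sym_maps m)}"
    using card_image[OF label_index(1)] by simp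
  ultimately have "label_index m ` sym_maps m = {..<card (sym_maps m)}" by (intro card_subset_eq) auto
  then show thesis using assms that by (metis imageE lessThan_iff)
qed

lemma label_val_commute: "label_val m l i j \<longleftrightarrow> label_val m l j i"
proof -
  have "label_val m l j i" if lv: "label_val m l i j" for i j
  proof -
    obtain f where f: "i \<in> {1..m}" "j \<in> {1..m}" "f \<in> sym_maps m" "label_index m f = l" "f (i, j) = 1"
      using lv unfolding label_val_def by blast
    then have "f (i, j) = f (j, i)" by (simp add: sym_maps_def)
    then show ?thesis using f unfolding label_val_def by (intro conjI bexI[of _ f]) simp_all
  qed
  then show ?thesis by blast
qed

lemma label_val_eq_adj:
  assumes \<delta>: "consistent \<delta>" and l: "lab_digit \<delta> k < card (sym_maps m)"
    and k: "\<forall>j<k. seq_point \<delta> j = y j" "key_less (seq_point \<delta> k) (y k)"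
  shows "label_val m (lab_digit \<delta> k) a b \<longleftrightarrow> interp_adj m (seq_tree m) (seq_point \<delta>, real a) (y, real b)"
proof (cases "a \<in> {1..m} \<and> b \<in> {1..m}")
  case True
  obtain f where f: "f \<in> sym_maps m" "label_index m f = lab_digit \<delta> k" using label_index_surj[OF l] by blast
  have "label_val m (lab_digit \<delta> k) a b \<longleftrightarrow> f (a, b) = 1"
    using True f inj_onD[OF label_index(1)] unfolding label_val_def by (metis (no_types, lifting))
  also have "\<dots> \<longleftrightarrow> interp_adj m (seq_tree m) (seq_point \<delta>, real a) (y, real b)"
    using True f seq_point_key[OF \<delta>] by (intro seq_tree_adj[symmetric, OF f(1) k]) auto
  finally show ?thesis .
next
  case False
  then have "\<not> interp_adj m (seq_tree m) (seq_point \<delta>, real a) (y, real b)"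
    by (auto simp: interp_adj_def seq_tree_def)
  then show ?thesis using False by (auto simp: label_val_def)
qed

text \<open>The levels up to the first difference \<open>k\<close> are finitely many, so from some
  stage on all their comparisons are correct, and the approximation then reads the label at level
  \<open>k\<close>.\<close>

lemma eventually_approx_adj:
  assumes c: "consistent \<delta>" "consistent \<epsilon>" and ne: "seq_point \<delta> \<noteq> seq_point \<epsilon>"
    and l: "\<And>k. lab_digit \<delta> k < card (sym_maps m)" "\<And>k. lab_digit \<epsilon> k < card (sym_maps m)"
  shows "\<forall>\<^sub>F s in sequentially. approx_adj m s \<delta> \<epsilon> \<longleftrightarrow>
    interp_adj m (seq_tree m) (seq_point \<delta>, real (\<delta> 0)) (seq_point \<epsilon>, real (\<epsilon> 0))"
proof -
  have "\<exists>i. seq_point \<delta> i \<noteq> seq_point \<epsilon> i" using ne by auto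
  then obtain k where k: "seq_point \<delta> k \<noteq> seq_point \<epsilon> k" "\<forall>j<k. seq_point \<delta> j = seq_point \<epsilon> j"
    using exists_least_iff[of "\<lambda>i. seq_point \<delta> i \<noteq> seq_point \<epsilon> i"] by blast
  have "\<forall>\<^sub>F s in sequentially. \<forall>j\<in>{..k}. (digit_less s j \<delta> \<epsilon> \<longleftrightarrow> key_less (seq_point \<delta> j) (seq_point \<epsilon> j))
     \<and> (digit_less s j \<epsilon> \<delta> \<longleftrightarrow> key_less (seq_point \<epsilon> j) (seq_point \<delta> j))"
    using eventually_digit_less[OF c] eventually_digit_less[OF c(2,1)]
    by (intro eventually_ball_finite ballI eventually_conj) auto
  then show ?thesis using eventually_ge_at_top[of k]
  proof eventually_elim
    case (elim s)
    have eq: "\<not> digit_less s j \<delta> \<epsilon> \<and> \<not> digit_less s j \<epsilon> \<delta>" if "j < k" for j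
      using elim(1) that k(2) by simp
    have at: "(digit_less s k \<delta> \<epsilon> \<longleftrightarrow> key_less (seq_point \<delta> k) (seq_point \<epsilon> k))"
     "(digit_less s k \<epsilon> \<delta> \<longleftrightarrow> key_less (seq_point \<epsilon> k) (seq_point \<delta> k))" using elim(1) by auto
    have lin: "key_less (seq_point \<delta> k) (seq_point \<epsilon> k) \<and> \<not> key_less (seq_point \<epsilon> k) (seq_point \<delta> k)
      \<or> key_less (seq_point \<epsilon> k) (seq_point \<delta> k) \<and> \<not> key_less (seq_point \<delta> k) (seq_point \<epsilon> k)"
      using k(1) key_less_linear key_less_trans key_less_irrefl by metis
    have uniq: "approx_adj m s \<delta> \<epsilon> \<longleftrightarrow> (digit_less s k \<delta> \<epsilon> \<and> label_val m (lab_digit \<delta> k) (\<delta> 0) (\<epsilon> 0)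
       \<or> digit_less s k \<epsilon> \<delta> \<and> label_val m (lab_digit \<epsilon> k) (\<delta> 0) (\<epsilon> 0))"
      unfolding approx_adj_def using eq at lin elim(2) by (metis linorder_neqE_nat)
    from lin show ?case
    proof
      assume *: "key_less (seq_point \<delta> k) (seq_point \<epsilon> k) \<and> \<not> key_less (seq_point \<epsilon> k) (seq_point \<delta> k)"
      then have "label_val m (lab_digit \<delta> k) (\<delta> 0) (\<epsilon> 0) \<longleftrightarrow>
         interp_adj m (seq_tree m) (seq_point \<delta>, real (\<delta> 0)) (seq_point \<epsilon>, real (\<epsilon> 0))"
        using k(2) by (intro label_val_eq_adj c l) auto
      then show ?thesis using uniq at * by blast
    next
      assume *: "key_less (seq_point \<epsilon> k) (seq_point \<delta> k) \<and> \<not> key_less (seq_point \<delta> k) (seq_point \<epsilon> k)"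
      then have "label_val m (lab_digit \<epsilon> k) (\<epsilon> 0) (\<delta> 0) \<longleftrightarrow>
         interp_adj m (seq_tree m) (seq_point \<epsilon>, real (\<epsilon> 0)) (seq_point \<delta>, real (\<delta> 0))"
        using k(2) by (intro label_val_eq_adj c l) auto
      then show ?thesis using uniq at * label_val_commute seq_tree_adj_sym by metis
    qed
  qed
qed

lemma consistent_leaf_digit:
  assumes "distinct_leaves t" "x \<in> leaves t"
  shows "consistent (\<lambda>j. leaf_digit m t c j x)"
proof -
  let ?n = "card (leaves t)"
  have n: "0 < ?n" by (rule card_leaves_pos)
  have cut: "cut_digit (\<lambda>j. leaf_digit m t c j x) k s = (2 ^ s * code_pos t 0 x k) div ?n" for k s
    by (simp add: cut_digit_def leaf_digit_def)
  have lt: "code_pos t 0 x k < ?n" for k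
    using code_pos_bounds[OF assms, of 0 k] leaf_pos_bounds[OF assms, of 0] by simp
  have "((2 ^ s * p) div ?n) * 2 ^ s' < ((2 ^ s' * p) div ?n + 1) * 2 ^ s" for p s s' :: nat
  proof -
    have "((2 ^ s * p) div ?n) * ?n \<le> 2 ^ s * p" by simp
    then have 1: "((2 ^ s * p) div ?n) * ?n * 2 ^ s' \<le> 2 ^ s * p * 2 ^ s'" by (rule mult_le_mono1)
    have 2: "2 ^ s * p * 2 ^ s' = 2 ^ s' * p * 2 ^ s" by (simp only: mult_ac)
    have "2 ^ s' * p < ((2 ^ s' * p) div ?n + 1) * ?n"
      using n by (metis Suc_eq_plus1 dividend_less_div_times mult.commute mult_Suc)
    then have "2 ^ s' * p * 2 ^ s < ((2 ^ s' * p) div ?n + 1) * ?n * 2 ^ s" by simp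
    with 1[unfolded 2] have "((2 ^ s * p) div ?n) * ?n * 2 ^ s' < ((2 ^ s' * p) div ?n + 1) * ?n * 2 ^ s"
      by (rule le_less_trans)
    then have "((2 ^ s * p) div ?n) * 2 ^ s' * ?n < ((2 ^ s' * p) div ?n + 1) * 2 ^ s * ?n"
      by (simp only: mult_ac)
    then show ?thesis by simp
  qed
  then show ?thesis using lt by (simp add: consistent_def cut)
qed

subsection \<open>Limits of sequences of labelled trees\<close>

lemma (in prob_space) measure_tendsto_0_AE:
  assumes "\<And>s. B s \<in> sets M" "AE x in M. \<forall>\<^sub>F s in sequentially. x \<notin> B s"
  shows "(\<lambda>s. measure M (B s)) \<longlonglongrightarrow> 0"
proof -
  have "(\<lambda>s. \<integral>x. indicator (B s) x \<partial>M) \<longlonglongrightarrow> (\<integral>x. 0 \<partial>M :: real)"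
  proof (rule integral_dominated_convergence[where w = "\<lambda>_. 1"])
    show "AE x in M. (\<lambda>s. indicator (B s) x :: real) \<longlonglongrightarrow> 0"
      using assms(2) by eventually_elim (auto intro!: tendsto_eventually elim: eventually_mono)
  qed (use assms(1) in auto)
  then show ?thesis using assms(1) by simp
qed

lemma (in prob_space) measure_ball_diff_le:
  assumes "finite D" "\<And>d. d \<in> D \<Longrightarrow> Measurable.pred M (p d)" "\<And>d. d \<in> D \<Longrightarrow> Measurable.pred M (q d)"
  shows "\<bar>measure M {x \<in> space M. \<forall>d\<in>D. p d x} - measure M {x \<in> space M. \<forall>d\<in>D. q d x}\<bar>
    \<le> (\<Sum>d\<in>D. measure M {x \<in> space M. p d x \<noteq> q d x})"
proof -
  let ?P = "{x \<in> space M. \<forall>d\<in>D. p d x}" and ?Q = "{x \<in> space M. \<forall>d\<in>D. q d x}"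
  let ?N = "\<lambda>d. {x \<in> space M. p d x \<noteq> q d x}"
  have P: "?P \<in> sets M" "?Q \<in> sets M"
    using assms by (auto simp: pred_def[symmetric] intro!: pred_intros_finite)
  have N: "?N d \<in> sets M" if "d \<in> D" for d
  proof -
    have [measurable]: "Measurable.pred M (p d)" "Measurable.pred M (q d)" using assms that by auto
    have "Measurable.pred M (\<lambda>x. p d x \<and> \<not> q d x \<or> q d x \<and> \<not> p d x)" by measurable
    moreover have "?N d = {x \<in> space M. p d x \<and> \<not> q d x \<or> q d x \<and> \<not> p d x}" by auto
    ultimately show ?thesis by (simp add: pred_def)
  qed
  have U: "(\<Union>d\<in>D. ?N d) \<in> sets M" using assms(1) N by auto
  have sum: "measure M (\<Union>d\<in>D. ?N d) \<le> (\<Sum>d\<in>D. measure M (?N d))"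
    using assms(1) N by (intro finite_measure_subadditive_finite) auto
  have "measure M A \<le> measure M B + measure M (\<Union>d\<in>D. ?N d)"
    if "A \<subseteq> B \<union> (\<Union>d\<in>D. ?N d)" "A \<in> sets M" "B \<in> sets M" for A B
    using that U by (intro order_trans[OF finite_measure_mono measure_Un_le]) auto
  from this[of ?P ?Q] this[of ?Q ?P] have "measure M ?P \<le> measure M ?Q + measure M (\<Union>d\<in>D. ?N d)"
    "measure M ?Q \<le> measure M ?P + measure M (\<Union>d\<in>D. ?N d)" using P by blast+
  then show ?thesis using sum by linarith
qed

lemma measure_pair_uniform:
  assumes "finite V" "V \<noteq> {}" "S \<subseteq> V \<times> V"
  shows "measure (uniform_count_measure V \<Otimes>\<^sub>M uniform_count_measure V) S = real (card S) / real (card V) ^ 2"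
proof -
  let ?U = "uniform_count_measure V" let ?W = "?U \<Otimes>\<^sub>M ?U"
  interpret U: prob_space ?U using assms by (intro prob_space_uniform)
  interpret W: pair_prob_space ?U ?U ..
  have sing: "measure ?W {z} = 1 / real (card V) ^ 2" if "z \<in> V \<times> V" for z
  proof -
    have z: "{z} = {fst z} \<times> {snd z}" by auto
    have "emeasure ?W {z} = emeasure ?U {fst z} * emeasure ?U {snd z}"
      unfolding z using that by (intro U.emeasure_pair_measure_Times) (auto simp: sets_uniform_count_measure)
    also have "\<dots> = ennreal (1 / real (card V) * (1 / real (card V)))"
      using that assms by (subst ennreal_mult) (auto simp: emeasure_uniform_count_measure mem_Times_iff)
    finally show ?thesis by (simp add: measure_def power2_eq_square)
  qed
  have "finite S" using assms finite_subset by blast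
  then have "measure ?W S = (\<Sum>z\<in>S. measure ?W {z})"
    using assms by (intro W.finite_measure_eq_sum_singleton) (auto simp: sets_pair_uniform)
  also have "\<dots> = (\<Sum>z\<in>S. 1 / real (card V) ^ 2)" using sing assms(3) by (intro sum.cong) auto
  finally show ?thesis by simp
qed

lemma measure_PiM_pair_le:
  assumes "finite V" "V \<noteq> {}" "S \<subseteq> V \<times> V" "i \<in> I" "j \<in> I" "i \<noteq> j"
    and "A \<subseteq> {x \<in> space (\<Pi>\<^sub>M i\<in>I. uniform_count_measure V). (x i, x j) \<in> S}"
  shows "measure (\<Pi>\<^sub>M i\<in>I. uniform_count_measure V) A \<le> real (card S) / real (card V) ^ 2"
proof -
  let ?U = "uniform_count_measure V" let ?P = "\<Pi>\<^sub>M i\<in>I. ?U"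
  have pU: "prob_space ?U" using assms by (intro prob_space_uniform)
  interpret P: prob_space ?P using pU by (intro prob_space_PiM)
  have m: "(\<lambda>x. (x i, x j)) \<in> ?P \<rightarrow>\<^sub>M ?U \<Otimes>\<^sub>M ?U"
    using assms by (intro measurable_Pair measurable_component_singleton)
  have S: "S \<in> sets (?U \<Otimes>\<^sub>M ?U)" using assms by (simp add: sets_pair_uniform)
  have eq: "{x \<in> space ?P. (x i, x j) \<in> S} = (\<lambda>x. (x i, x j)) -` S \<inter> space ?P" by auto
  have "measure ?P A \<le> measure ?P ((\<lambda>x. (x i, x j)) -` S \<inter> space ?P)"
    using assms(7) measurable_sets[OF m S] unfolding eq by (intro P.finite_measure_mono)
  also have "\<dots> = measure (distr ?P (?U \<Otimes>\<^sub>M ?U) (\<lambda>x. (x i, x j))) S" by (rule measure_distr[OF m S, symmetric])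
  also have "\<dots> = real (card S) / real (card V) ^ 2"
    unfolding distr_PiM_pair[OF pU assms(4-6)] by (rule measure_pair_uniform[OF assms(1-3)])
  finally show ?thesis .
qed

context
  fixes m :: nat and t :: "nat \<Rightarrow> (nat \<times> nat \<Rightarrow> nat, 'v) ltree" and c :: "nat \<Rightarrow> 'v \<Rightarrow> nat"
    and Z :: "nat \<Rightarrow> real \<Rightarrow> nat"
  assumes t: "\<And>n. distinct_leaves (t n)" "\<And>n. left_light (t n)" "\<And>n. labs (t n) \<subseteq> sym_maps m"
    and c: "\<And>n. \<forall>x\<in>leaves (t n). c n x \<in> {1..m}"
    and card_lim: "filterlim (\<lambda>n. card (leaves (t n))) at_top sequentially"
    and Zm: "\<And>j. Z j \<in> unit_interval \<rightarrow>\<^sub>M count_space UNIV"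
    and Zb: "\<And>j u. u \<in> {0..<1} \<Longrightarrow> Z j u < digit_bound m j"
    and conv: "\<And>(I :: nat set) s R. finite I \<Longrightarrow>
       (\<lambda>n. measure (\<Pi>\<^sub>M i\<in>I. uniform_count_measure (leaves (t n)))
          {x \<in> space (\<Pi>\<^sub>M i\<in>I. uniform_count_measure (leaves (t n))). R (\<lambda>i\<in>I. \<lambda>j\<in>{..<s}. leaf_digit m (t n) (c n) j (x i))})
        \<longlonglongrightarrow> measure (\<Pi>\<^sub>M i\<in>I. unit_interval) {x \<in> space (\<Pi>\<^sub>M i\<in>I. unit_interval). R (\<lambda>i\<in>I. \<lambda>j\<in>{..<s}. Z j (x i))}"
begin

abbreviation "PU I \<equiv> (\<Pi>\<^sub>M i\<in>I. unit_interval) :: (nat \<Rightarrow> real) measure"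
abbreviation "PV I n \<equiv> (\<Pi>\<^sub>M i\<in>I. uniform_count_measure (leaves (t n))) :: (nat \<Rightarrow> 'v) measure"
abbreviation "zeta u \<equiv> (\<lambda>j. Z j u)"
abbreviation "ldig n x \<equiv> (\<lambda>j. leaf_digit m (t n) (c n) j x)"

lemma prob_space_PU: "prob_space (PU I)"
  by (intro prob_space_PiM prob_space_unit_interval)

lemma space_unit: "space unit_interval = {0..<1}"
  by (simp add: space_restrict_space)

lemma digits_event_sets: "finite I \<Longrightarrow> {x \<in> space (PU I). R (\<lambda>i\<in>I. \<lambda>j\<in>{..<s}. Z j (x i))} \<in> sets (PU I)"
  using Zb by (intro measure_PiM_digits(2)[where d = "digit_bound m"] prob_space_unit_interval Zm) (simp_all add: space_unit)

lemma leaf_event_sets: "finite I \<Longrightarrow> {x \<in> space (PV I n). R (\<lambda>i\<in>I. \<lambda>j\<in>{..<s}. leaf_digit m (t n) (c n) j (x i))} \<in> sets (PV I n)"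
proof -
  assume I: "finite I"
  show ?thesis
  proof (rule measure_PiM_digits(2)[where d = "digit_bound m"])
    show "prob_space (uniform_count_measure (leaves (t n)))" by (intro prob_space_uniform) auto
    show "leaf_digit m (t n) (c n) j \<in> uniform_count_measure (leaves (t n)) \<rightarrow>\<^sub>M count_space UNIV" for j
      by (rule measurableI) (auto simp: sets_uniform_count_measure space_uniform_count_measure)
    show "leaf_digit m (t n) (c n) j x < digit_bound m j" if "x \<in> space (uniform_count_measure (leaves (t n)))" for j x
      using leaf_digit_bound[OF t[of n] c[of n]] that by (simp add: space_uniform_count_measure)
  qed (rule I)
qed

text \<open>Each of the countably many inequalities is an event in finitely many digits, so its
  limit probability can be computed along the trees.\<close>

lemma AE_consistent:
  assumes "finite I" "i \<in> I"
  shows "AE x in PU I. consistent (zeta (x i))"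
proof -
  interpret prob_space "PU I" by (rule prob_space_PU)
  have *: "AE x in PU I. cut_digit (zeta (x i)) k s * 2 ^ s' < (cut_digit (zeta (x i)) k s' + 1) * 2 ^ s" for k s s'
  proof -
    let ?b = "stage_bound (k + s + s')"
    define R where "R w \<longleftrightarrow> \<not> cut_digit (w i) k s * 2 ^ s' < (cut_digit (w i) k s' + 1) * 2 ^ s" for w :: "nat \<Rightarrow> nat \<Rightarrow> nat"
    have b: "cut_digit (\<lambda>j\<in>{..<?b}. \<delta> j) k a = cut_digit \<delta> k a" if "a \<le> s + s'" for \<delta> a
      using that by (simp add: cut_digit_def less_stage_bound)
    have R: "R (\<lambda>i\<in>I. \<lambda>j\<in>{..<?b}. \<delta> i j) \<longleftrightarrow> \<not> cut_digit (\<delta> i) k s * 2 ^ s' < (cut_digit (\<delta> i) k s' + 1) * 2 ^ s"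
      for \<delta> :: "nat \<Rightarrow> nat \<Rightarrow> nat"
      using assms(2) by (simp add: R_def b)
    \<comment> \<open>No leaf of any tree violates the inequality, so the probabilities are
      constantly \<open>0\<close>.\<close>
    have e: "{x \<in> space (PV I n). R (\<lambda>i\<in>I. \<lambda>j\<in>{..<?b}. leaf_digit m (t n) (c n) j (x i))} = {}" for n
    proof -
      have "consistent (ldig n (x i))" if "x \<in> space (PV I n)" for x
        using that assms(2) by (intro consistent_leaf_digit t) (auto simp: space_PiM space_uniform_count_measure)
      then show ?thesis unfolding R consistent_def by blast
    qed
    have "measure (PU I) {x \<in> space (PU I). R (\<lambda>i\<in>I. \<lambda>j\<in>{..<?b}. Z j (x i))} = 0"
      using conv[OF assms(1), of R ?b] unfolding e by (simp add: LIMSEQ_const_iff)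
    then have "AE x in PU I. \<not> R (\<lambda>i\<in>I. \<lambda>j\<in>{..<?b}. Z j (x i))"
      using digits_event_sets[OF assms(1), of R ?b] by (subst AE_iff_measurable[OF _ refl]) (auto simp: emeasure_eq_measure)
    then show ?thesis unfolding R by simp
  qed
  have 0: "AE x in PU I. cut_digit (zeta (x i)) k 0 = 0" for k
  proof (rule AE_I2)
    fix x assume "x \<in> space (PU I)"
    then have "x i \<in> {0..<1}" using assms(2) by (auto simp: space_PiM space_unit)
    from Zb[OF this, of "Suc (prod_encode (k, Suc 0))"] show "cut_digit (zeta (x i)) k 0 = 0"
      by (simp add: cut_digit_def digit_bound_def)
  qed
  have "AE x in PU I. (\<forall>k. cut_digit (zeta (x i)) k 0 = 0) \<and>
     (\<forall>k s s'. cut_digit (zeta (x i)) k s * 2 ^ s' < (cut_digit (zeta (x i)) k s' + 1) * 2 ^ s)"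
    using * 0 by (simp add: AE_all_countable)
  then show ?thesis by (simp add: consistent_def)
qed

lemma error_bound_tendsto: "(\<lambda>s. (4 * real s + 5) / 2 ^ s) \<longlonglongrightarrow> 0"
proof -
  have "(\<lambda>s. 4 * (real s * (1 / 2) ^ s) + 5 * (1 / 2) ^ s) \<longlonglongrightarrow> 4 * 0 + 5 * (0 :: real)"
    by (intro tendsto_intros powser_times_n_limit_0) auto
  then show ?thesis by (simp add: power_one_over add_divide_distrib)
qed

lemma inverse_card_tendsto: "(\<lambda>n. 1 / real (card (leaves (t n)))) \<longlonglongrightarrow> 0"
  by (rule real_tendsto_divide_at_top[OF tendsto_const filterlim_compose[OF filterlim_real_sequentially card_lim]])

lemma error_set_subset: "error_set (t n) s \<subseteq> leaves (t n) \<times> leaves (t n)"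
  by (auto simp: error_set_def[OF t[of n] c[of n]] undetected_def[OF t[of n] c[of n]])

lemma measure_leaf_error_le:
  assumes "i \<in> I" "j \<in> I" "i \<noteq> j" "A \<subseteq> {x \<in> space (PV I n). (x i, x j) \<in> error_set (t n) s}"
  shows "measure (PV I n) A \<le> 1 / real (card (leaves (t n))) + (4 * real s + 5) / 2 ^ s"
  using measure_PiM_pair_le[OF finite_leaves leaves_nonempty error_set_subset assms]
    card_error_set[OF t[of n] c[of n], where s = s] by linarith

text \<open>In every tree, being near at stage \<open>s\<close> implies membership in
  \<open>error_set\<close>. The bound \<open>(4 s + 5) / 2^s\<close> is left after \<open>n\<close>
  tends to infinity and vanishes as \<open>s\<close> grows.\<close>

lemma AE_not_near:
  assumes I: "finite I" and ij: "i \<in> I" "j \<in> I" "i \<noteq> j"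
  shows "AE x in PU I. \<exists>s. \<not> digits_near s (zeta (x i)) (zeta (x j))"
proof -
  interpret prob_space "PU I" by (rule prob_space_PU)
  let ?N = "\<lambda>s. {x \<in> space (PU I). digits_near s (zeta (x i)) (zeta (x j))}"
  have N: "?N s \<in> sets (PU I) \<and> measure (PU I) (?N s) \<le> (4 * real s + 5) / 2 ^ s" for s
  proof -
    let ?R = "\<lambda>w :: nat \<Rightarrow> nat \<Rightarrow> nat. digits_near s (w i) (w j)"
    have R: "?R (\<lambda>i\<in>I. \<lambda>j\<in>{..<stage_bound s}. \<delta> i j) \<longleftrightarrow> digits_near s (\<delta> i) (\<delta> j)" for \<delta>
      using ij digits_near_restrict[of s "\<delta> i" "\<delta> j"] by simp
    have "measure (PV I n) {x \<in> space (PV I n). ?R (\<lambda>i\<in>I. \<lambda>j\<in>{..<stage_bound s}. leaf_digit m (t n) (c n) j (x i))}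
       \<le> 1 / real (card (leaves (t n))) + (4 * real s + 5) / 2 ^ s" for n
    proof (rule measure_leaf_error_le[OF ij], rule subsetI)
      fix x assume x: "x \<in> {x \<in> space (PV I n). ?R (\<lambda>i\<in>I. \<lambda>j\<in>{..<stage_bound s}. leaf_digit m (t n) (c n) j (x i))}"
      then have "x i \<in> leaves (t n)" "x j \<in> leaves (t n)" using ij by (auto simp: space_PiM space_uniform_count_measure)
      from approx_adj_leaf(2)[OF t[of n] c[of n] this] x show "x \<in> {x \<in> space (PV I n). (x i, x j) \<in> error_set (t n) s}"
        unfolding mem_Collect_eq R by blast
    qed
    moreover have "(\<lambda>n. 1 / real (card (leaves (t n))) + (4 * real s + 5) / 2 ^ s) \<longlonglongrightarrow> 0 + (4 * real s + 5) / 2 ^ s"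
      by (intro tendsto_add inverse_card_tendsto tendsto_const)
    ultimately have "measure (PU I) {x \<in> space (PU I). ?R (\<lambda>i\<in>I. \<lambda>j\<in>{..<stage_bound s}. Z j (x i))} \<le> 0 + (4 * real s + 5) / 2 ^ s"
      using conv[OF I, of ?R "stage_bound s"] by (intro LIMSEQ_le[of _ _ "\<lambda>n. 1 / real (card (leaves (t n))) + (4 * real s + 5) / 2 ^ s"]) auto
    then show ?thesis using digits_event_sets[OF I, of ?R "stage_bound s"] unfolding R by simp
  qed
  let ?S = "{x \<in> space (PU I). \<forall>s. digits_near s (zeta (x i)) (zeta (x j))}"
  have S: "?S \<in> sets (PU I)"
  proof -
    have "Measurable.pred (PU I) (\<lambda>x. \<forall>s. digits_near s (zeta (x i)) (zeta (x j)))"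
      using N by (intro pred_intros_countable) (simp add: pred_def)
    then show ?thesis by (simp add: pred_def)
  qed
  have "measure (PU I) ?S \<le> (4 * real s + 5) / 2 ^ s" for s
    using N[of s] finite_measure_mono[of ?S "?N s"] by (smt (verit) Collect_mono_iff)
  then have "measure (PU I) ?S \<le> 0" by (intro LIMSEQ_le_const[OF error_bound_tendsto]) auto
  then have "measure (PU I) ?S = 0" by (simp add: measure_le_0_iff)
  then have "AE x in PU I. \<not> (\<forall>s. digits_near s (zeta (x i)) (zeta (x j)))"
    using S by (subst AE_iff_measurable[OF _ refl]) (auto simp: emeasure_eq_measure)
  then show ?thesis by simp
qed

definition limit_leaf :: "real \<Rightarrow> (nat \<Rightarrow> real) \<times> real" where
  "limit_leaf u = (seq_point (zeta u), real (Z 0 u))"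

lemma AE_limit_leaf_neq:
  assumes "finite I" "i \<in> I" "j \<in> I" "i \<noteq> j"
  shows "AE x in PU I. fst (limit_leaf (x i)) \<noteq> fst (limit_leaf (x j))"
  using AE_not_near[OF assms] AE_consistent[OF assms(1,2)] AE_consistent[OF assms(1,3)]
  by eventually_elim (auto simp: limit_leaf_def dest: digits_near_of_eq)

lemma limit_leaf_measurable: "limit_leaf \<in> unit_interval \<rightarrow>\<^sub>M borel"
proof -
  have Zr [measurable]: "(\<lambda>u. real (Z j u)) \<in> borel_measurable unit_interval" for j
    using measurable_compose[OF Zm, of real borel] by simp
  have cut: "real (cut_digit (zeta u) k s) / 2 ^ s \<le> 1" if "u \<in> space unit_interval" for u k s
    using Zb[of u "Suc (prod_encode (k, Suc s))"] that by (simp add: space_unit cut_digit_def digit_bound_def field_simps)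
  have "(\<lambda>u. SUP s. real (cut_digit (zeta u) k s) / 2 ^ s) \<in> borel_measurable unit_interval" for k
  proof (rule borel_measurable_cSUP)
    show "(\<lambda>u. real (cut_digit (zeta u) k s) / 2 ^ s) \<in> borel_measurable unit_interval" for s
      unfolding cut_digit_def by measurable
    show "bdd_above (range (\<lambda>s. real (cut_digit (zeta u) k s) / 2 ^ s))" if "u \<in> space unit_interval" for u
      using cut[OF that] by (intro bdd_aboveI2)
  qed auto
  then have [measurable]: "(\<lambda>u. cut_point (zeta u) k) \<in> borel_measurable unit_interval" for k
    unfolding cut_point_def .
  have "(\<lambda>u. seq_point (zeta u)) \<in> borel_measurable unit_interval"
    unfolding seq_point_def[abs_def] lab_digit_def by (intro measurable_coordinatewise_then_product) measurable
  then show ?thesis unfolding limit_leaf_def[abs_def] by (intro borel_measurable_Pair Zr)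
qed

abbreviation "limit_adj u v \<equiv> interp_adj m (seq_tree m) (limit_leaf u) (limit_leaf v)"

lemma limit_adj_measurable: "(\<lambda>(u, v). limit_adj u v) \<in> unit_interval \<Otimes>\<^sub>M unit_interval \<rightarrow>\<^sub>M count_space UNIV"
proof -
  have b: "borel_space (seq_tree m) = borel" by (simp add: seq_tree_def)
  have E: "(\<lambda>(x, y). interp_adj m (seq_tree m) x y) \<in> borel \<Otimes>\<^sub>M borel \<rightarrow>\<^sub>M count_space UNIV"
    using interp_adj_measurable[OF seq_tree_colored, of euclidean m, unfolded b] compatible_polish_borel by blast
  have "(\<lambda>z. (limit_leaf (fst z), limit_leaf (snd z))) \<in> unit_interval \<Otimes>\<^sub>M unit_interval \<rightarrow>\<^sub>M borel \<Otimes>\<^sub>M borel"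
    using limit_leaf_measurable by (intro measurable_Pair) (auto intro: measurable_compose[rotated])
  from measurable_compose[OF this E] show ?thesis by (simp add: case_prod_unfold)
qed

lemma limit_adj_eventually:
  assumes I: "finite I" and ij: "i \<in> I" "j \<in> I" "i \<noteq> j"
  shows "AE x in PU I. \<forall>\<^sub>F s in sequentially. approx_adj m s (zeta (x i)) (zeta (x j)) \<longleftrightarrow> limit_adj (x i) (x j)"
proof -
  have lab: "lab_digit (zeta u) k < card (sym_maps m)" if "u \<in> {0..<1}" for u k
    using Zb[OF that, of "Suc (prod_encode (k, 0))"] by (simp add: lab_digit_def digit_bound_def)
  have "AE x in PU I. x \<in> space (PU I)" by (rule AE_space)
  then show ?thesis
    using AE_limit_leaf_neq[OF I ij] AE_consistent[OF I ij(1)] AE_consistent[OF I ij(2)]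
  proof eventually_elim
    case (elim x)
    have "x i \<in> {0..<1}" "x j \<in> {0..<1}" using elim(1) ij by (auto simp: space_PiM space_unit)
    then show ?case unfolding limit_leaf_def
      using elim(2) by (intro eventually_approx_adj elim lab) (simp add: limit_leaf_def)
  qed
qed

text \<open>Exchange of limits through the stage \<open>s\<close> densities: \<open>?a n\<close> and
  \<open>?b s n\<close> are close uniformly in \<open>n\<close> up to the vanishing term
  \<open>1 / card\<close>, \<open>?b s n\<close> tends to \<open>?c s\<close> for fixed
  \<open>s\<close>, and \<open>?c s\<close> tends to \<open>?l\<close> by dominated convergence. The
  precision \<open>s\<close> is chosen before \<open>n\<close>.\<close>

lemma edge_dens_tendsto:
  fixes I :: "nat set"
  assumes I: "finite I" and D: "D \<subseteq> I \<times> I" "\<And>i j. (i, j) \<in> D \<Longrightarrow> i \<noteq> j"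
  shows "(\<lambda>n. edge_dens I D (uniform_count_measure (leaves (t n))) (leaf_adj (t n) (c n)))
    \<longlonglongrightarrow> edge_dens I D unit_interval limit_adj"
proof -
  have fin: "finite D" using I D finite_subset by blast
  interpret P: prob_space "PU I" by (rule prob_space_PU)
  let ?a = "\<lambda>n. edge_dens I D (uniform_count_measure (leaves (t n))) (leaf_adj (t n) (c n))"
  let ?l = "edge_dens I D unit_interval limit_adj"
  let ?R = "\<lambda>s (w :: nat \<Rightarrow> nat \<Rightarrow> nat). \<forall>(i, j)\<in>D. approx_adj m s (w i) (w j)"
  let ?b = "\<lambda>s n. measure (PV I n) {x \<in> space (PV I n). \<forall>(i, j)\<in>D. approx_adj m s (ldig n (x i)) (ldig n (x j))}"
  let ?c = "\<lambda>s. measure (PU I) {x \<in> space (PU I). \<forall>(i, j)\<in>D. approx_adj m s (zeta (x i)) (zeta (x j))}"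
  have R: "?R s (\<lambda>i\<in>I. \<lambda>j\<in>{..<stage_bound s}. \<delta> i j) \<longleftrightarrow> (\<forall>(i, j)\<in>D. approx_adj m s (\<delta> i) (\<delta> j))" for s \<delta>
  proof (rule ball_cong[OF refl])
    fix d assume "d \<in> D"
    then obtain i j where d: "d = (i, j)" "i \<in> I" "j \<in> I" using D(1) by blast
    then show "(case d of (i, j) \<Rightarrow> approx_adj m s ((\<lambda>i\<in>I. \<lambda>j\<in>{..<stage_bound s}. \<delta> i j) i) ((\<lambda>i\<in>I. \<lambda>j\<in>{..<stage_bound s}. \<delta> i j) j))
      = (case d of (i, j) \<Rightarrow> approx_adj m s (\<delta> i) (\<delta> j))"
      using approx_adj_restrict[of m s "\<delta> i" "\<delta> j"] by simp
  qed
  have bc: "(\<lambda>n. ?b s n) \<longlonglongrightarrow> ?c s" for s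
    using conv[OF I, of "?R s" "stage_bound s"] unfolding R .
  have pred1: "Measurable.pred (PU I) (\<lambda>x. approx_adj m s (zeta (x i)) (zeta (x j)))" if "i \<in> I" "j \<in> I" for i j s
  proof -
    have "approx_adj m s ((\<lambda>i\<in>I. \<lambda>j\<in>{..<stage_bound s}. \<delta> i j) i) ((\<lambda>i\<in>I. \<lambda>j\<in>{..<stage_bound s}. \<delta> i j) j)
      \<longleftrightarrow> approx_adj m s (\<delta> i) (\<delta> j)" for \<delta> :: "nat \<Rightarrow> nat \<Rightarrow> nat"
      using that approx_adj_restrict[of m s "\<delta> i" "\<delta> j"] by simp
    from digits_event_sets[OF I, of "\<lambda>w. approx_adj m s (w i) (w j)" "stage_bound s", unfolded this]
    show ?thesis by (simp add: pred_def)
  qed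
  have pred2: "Measurable.pred (PV I n) (\<lambda>x. approx_adj m s (ldig n (x i)) (ldig n (x j)))" if "i \<in> I" "j \<in> I" for i j s n
  proof -
    have "approx_adj m s ((\<lambda>i\<in>I. \<lambda>j\<in>{..<stage_bound s}. \<delta> i j) i) ((\<lambda>i\<in>I. \<lambda>j\<in>{..<stage_bound s}. \<delta> i j) j)
      \<longleftrightarrow> approx_adj m s (\<delta> i) (\<delta> j)" for \<delta> :: "nat \<Rightarrow> nat \<Rightarrow> nat"
      using that approx_adj_restrict[of m s "\<delta> i" "\<delta> j"] by simp
    from leaf_event_sets[OF I, of n "\<lambda>w. approx_adj m s (w i) (w j)" "stage_bound s", unfolded this]
    show ?thesis by (simp add: pred_def)
  qed
  have ind: "fst d \<in> I" "snd d \<in> I" "fst d \<noteq> snd d" if "d \<in> D" for d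
    using that D by (cases d; auto)+
  have ab: "\<bar>?a n - ?b s n\<bar> \<le> real (card D) * (1 / real (card (leaves (t n))) + (4 * real s + 5) / 2 ^ s)" for n s
  proof -
    interpret Q: prob_space "PV I n" by (intro prob_space_PiM prob_space_uniform) auto
    let ?p = "\<lambda>d x. leaf_adj (t n) (c n) (x (fst d)) (x (snd d))"
    let ?q = "\<lambda>d x. approx_adj m s (ldig n (x (fst d))) (ldig n (x (snd d)))"
    have "\<bar>measure (PV I n) {x \<in> space (PV I n). \<forall>d\<in>D. ?p d x} - measure (PV I n) {x \<in> space (PV I n). \<forall>d\<in>D. ?q d x}\<bar>
      \<le> (\<Sum>d\<in>D. measure (PV I n) {x \<in> space (PV I n). ?p d x \<noteq> ?q d x})"
    proof (rule Q.measure_ball_diff_le[OF fin])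
      fix d assume d: "d \<in> D"
      show "Measurable.pred (PV I n) (?p d)"
      proof -
        have "(\<lambda>(x, y). leaf_adj (t n) (c n) x y) \<in> uniform_count_measure (leaves (t n)) \<Otimes>\<^sub>M uniform_count_measure (leaves (t n))
          \<rightarrow>\<^sub>M count_space UNIV" by (rule measurable_pair_uniform) simp
        from pred_edges[OF this, of "{d}" I] ind[OF d] show ?thesis by (cases d) simp
      qed
      show "Measurable.pred (PV I n) (?q d)" using pred2 ind[OF d] by blast
    qed
    also have "\<dots> \<le> (\<Sum>d\<in>D. 1 / real (card (leaves (t n))) + (4 * real s + 5) / 2 ^ s)"
    proof (rule sum_mono, rule measure_leaf_error_le[OF ind])
      fix d assume d: "d \<in> D"
      show "{x \<in> space (PV I n). ?p d x \<noteq> ?q d x} \<subseteq> {x \<in> space (PV I n). (x (fst d), x (snd d)) \<in> error_set (t n) s}"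
      proof (rule subsetI)
        fix x assume x: "x \<in> {x \<in> space (PV I n). ?p d x \<noteq> ?q d x}"
        then have "x (fst d) \<in> leaves (t n)" "x (snd d) \<in> leaves (t n)"
          using ind[OF d] by (auto simp: space_PiM space_uniform_count_measure)
        from approx_adj_leaf(1)[OF t[of n] c[of n] this] x
        show "x \<in> {x \<in> space (PV I n). (x (fst d), x (snd d)) \<in> error_set (t n) s}" by blast
      qed
    qed
    finally show ?thesis by (simp add: edge_dens_def case_prod_unfold)
  qed
  define \<eta> where "\<eta> s = (\<Sum>d\<in>D. measure (PU I) {x \<in> space (PU I).
     limit_adj (x (fst d)) (x (snd d)) \<noteq> approx_adj m s (zeta (x (fst d))) (zeta (x (snd d)))})" for s
  have predl: "Measurable.pred (PU I) (\<lambda>x. limit_adj (x i) (x j))" if "i \<in> I" "j \<in> I" for i j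
    using pred_edges[OF limit_adj_measurable, of "{(i, j)}" I] that by simp
  have lc: "\<bar>?l - ?c s\<bar> \<le> \<eta> s" for s
    unfolding edge_dens_def case_prod_unfold \<eta>_def
    using P.measure_ball_diff_le[OF fin, of "\<lambda>d x. limit_adj (x (fst d)) (x (snd d))"
       "\<lambda>d x. approx_adj m s (zeta (x (fst d))) (zeta (x (snd d)))"] predl pred1 ind by blast
  have "\<eta> \<longlonglongrightarrow> (\<Sum>d\<in>D. 0)"
    unfolding \<eta>_def
  proof (intro tendsto_sum P.measure_tendsto_0_AE)
    fix d assume d: "d \<in> D"
    show "{x \<in> space (PU I). limit_adj (x (fst d)) (x (snd d)) \<noteq> approx_adj m s (zeta (x (fst d))) (zeta (x (snd d)))} \<in> sets (PU I)" for s
    proof -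
      note [measurable] = predl[OF ind(1,2)[OF d]] pred1[OF ind(1,2)[OF d]]
      have "Measurable.pred (PU I) (\<lambda>x. limit_adj (x (fst d)) (x (snd d)) \<and> \<not> approx_adj m s (zeta (x (fst d))) (zeta (x (snd d)))
        \<or> \<not> limit_adj (x (fst d)) (x (snd d)) \<and> approx_adj m s (zeta (x (fst d))) (zeta (x (snd d))))"
        using predl[OF ind(1,2)[OF d]] pred1[OF ind(1,2)[OF d]] by (intro pred_intros_logic)
      then show ?thesis by (rule back_subst[of "\<lambda>S. S \<in> sets (PU I)", OF predE]) auto
    qed
    show "AE x in PU I. \<forall>\<^sub>F s in sequentially. x \<notin> {x \<in> space (PU I).
       limit_adj (x (fst d)) (x (snd d)) \<noteq> approx_adj m s (zeta (x (fst d))) (zeta (x (snd d)))}"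
      using limit_adj_eventually[OF I ind[OF d]] by eventually_elim (auto elim: eventually_mono)
  qed
  then have \<eta>: "\<eta> \<longlonglongrightarrow> 0" by simp
  have g: "(\<lambda>s. real (card D) * ((4 * real s + 5) / 2 ^ s) + \<eta> s) \<longlonglongrightarrow> real (card D) * 0 + 0"
    by (intro tendsto_intros error_bound_tendsto \<eta>)
  show ?thesis
  proof (rule LIMSEQ_I)
    fix e :: real assume e: "0 < e"
    have "\<forall>\<^sub>F s in sequentially. real (card D) * ((4 * real s + 5) / 2 ^ s) + \<eta> s < e / 2"
      using order_tendstoD(2)[OF g, of "e / 2"] e by simp
    then obtain s where s: "real (card D) * ((4 * real s + 5) / 2 ^ s) + \<eta> s < e / 2"
      by (auto simp: eventually_sequentially)
    have "(\<lambda>n. real (card D) * (1 / real (card (leaves (t n)))) + \<bar>?b s n - ?c s\<bar>) \<longlonglongrightarrow> real (card D) * 0 + \<bar>?c s - ?c s\<bar>"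
      by (intro tendsto_intros inverse_card_tendsto bc)
    then have "\<forall>\<^sub>F n in sequentially. real (card D) * (1 / real (card (leaves (t n)))) + \<bar>?b s n - ?c s\<bar> < e / 2"
      by (rule order_tendstoD(2)) (use e in simp)
    then have "\<forall>\<^sub>F n in sequentially. norm (?a n - ?l) < e"
    proof eventually_elim
      case (elim n)
      have "\<bar>?a n - ?l\<bar> \<le> \<bar>?a n - ?b s n\<bar> + \<bar>?b s n - ?c s\<bar> + \<bar>?l - ?c s\<bar>" by linarith
      also have "\<dots> \<le> real (card D) * (1 / real (card (leaves (t n)))) + real (card D) * ((4 * real s + 5) / 2 ^ s)
         + \<bar>?b s n - ?c s\<bar> + \<eta> s"
        using ab[of n s] lc[of s] by (simp only: distrib_left)
      also have "\<dots> < e" using elim s by linarith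
      finally show ?case by simp
    qed
    then show "\<exists>no. \<forall>n\<ge>no. norm (?a n - ?l) < e" by (simp add: eventually_sequentially)
  qed
qed

text \<open>The measure is the law of a limit leaf transported to the reals. Its atomlessness comes
  from comparing two independent limit leaves.\<close>

lemma limit_tree_exists:
  "\<exists>(T :: real colored_tree) X \<mu>. colored_borel_tree_semilattice m T \<and> atomless_prob_on T X \<mu>
     \<and> (\<forall>x y. interp_adj m T x y \<longrightarrow> interp_adj m T y x)
     \<and> (\<forall>(I :: nat set) D. finite I \<longrightarrow> D \<subseteq> I \<times> I \<longrightarrow> (\<forall>(i, j)\<in>D. i \<noteq> j) \<longrightarrow>
         (\<lambda>n. edge_dens I D (uniform_count_measure (leaves (t n))) (leaf_adj (t n) (c n)))
           \<longlonglongrightarrow> edge_dens I D \<mu> (interp_adj m T))"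
proof -
  obtain h :: "(nat \<Rightarrow> real) \<times> real \<Rightarrow> real" where h: "inj h" using inj_seq_real by blast
  let ?T = "transport_tree h (seq_tree m)" let ?X = "transport_topology h euclidean"
  let ?M = "borel_space ?T"
  have bT: "?M = embed_measure borel h" by (simp add: transport_tree_def seq_tree_def)
  have T: "colored_borel_tree_semilattice m ?T" by (rule transport_colored[OF h seq_tree_colored])
  have X: "compatible_polish_topology ?X ?M"
    unfolding bT by (rule transport_compatible[OF h compatible_polish_borel])
  define \<Phi> where "\<Phi> u = h (limit_leaf u)" for u
  have \<Phi>: "\<Phi> \<in> unit_interval \<rightarrow>\<^sub>M ?M"
    unfolding bT \<Phi>_def[abs_def] by (rule measurable_compose[OF limit_leaf_measurable measurable_embed_measure2[OF h]])
  let ?\<mu> = "distr unit_interval ?M \<Phi>"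
  interpret U: prob_space unit_interval by (rule prob_space_unit_interval)
  have \<mu>: "prob_space ?\<mu>" using \<Phi> by (rule U.prob_space_distr)
  have "atomless ?\<mu>"
    unfolding atomless_def
  proof
    fix x
    show "emeasure ?\<mu> {x} = 0"
    proof (cases "{x} \<in> sets ?M")
      case True
      define A where "A = \<Phi> -` {x} \<inter> space unit_interval"
      interpret product_prob_space "\<lambda>_ :: nat. unit_interval" by unfold_locales
      have A: "A \<in> sets unit_interval" unfolding A_def using \<Phi> True by (rule measurable_sets)
      have sub: "A \<subseteq> space unit_interval" by (simp add: A_def)
      \<comment> \<open>Two independent points both lie in \<open>A\<close> with probability the
        square of its mass; as their limit leaves almost surely differ, this square is
        \<open>0\<close>.\<close>
      have "AE z in PU {0, 1}. fst (limit_leaf (z 0)) \<noteq> fst (limit_leaf (z 1))"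
        by (rule AE_limit_leaf_neq) simp_all
      then have ae: "AE z in PU {0, 1}. \<not> (z 0 \<in> A \<and> z 1 \<in> A)"
      proof eventually_elim
        case (elim z)
        have "\<Phi> (z 0) \<noteq> \<Phi> (z 1)" using elim h by (auto simp: \<Phi>_def inj_eq)
        then show ?case by (auto simp: A_def)
      qed
      have "(\<Pi>\<^sub>E i\<in>{0, 1 :: nat}. A) = {z \<in> space (PU {0, 1}). z 0 \<in> A \<and> z 1 \<in> A}"
      proof (rule set_eqI)
        fix z :: "nat \<Rightarrow> real"
        show "z \<in> (\<Pi>\<^sub>E i\<in>{0, 1 :: nat}. A) \<longleftrightarrow> z \<in> {z \<in> space (PU {0, 1}). z 0 \<in> A \<and> z 1 \<in> A}"
          unfolding space_PiM PiE_iff mem_Collect_eq ball_simps using sub by blast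
      qed
      then have "emeasure (PU {0, 1}) (\<Pi>\<^sub>E i\<in>{0, 1}. A) = 0"
        using emeasure_eq_0_AE[OF ae] by simp
      moreover have "emeasure (PU {0, 1}) (\<Pi>\<^sub>E i\<in>{0, 1}. A) = (\<Prod>i\<in>{0, 1 :: nat}. emeasure unit_interval A)"
        using A by (intro emeasure_PiM) simp_all
      ultimately have "emeasure unit_interval A = 0" by simp
      then show ?thesis using emeasure_distr[OF \<Phi> True] by (simp add: A_def)
    \<comment> \<open>A nonmeasurable singleton has measure \<open>0\<close> by convention.\<close>
    qed (simp add: emeasure_notin_sets)
  qed
  then have at: "atomless_prob_on ?T ?X ?\<mu>" using X \<mu> by (simp add: atomless_prob_on_def)
  have sym: "interp_adj m ?T y x" if xy: "interp_adj m ?T x y" for x y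
  proof -
    have "x \<in> range h" "y \<in> range h"
      using xy by (auto simp: interp_adj_def transport_tree_def)
    then obtain p q where pq: "x = h p" "y = h q" by blast
    show ?thesis using xy seq_tree_adj_sym unfolding pq transport_adj[OF h] by blast
  qed
  have "edge_dens I D ?\<mu> (interp_adj m ?T) = edge_dens I D unit_interval limit_adj"
    if "finite I" "D \<subseteq> I \<times> I" for I :: "nat set" and D
    unfolding edge_dens_distr[OF that prob_space_unit_interval \<Phi> interp_adj_measurable[OF T X]]
    by (simp add: \<Phi>_def transport_adj[OF h])
  then have "(\<lambda>n. edge_dens I D (uniform_count_measure (leaves (t n))) (leaf_adj (t n) (c n)))
           \<longlonglongrightarrow> edge_dens I D ?\<mu> (interp_adj m ?T)"
    if "finite I" "D \<subseteq> I \<times> I" "\<forall>(i, j)\<in>D. i \<noteq> j" for I :: "nat set" and D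
    using edge_dens_tendsto[OF that(1,2)] that by (simp add: case_prod_unfold) (metis fst_conv snd_conv)
  then show ?thesis using T at sym by (intro exI[of _ ?T] exI[of _ ?X] exI[of _ ?\<mu>]) blast
qed

end

lemma ltree_limit:
  fixes t :: "nat \<Rightarrow> (nat \<times> nat \<Rightarrow> nat, 'v) ltree"
  assumes t: "\<And>n. distinct_leaves (t n)" "\<And>n. left_light (t n)" "\<And>n. labs (t n) \<subseteq> sym_maps m"
    and c: "\<And>n. \<forall>x\<in>leaves (t n). c n x \<in> {1..m}"
    and lim: "filterlim (\<lambda>n. card (leaves (t n))) at_top sequentially"
  shows "\<exists>r (T :: real colored_tree) X \<mu>. strict_mono (r :: nat \<Rightarrow> nat)
     \<and> colored_borel_tree_semilattice m T \<and> atomless_prob_on T X \<mu>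
     \<and> (\<forall>x y. interp_adj m T x y \<longrightarrow> interp_adj m T y x)
     \<and> (\<forall>(I :: nat set) D. finite I \<longrightarrow> D \<subseteq> I \<times> I \<longrightarrow> (\<forall>(i, j)\<in>D. i \<noteq> j) \<longrightarrow>
         (\<lambda>n. edge_dens I D (uniform_count_measure (leaves (t (r n)))) (leaf_adj (t (r n)) (c (r n))))
           \<longlonglongrightarrow> edge_dens I D \<mu> (interp_adj m T))"
proof -
  let ?M = "\<lambda>n. uniform_count_measure (leaves (t n))"
  have "\<exists>r Z. strict_mono (r :: nat \<Rightarrow> nat) \<and> (\<forall>j. Z j \<in> unit_interval \<rightarrow>\<^sub>M count_space UNIV)
    \<and> (\<forall>j. \<forall>u\<in>{0..<1}. Z j u < digit_bound m j)
    \<and> (\<forall>(I :: nat set) s R. finite I \<longrightarrow>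
       (\<lambda>n. measure (\<Pi>\<^sub>M i\<in>I. ?M (r n)) {x \<in> space (\<Pi>\<^sub>M i\<in>I. ?M (r n)). R (\<lambda>i\<in>I. \<lambda>j\<in>{..<s}. leaf_digit m (t (r n)) (c (r n)) j (x i))})
        \<longlonglongrightarrow> measure (\<Pi>\<^sub>M i\<in>I. unit_interval) {x \<in> space (\<Pi>\<^sub>M i\<in>I. unit_interval). R (\<lambda>i\<in>I. \<lambda>j\<in>{..<s}. Z j (x i))})"
  proof (rule exists_limit_digits)
    show "prob_space (?M n)" for n by (intro prob_space_uniform) auto
    show "leaf_digit m (t n) (c n) j \<in> ?M n \<rightarrow>\<^sub>M count_space UNIV" for n j
      by (rule measurableI) (auto simp: sets_uniform_count_measure space_uniform_count_measure)
    show "leaf_digit m (t n) (c n) j x < digit_bound m j" if "x \<in> space (?M n)" for n j x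
      using leaf_digit_bound[OF t[of n] c[of n]] that by (simp add: space_uniform_count_measure)
  qed
  then obtain r Z where r: "strict_mono (r :: nat \<Rightarrow> nat)"
    and Z: "\<And>j. Z j \<in> unit_interval \<rightarrow>\<^sub>M count_space UNIV" "\<And>j u. u \<in> {0..<1} \<Longrightarrow> Z j u < digit_bound m j"
    and conv: "\<And>(I :: nat set) s R. finite I \<Longrightarrow>
       (\<lambda>n. measure (\<Pi>\<^sub>M i\<in>I. ?M (r n)) {x \<in> space (\<Pi>\<^sub>M i\<in>I. ?M (r n)). R (\<lambda>i\<in>I. \<lambda>j\<in>{..<s}. leaf_digit m (t (r n)) (c (r n)) j (x i))})
        \<longlonglongrightarrow> measure (\<Pi>\<^sub>M i\<in>I. unit_interval) {x \<in> space (\<Pi>\<^sub>M i\<in>I. unit_interval). R (\<lambda>i\<in>I. \<lambda>j\<in>{..<s}. Z j (x i))}"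
    by blast
  have "filterlim (\<lambda>n. card (leaves (t (r n)))) at_top sequentially"
    using filterlim_compose[OF lim filterlim_subseq[OF r]] .
  then have T: "\<exists>(T :: real colored_tree) X \<mu>. colored_borel_tree_semilattice m T \<and> atomless_prob_on T X \<mu>
     \<and> (\<forall>x y. interp_adj m T x y \<longrightarrow> interp_adj m T y x)
     \<and> (\<forall>(I :: nat set) D. finite I \<longrightarrow> D \<subseteq> I \<times> I \<longrightarrow> (\<forall>(i, j)\<in>D. i \<noteq> j) \<longrightarrow>
         (\<lambda>n. edge_dens I D (uniform_count_measure (leaves (t (r n)))) (leaf_adj (t (r n)) (c (r n))))
           \<longlonglongrightarrow> edge_dens I D \<mu> (interp_adj m T))"
    by (rule limit_tree_exists[of "\<lambda>n. t (r n)" m "\<lambda>n. c (r n)" Z, OF t(1) t(2) t(3) c _ Z conv])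
  show ?thesis
  proof (rule exI[of _ r])
    show "\<exists>(T :: real colored_tree) X \<mu>. strict_mono r \<and> colored_borel_tree_semilattice m T \<and> atomless_prob_on T X \<mu>
     \<and> (\<forall>x y. interp_adj m T x y \<longrightarrow> interp_adj m T y x)
     \<and> (\<forall>(I :: nat set) D. finite I \<longrightarrow> D \<subseteq> I \<times> I \<longrightarrow> (\<forall>(i, j)\<in>D. i \<noteq> j) \<longrightarrow>
         (\<lambda>n. edge_dens I D (uniform_count_measure (leaves (t (r n)))) (leaf_adj (t (r n)) (c (r n))))
           \<longlonglongrightarrow> edge_dens I D \<mu> (interp_adj m T))"
      using T by (elim exE) (rule exI, rule exI, rule exI, rule conjI[OF r])
  qed
qed

subsection \<open>The two directions\<close>

context
  fixes m :: nat and T :: "'a colored_tree" and X :: "'a topology" and \<mu> :: "'a measure"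
  assumes T: "colored_borel_tree_semilattice m T" and A: "atomless_prob_on T X \<mu>"
begin

lemma interp_adj_irrefl: "\<not> interp_adj m T x x"
  by (simp add: interp_adj_def)

lemma id_measurable_pair_interp:
  "(\<lambda>z. z) \<in> interp_measure X \<mu> \<Otimes>\<^sub>M interp_measure X \<mu> \<rightarrow>\<^sub>M borel_space T \<Otimes>\<^sub>M borel_space T"
proof -
  have "(\<lambda>x. x) \<in> interp_measure X \<mu> \<rightarrow>\<^sub>M borel_space T"
    using id_measurable_interp[OF A] measurable_cong_sets[OF refl atomless_prob_on_top(6)[OF A]] by blast
  then have "(\<lambda>z. (fst z, snd z)) \<in> interp_measure X \<mu> \<Otimes>\<^sub>M interp_measure X \<mu> \<rightarrow>\<^sub>M borel_space T \<Otimes>\<^sub>M borel_space T"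
    by (intro measurable_Pair) (auto intro: measurable_compose[rotated])
  then show ?thesis by simp
qed

lemma compatible_borel_space: "compatible_polish_topology X (borel_space T)"
  using A by (simp add: atomless_prob_on_def)

lemma interp_adj_measurable_interp:
  "(\<lambda>(x, y). interp_adj m T x y) \<in> interp_measure X \<mu> \<Otimes>\<^sub>M interp_measure X \<mu> \<rightarrow>\<^sub>M count_space UNIV"
  using measurable_compose[OF id_measurable_pair_interp interp_adj_measurable[OF T compatible_borel_space]] .

lemma diagonal_interp:
  "{z \<in> space (interp_measure X \<mu> \<Otimes>\<^sub>M interp_measure X \<mu>). fst z = snd z} \<in> sets (interp_measure X \<mu> \<Otimes>\<^sub>M interp_measure X \<mu>)"
proof -
  have "Measurable.pred (borel_space T \<Otimes>\<^sub>M borel_space T) (\<lambda>z. fst z = snd z)"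
    using diagonal_measurable[OF compatible_borel_space] by (simp add: pred_def)
  from measurable_compose[OF id_measurable_pair_interp this] show ?thesis by (simp add: pred_def)
qed

lemma atomless_interp: "atomless (interp_measure X \<mu>)"
  unfolding atomless_def
proof
  fix x assume "x \<in> space (interp_measure X \<mu>)"
  then have x: "x \<in> measure_support X \<mu>" by (simp add: space_interp_measure[OF A])
  then have "x \<in> space \<mu>" using sets.sets_into_space[OF support_in_sets[OF A]] by blast
  then have "emeasure \<mu> {x} = 0" using A by (simp add: atomless_prob_on_def atomless_def)
  then show "emeasure (interp_measure X \<mu>) {x} = 0"
    unfolding interp_measure_def using x support_in_sets[OF A]
    by (subst emeasure_restrict_space) (auto dest: sets.sets_into_space)
qed

lemma edge_dens_interp:
  assumes "finite I" "D \<subseteq> I \<times> I"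
  shows "edge_dens I D (interp_measure X \<mu>) (interp_adj m T) = edge_dens I D \<mu> (interp_adj m T)"
proof -
  have "sets (\<mu> \<Otimes>\<^sub>M \<mu>) = sets (borel_space T \<Otimes>\<^sub>M borel_space T)"
    using atomless_prob_on_top(6)[OF A] by (intro sets_pair_measure_cong)
  then have E: "(\<lambda>(x, y). interp_adj m T x y) \<in> \<mu> \<Otimes>\<^sub>M \<mu> \<rightarrow>\<^sub>M count_space UNIV"
    using interp_adj_measurable[OF T compatible_borel_space] measurable_cong_sets[OF _ refl] by blast
  show ?thesis
    using edge_dens_distr[OF assms prob_space_interp[OF A] id_measurable_interp[OF A] E] distr_interp[OF A] by simp
qed

lemma borel_graph_interp:
  assumes "\<forall>x\<in>space (interp_measure X \<mu>). \<forall>y\<in>space (interp_measure X \<mu>).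
    interp_adj m T x y \<longrightarrow> interp_adj m T y x"
  shows "borel_graph (interp_measure X \<mu>) (interp_adj m T)"
proof -
  let ?\<nu> = "interp_measure X \<mu>"
  have "{(x, y). x \<in> space ?\<nu> \<and> y \<in> space ?\<nu> \<and> interp_adj m T x y}
    = {z \<in> space (?\<nu> \<Otimes>\<^sub>M ?\<nu>). case z of (x, y) \<Rightarrow> interp_adj m T x y}"
    by (auto simp: space_pair_measure)
  also have "\<dots> \<in> sets (?\<nu> \<Otimes>\<^sub>M ?\<nu>)" using interp_adj_measurable_interp by (rule predE)
  finally show ?thesis
    unfolding borel_graph_def using assms standard_borel_interp[OF A] prob_space_interp[OF A] by blast
qed

lemma interp_qf_limitI:
  assumes sym: "\<forall>x\<in>space (interp_measure X \<mu>). \<forall>y\<in>space (interp_measure X \<mu>).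
      interp_adj m T x y \<longrightarrow> interp_adj m T y x"
    and G: "\<And>n. finite_graph (G n)" "\<And>n. verts (G n) \<noteq> {}"
    and card: "filterlim (\<lambda>n. card (verts (G n))) at_top sequentially"
    and lim: "\<And>p D. D \<subseteq> all_edges p \<Longrightarrow>
      (\<lambda>n. edge_dens {..<p} D (uniform_count_measure (verts (G n))) (adj (G n)))
        \<longlonglongrightarrow> edge_dens {..<p} D (interp_measure X \<mu>) (interp_adj m T)"
  shows "qf_limit G (interp_measure X \<mu>) (interp_adj m T)"
  using sym
  by (intro qf_limitI[OF prob_space_interp[OF A] atomless_interp diagonal_interp
      interp_adj_measurable_interp _ interp_adj_irrefl G card lim]) blast+

lemma interp_is_qf_limit:
  assumes m: "m \<ge> 1"
    and sym: "\<forall>x\<in>space (interp_measure X \<mu>). \<forall>y\<in>space (interp_measure X \<mu>).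
      interp_adj m T x y \<longrightarrow> interp_adj m T y x"
  shows "\<exists>G. (\<forall>n. m_partite_cograph m (G n)) \<and> qf_limit G (interp_measure X \<mu>) (interp_adj m T)"
proof -
  let ?\<nu> = "interp_measure X \<mu>" and ?E = "interp_adj m T"
  obtain N \<omega> where w: "\<And>n. n < N n \<and> \<omega> n \<in> {..<N n} \<rightarrow>\<^sub>E space ?\<nu> \<and> inj_on (\<omega> n) {..<N n}"
    and lim: "\<And>p D. D \<subseteq> all_edges p \<Longrightarrow>
      (\<lambda>n. sample_dens ?E {..<p} D (N n) (\<omega> n)) \<longlonglongrightarrow> edge_dens {..<p} D ?\<nu> ?E"
    using exists_good_samples[OF prob_space_interp[OF A] interp_adj_measurable_interp atomless_interp diagonal_interp]
    by blast
  define G where "G n = \<lparr>verts = {..<N n}, adj = \<lambda>i j. ?E (\<omega> n i) (\<omega> n j)\<rparr>" for n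
  have G: "m_partite_cograph m (G n)" for n
    unfolding G_def
  proof (rule interp_sample_m_partite[OF m T])
    show "0 < N n" "inj_on (\<omega> n) {..<N n}" using w[of n] by auto
    have in_space: "\<omega> n i \<in> space ?\<nu>" if "i < N n" for i using w[of n] that by auto
    have "space ?\<nu> \<subseteq> space (borel_space T)"
      using space_interp_measure[OF A] sets.sets_into_space[OF support_in_sets[OF A]] atomless_prob_on_top(5)[OF A] by simp
    then show "\<omega> n ` {..<N n} \<subseteq> space (borel_space T)" using in_space by auto
    show "?E (\<omega> n j) (\<omega> n i)" if "i < N n" "j < N n" "?E (\<omega> n i) (\<omega> n j)" for i j
      using sym in_space that by blast
  qed
  have "qf_limit G ?\<nu> ?E"
  proof (rule interp_qf_limitI[OF sym])
    show "finite_graph (G n)" for n using G by (simp add: m_partite_cograph_def)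
    have "0 < N n" for n using w[of n] by auto
    then show "verts (G n) \<noteq> {}" for n by (simp add: G_def lessThan_empty_iff)
    have "n \<le> card (verts (G n))" for n using w[of n] by (simp add: G_def)
    then show "filterlim (\<lambda>n. card (verts (G n))) at_top sequentially"
      by (intro filterlim_at_top_mono[OF filterlim_ident]) auto
    show "(\<lambda>n. edge_dens {..<p} D (uniform_count_measure (verts (G n))) (adj (G n))) \<longlonglongrightarrow> edge_dens {..<p} D ?\<nu> ?E"
      if "D \<subseteq> all_edges p" for p D
      using lim[OF that] unfolding sample_dens_def[OF prob_space_interp[OF A] interp_adj_measurable_interp]
      by (simp add: G_def)
  qed
  then show ?thesis using G by blast
qed

end

section \<open>Limits of left-convergent sequences\<close>

lemma distr_fst_uniform:
  assumes "finite V" "V \<noteq> {}"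
  shows "distr (uniform_count_measure (V \<times> {..n :: nat})) (uniform_count_measure V) fst = uniform_count_measure V"
proof (rule measure_eqI_finite[of _ V])
  let ?U = "uniform_count_measure (V \<times> {..n})" and ?V = "uniform_count_measure V"
  show "sets (distr ?U ?V fst) = Pow V" "sets ?V = Pow V" by (simp_all add: sets_uniform_count_measure)
  fix a assume a: "a \<in> V"
  have m: "fst \<in> ?U \<rightarrow>\<^sub>M ?V"
    by (rule measurableI) (auto simp: sets_uniform_count_measure space_uniform_count_measure)
  have "emeasure (distr ?U ?V fst) {a} = emeasure ?U (fst -` {a} \<inter> space ?U)"
    using a by (intro emeasure_distr[OF m]) (simp add: sets_uniform_count_measure)
  also have "fst -` {a} \<inter> space ?U = {a} \<times> {..n}" using a by (auto simp: space_uniform_count_measure)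
  also have "emeasure ?U ({a} \<times> {..n}) = ennreal (real (Suc n) / real (card V * Suc n))"
    using a assms by (subst emeasure_uniform_count_measure) (auto simp: card_cartesian_product)
  also have "real (Suc n) / real (card V * Suc n) = 1 / real (card V)"
    by (simp only: of_nat_mult) simp
  also have "ennreal (1 / real (card V)) = emeasure ?V {a}"
    using a assms by (simp add: emeasure_uniform_count_measure)
  finally show "emeasure (distr ?U ?V fst) {a} = emeasure ?V {a}" .
qed (rule assms)

text \<open>Blowing up every vertex into an independent set changes no homomorphism density, so the graphs
  may be assumed to grow.\<close>

lemma m_partite_cograph_blow_up:
  assumes "m_partite_cograph m G"
  shows "\<exists>t c. distinct_leaves t \<and> left_light t \<and> labs t \<subseteq> sym_maps m \<and> leaves t = verts G \<times> {..n :: nat}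
    \<and> (\<forall>x\<in>leaves t. c x \<in> {1..m})
    \<and> (\<forall>x\<in>leaves t. \<forall>y\<in>leaves t. leaf_adj t c x y \<longleftrightarrow> adj G (fst x) (fst y))"
proof -
  obtain t0 c where t0: "distinct_leaves t0" "leaves t0 = verts G" "labs t0 \<subseteq> sym_maps m"
    and c: "\<And>x. x \<in> verts G \<Longrightarrow> c x \<in> {1..m}"
    and adj: "\<And>x y. x \<in> verts G \<Longrightarrow> y \<in> verts G \<Longrightarrow> x \<noteq> y \<Longrightarrow> adj G x y \<longleftrightarrow> lca_lab t0 x y (c x, c y) = 1"
    using m_partite_cograph_imp_ltree[OF assms] by metis
  define f0 where "f0 = (\<lambda>z\<in>{1..m} \<times> {1..m}. 0 :: nat)"
  have f0: "f0 \<in> sym_maps m" by (auto simp: f0_def sym_maps_def binary_maps_def)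
  have irr: "\<not> adj G x x" if "x \<in> verts G" for x
    using assms that by (auto simp: m_partite_cograph_def finite_graph_def)
  obtain t where t: "distinct_leaves t" "left_light t" "leaves t = leaves (blow_up f0 n t0)" "labs t = labs (blow_up f0 n t0)"
    and lca: "\<forall>x\<in>leaves (blow_up f0 n t0). \<forall>y\<in>leaves (blow_up f0 n t0). x \<noteq> y \<longrightarrow>
      lca_lab t x y = lca_lab (blow_up f0 n t0) x y"
    using exists_left_light[OF distinct_leaves_blow_up[OF t0(1), of f0 n]] by (elim exE conjE) (rule that)
  have lv: "leaves t = verts G \<times> {..n}" using t(3) t0(2) by (simp add: leaves_blow_up)
  have labs: "labs t \<subseteq> sym_maps m" using t(4) labs_blow_up[of f0 n t0] t0(3) f0 by blast
  have col: "\<forall>x\<in>leaves t. (c \<circ> fst) x \<in> {1..m}"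
    using c lv by auto
  have "leaf_adj t (c \<circ> fst) x y \<longleftrightarrow> adj G (fst x) (fst y)" if xy: "x \<in> leaves t" "y \<in> leaves t" for x y
  proof -
    obtain v i w j where e: "x = (v, i)" "y = (w, j)" by force
    have vw: "v \<in> verts G" "w \<in> verts G" "i \<le> n" "j \<le> n" using xy lv e by auto
    show ?thesis
    proof (cases "x = y")
      case True
      then show ?thesis using irr vw e by (simp add: leaf_adj_def[OF t(1,2) labs col])
    next
      case False
      have "lca_lab t x y = (if v = w then f0 else lca_lab t0 v w)"
        using lca xy False t(3) lca_lab_blow_up[OF t0(1), of v w i n j f0] vw t0(2) e by simp
      moreover have "f0 (c v, c w) = 0" using c vw by (simp add: f0_def)
      ultimately show ?thesis
        using False irr[OF vw(1)] adj[OF vw(1,2)] e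
        by (cases "v = w") (simp_all add: leaf_adj_def[OF t(1,2) labs col])
    qed
  qed
  then show ?thesis using t(1,2) labs lv col by (intro exI[of _ t] exI[of _ "c \<circ> fst"]) blast
qed

text \<open>The limit is built from blow-ups, which grow in any case, so the left limit holds
  without a condition on the sizes. The QF-limit concerns the graphs \<open>G n\<close> themselves,
  where the mass of repeated entries must vanish.\<close>

lemma left_convergent_has_limit:
  assumes G: "\<And>n. m_partite_cograph m (G n)" and lc: "left_convergent G"
  shows "\<exists>(T :: real colored_tree) X \<mu>.
     colored_borel_tree_semilattice m T \<and> atomless_prob_on T X \<mu>
     \<and> borel_graph (interp_measure X \<mu>) (interp_adj m T)
     \<and> (filterlim (\<lambda>n. card (verts (G n))) at_top sequentially \<longrightarrow>
          qf_limit G (interp_measure X \<mu>) (interp_adj m T))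
     \<and> left_limit G (interp_measure X \<mu>) (random_free_graphon (interp_adj m T))"
proof -
  have fg: "finite_graph (G n)" for n using G by (simp add: m_partite_cograph_def)
  define Q where "Q n t c \<longleftrightarrow> distinct_leaves t \<and> left_light t \<and> labs t \<subseteq> sym_maps m \<and> leaves t = verts (G n) \<times> {..n}
    \<and> (\<forall>x\<in>leaves t. c x \<in> {1..m})
    \<and> (\<forall>x\<in>leaves t. \<forall>y\<in>leaves t. leaf_adj t c x y \<longleftrightarrow> adj (G n) (fst x) (fst y))" for n t c
  have "\<exists>t c. Q n t c" for n unfolding Q_def by (rule m_partite_cograph_blow_up[OF G])
  then obtain t c where Q: "\<And>n. Q n (t n) (c n)" by metis
  have tc: "distinct_leaves (t n)" "left_light (t n)" "labs (t n) \<subseteq> sym_maps m"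
    "leaves (t n) = verts (G n) \<times> {..n}" "\<forall>x\<in>leaves (t n). c n x \<in> {1..m}"
    "\<forall>x\<in>leaves (t n). \<forall>y\<in>leaves (t n). leaf_adj (t n) (c n) x y \<longleftrightarrow> adj (G n) (fst x) (fst y)" for n
    using Q[of n, unfolded Q_def] by - (elim conjE, assumption)+
  have fin: "finite (verts (G n))" for n using fg by (simp add: finite_graph_def)
  have ne: "verts (G n) \<noteq> {}" for n using tc(4)[of n] leaves_nonempty[of "t n"] by auto
  \<comment> \<open>The blow-up factor \<open>n + 1\<close> alone already exceeds \<open>n\<close>;
    the vertex sets are nonempty because trees have leaves.\<close>
  have "n \<le> card (leaves (t n))" for n
  proof -
    have "1 \<le> card (verts (G n))" using fin ne by (simp add: Suc_le_eq card_gt_0_iff)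
    then have "1 * Suc n \<le> card (verts (G n)) * Suc n" by (rule mult_le_mono1)
    then show ?thesis by (simp add: tc(4) card_cartesian_product)
  qed
  then have lim: "filterlim (\<lambda>n. card (leaves (t n))) at_top sequentially"
    by (intro filterlim_at_top_mono[OF filterlim_ident]) auto
  have dens: "edge_dens I D (uniform_count_measure (leaves (t n))) (leaf_adj (t n) (c n))
     = edge_dens I D (uniform_count_measure (verts (G n))) (adj (G n))"
    if "finite I" "D \<subseteq> I \<times> I" for I :: "nat set" and D n
  proof -
    let ?U = "uniform_count_measure (verts (G n) \<times> {..n})" and ?V = "uniform_count_measure (verts (G n))"
    have pU: "prob_space ?U" using fin ne by (intro prob_space_uniform) auto
    have m: "fst \<in> ?U \<rightarrow>\<^sub>M ?V"
      by (rule measurableI) (auto simp: sets_uniform_count_measure space_uniform_count_measure)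
    have "edge_dens I D ?U (leaf_adj (t n) (c n)) = edge_dens I D ?U (\<lambda>x y. adj (G n) (fst x) (fst y))"
      by (rule edge_dens_cong[OF refl _ that(2)]) (use tc(6)[of n, unfolded tc(4)] in \<open>simp only: space_uniform_count_measure\<close>)
    also have "\<dots> = edge_dens I D (distr ?U ?V fst) (adj (G n))"
      by (rule edge_dens_distr[OF that pU m measurable_pair_uniform[OF fin], symmetric])
    finally show ?thesis by (simp add: tc(4) distr_fst_uniform[OF fin ne])
  qed
  have "\<exists>r (T :: real colored_tree) X \<mu>. strict_mono (r :: nat \<Rightarrow> nat)
     \<and> colored_borel_tree_semilattice m T \<and> atomless_prob_on T X \<mu>
     \<and> (\<forall>x y. interp_adj m T x y \<longrightarrow> interp_adj m T y x)
     \<and> (\<forall>(I :: nat set) D. finite I \<longrightarrow> D \<subseteq> I \<times> I \<longrightarrow> (\<forall>(i, j)\<in>D. i \<noteq> j) \<longrightarrow>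
         (\<lambda>n. edge_dens I D (uniform_count_measure (leaves (t (r n)))) (leaf_adj (t (r n)) (c (r n))))
           \<longlonglongrightarrow> edge_dens I D \<mu> (interp_adj m T))"
    by (rule ltree_limit[OF tc(1,2,3,5) lim])
  then obtain r :: "nat \<Rightarrow> nat" and T :: "real colored_tree" and X \<mu> where r: "strict_mono r"
    and T: "colored_borel_tree_semilattice m T" and A: "atomless_prob_on T X \<mu>"
    and sym: "\<forall>x y. interp_adj m T x y \<longrightarrow> interp_adj m T y x"
    and conv: "\<forall>(I :: nat set) D. finite I \<longrightarrow> D \<subseteq> I \<times> I \<longrightarrow> (\<forall>(i, j)\<in>D. i \<noteq> j) \<longrightarrow>
         (\<lambda>n. edge_dens I D (uniform_count_measure (leaves (t (r n)))) (leaf_adj (t (r n)) (c (r n))))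
           \<longlonglongrightarrow> edge_dens I D \<mu> (interp_adj m T)"
    by (elim exE conjE) (rule that)
  let ?\<nu> = "interp_measure X \<mu>" and ?E = "interp_adj m T"
  have sym': "\<forall>x\<in>space ?\<nu>. \<forall>y\<in>space ?\<nu>. ?E x y \<longrightarrow> ?E y x" using sym by blast
  have hom: "(\<lambda>n. hom_density F (G n)) \<longlonglongrightarrow> edge_dens (verts F) (lt_edges F) ?\<nu> ?E" if F: "finite_graph F" for F
  proof -
    have fF: "finite (verts F)" using F by (simp add: finite_graph_def)
    \<comment> \<open>Left convergence provides a limit for the whole sequence; the subsequence only
      identifies it.\<close>
    obtain L where L: "(\<lambda>n. hom_density F (G n)) \<longlonglongrightarrow> L"
      using lc F by (auto simp: left_convergent_def convergent_def)
    have "(\<lambda>n. hom_density F (G (r n))) \<longlonglongrightarrow> L"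
      using LIMSEQ_subseq_LIMSEQ[OF L r] by (simp add: comp_def)
    moreover have "(\<lambda>n. hom_density F (G (r n))) \<longlonglongrightarrow> edge_dens (verts F) (lt_edges F) \<mu> ?E"
    proof -
      have "\<forall>(i, j)\<in>lt_edges F. i \<noteq> j" by (auto simp: lt_edges_def)
      then show ?thesis
        using conv[rule_format, OF fF lt_edges_subset] unfolding dens[OF fF lt_edges_subset] hom_density_eq_edge_dens[OF F fg ne]
        by blast
    qed
    ultimately have "L = edge_dens (verts F) (lt_edges F) \<mu> ?E" by (rule LIMSEQ_unique)
    then show ?thesis using L edge_dens_interp[OF T A fF lt_edges_subset] by simp
  qed
  have ll: "left_limit G ?\<nu> (random_free_graphon ?E)"
    unfolding left_limit_def
    using hom graphon_density_eq_edge_dens[OF _ prob_space_interp[OF A] interp_adj_measurable_interp[OF T A]] by simp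
  have qf: "qf_limit G ?\<nu> ?E" if card: "filterlim (\<lambda>n. card (verts (G n))) at_top sequentially"
  proof (rule interp_qf_limitI[OF T A sym' fg ne card])
    fix p D assume D: "D \<subseteq> all_edges p"
    \<comment> \<open>Every set of increasing pairs below \<open>p\<close> is the edge set of a
      finite graph, so the densities demanded by the QF criterion are homomorphism
      densities.\<close>
    let ?F = "\<lparr>verts = {..<p}, adj = \<lambda>i j. (i, j) \<in> D \<or> (j, i) \<in> D\<rparr>"
    have F: "finite_graph ?F" using D by (auto simp: finite_graph_def all_edges_def)
    have "lt_edges ?F = D" using D by (auto simp: lt_edges_def all_edges_def)
    then show "(\<lambda>n. edge_dens {..<p} D (uniform_count_measure (verts (G n))) (adj (G n))) \<longlonglongrightarrow> edge_dens {..<p} D ?\<nu> ?E"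
      using hom[OF F] unfolding hom_density_eq_edge_dens[OF F fg ne] by simp
  qed
  show ?thesis
    by (intro exI[of _ T] exI[of _ X] exI[of _ \<mu>] conjI impI T A borel_graph_interp[OF T A sym'] ll qf)
qed

text \<open>The QF-limit is tied to growing vertex sets because \<open>Eq 0 1\<close> has pairing
  \<open>1 / card (verts (G n))\<close> in a finite graph and \<open>0\<close> in an atomless one.
  In the converse the symmetry of adjacency is a premise because node labels may be asymmetric maps,
  whereas edges of a Borel graph are symmetric.\<close>

theorem theorem6p3:
  fixes m :: nat
  assumes "m \<ge> 1"
  shows
    "(\<forall>G. (\<forall>n. m_partite_cograph m (G n)) \<and> left_convergent G \<longrightarrow>
        (\<exists>(T :: real colored_tree) X \<mu>.
           colored_borel_tree_semilattice m T \<and> atomless_prob_on T X \<mu>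
           \<and> borel_graph (interp_measure X \<mu>) (interp_adj m T)
           \<and> (filterlim (\<lambda>n. card (verts (G n))) at_top sequentially \<longrightarrow>
                qf_limit G (interp_measure X \<mu>) (interp_adj m T))
           \<and> left_limit G (interp_measure X \<mu>) (random_free_graphon (interp_adj m T))))
     \<and> (\<forall>(T :: 'a colored_tree) X \<mu>.
          colored_borel_tree_semilattice m T \<and> atomless_prob_on T X \<mu>
          \<and> (\<forall>x\<in>space (interp_measure X \<mu>). \<forall>y\<in>space (interp_measure X \<mu>).
                interp_adj m T x y \<longrightarrow> interp_adj m T y x) \<longrightarrow>
          borel_graph (interp_measure X \<mu>) (interp_adj m T)
          \<and> (\<exists>G. (\<forall>n. m_partite_cograph m (G n))
                \<and> qf_limit G (interp_measure X \<mu>) (interp_adj m T)))"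
proof (intro conjI allI impI; (elim conjE)?)
  fix G assume "\<forall>n. m_partite_cograph m (G n)" "left_convergent G"
  then show "\<exists>(T :: real colored_tree) X \<mu>.
     colored_borel_tree_semilattice m T \<and> atomless_prob_on T X \<mu>
     \<and> borel_graph (interp_measure X \<mu>) (interp_adj m T)
     \<and> (filterlim (\<lambda>n. card (verts (G n))) at_top sequentially \<longrightarrow>
          qf_limit G (interp_measure X \<mu>) (interp_adj m T))
     \<and> left_limit G (interp_measure X \<mu>) (random_free_graphon (interp_adj m T))"
    by (intro left_convergent_has_limit) simp_all
next
  fix T :: "'a colored_tree" and X \<mu>
  assume T: "colored_borel_tree_semilattice m T" "atomless_prob_on T X \<mu>"
    and sym: "\<forall>x\<in>space (interp_measure X \<mu>). \<forall>y\<in>space (interp_measure X \<mu>).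
       interp_adj m T x y \<longrightarrow> interp_adj m T y x"
  show "borel_graph (interp_measure X \<mu>) (interp_adj m T)" by (rule borel_graph_interp[OF T sym])
  show "\<exists>G. (\<forall>n. m_partite_cograph m (G n)) \<and> qf_limit G (interp_measure X \<mu>) (interp_adj m T)"
    by (rule interp_is_qf_limit[OF T assms sym])
qed

end
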